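(* Let $A\in\mathbb{Z}^{d\times n}$ have rank $d$ with columns lying in an affine hyperplane of $\mathbb{Q}^d$ not containing the origin, let $\beta\in\mathbb{C}^d$, let $w\in\mathbb{R}^n$ be a generic weight vector, and let $v$ be a fake exponent of $H_A(\beta)$ with respect to $w$. Assume that $B$ is a $\mathbb{Z}$-basis of $L=\ker_{\mathbb{Z}}(A)$ and that $P=m(s)P_B$. Then $$\sum_{q\geq0}\dim_{\mathbb{C}}C_v(q)\,t^q=H_{w,v}(t).$$ In particular, $$\max\{q\geq0\mid C_v(q)\neq0\}=\operatorname{fdeg}_w(v)\quad\text{and}\quad\dim_{\mathbb{C}}C_v=H_{w,v}(1).$$
   Context: Notation: $\mathbb{N}=\{0,1,2,\ldots\}$, $[n]=\{1,\ldots,n\}$, $L=\ker_{\mathbb{Z}}(A)$. The toric ideal is $I_A=\langle\partial^u-\partial^{u'}\mid Au=Au',\ u,u'\in\mathbb{N}^n\rangle\subseteq\mathbb{C}[\partial_1,\ldots,\partial_n]$. $\operatorname{in}_w(I_A)$ is the ideal generated by the $w$-initial forms (sums of terms of maximal $w$-weight) of elements of $I_A$; "$w$ generic" means in particular that $\operatorname{in}_w(I_A)$ is a monomial ideal. Let $D=\mathbb{C}\langle x_1,\ldots,x_n,\partial_1,\ldots,\partial_n\rangle$ be the Weyl algebra and $\vartheta_j=x_j\partial_j$. $H_A(\beta)$ is the left ideal of $D$ generated by $I_A$ and the Euler operators $\sum_j a_{ij}\vartheta_j-\beta_i$. The fake indicial ideal is $(D\cdot\operatorname{in}_w(I_A)\cap\mathbb{C}[\vartheta])+\langle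 A\vartheta-\beta\rangle\subseteq\mathbb{C}[\vartheta]$; a zero $v\in\mathbb{C}^n$ of it is called a fake exponent of $H_A(\beta)$ with respect to $w$. $\operatorname{nsupp}(z)=\{j\in[n]\mid z_j\in\mathbb{Z}_{<0}\}$ for $z\in\mathbb{C}^n$. For $u\in L$ put $I_u=\operatorname{nsupp}(v+u)$, so $I_0=\operatorname{nsupp}(v)$; put $V=[n]\setminus I_0$. A standard pair of a monomial ideal $M\subseteq\mathbb{C}[\partial]$ is a pair $(a,\sigma)$, $a\in\mathbb{N}^n$, $\sigma\subseteq[n]$, such that (i) $a_i=0$ for $i\in\sigma$; (ii) $\partial^a\prod_{j\in\sigma}\partial_j^{b_j}\notin M$ for all $b_j\in\mathbb{N}$; (iii) for every $\ell\notin\sigma$ there are $b_j\in\mathbb{N}$ ($j\in\sigma\cup\{\ell\}$) with $\partial^a\prod_{j\in\sigma\cup\{\ell\}}\partial_j^{b_j}\in M$. $\mathcal{S}(M)$ is the set of standard pairs, and $\mathcal{S}_w(v)=\{(a,\sigma)\in\mathcal{S}(\operatorname{in}_w(I_A))\mid v_j=a_j\text{ for every }j\notin\sigma\}$. (Known criterion: $v$ is a fake exponent iff $Av=\beta$ and $\mathcal{S}_w(v)\neq\emptyset$.) $\Delta_w(v)=\{\tau\subseteq[n]\mid\tau\subseteq\sigma\text{ for some }(a,\sigma)\in\mathcal{S}_w(v)\}$, and $\operatorname{link}_v=\{\tau\in\Delta_w(v)\mid\tau\cap I_0=\emptyset,\ \tau\cup I_0\in\Delta_w(v)\}$, regarded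 as a simplicial complex on the vertex set $V$ (some elements of $V$ may be nonfaces). For a simplicial complex $\Delta$ on $V$, $I_\Delta=\langle\prod_{i\in\tau}x_i\mid\tau\subseteq V,\ \tau\notin\Delta\rangle$ and $\mathbb{C}[\Delta]=\mathbb{C}[x_i\mid i\in V]/I_\Delta$. Write $k=|I_0|$, $I_0=\{i_1,\ldots,i_k\}$, and $\langle A\theta\rangle=\langle\sum_j a_{ij}\theta_j\mid i=1,\ldots,d\rangle\subseteq\mathbb{C}[\theta_1,\ldots,\theta_n]$. By row reduction, $\langle A\theta\rangle$ has generators $\theta_{i_p}-L_p(\theta_V)$ ($1\le p\le k$), $\ell_q(\theta_V)$ ($1\le q\le d-k$), with $L_p,\ell_q$ linear forms in the variables $\theta_j$, $j\in V$. Via $\theta_j\mapsto x_j$ regard $\ell_q\in\mathbb{C}[\operatorname{link}_v]$, and define $H_{w,v}(t)=\operatorname{Hilb}\bigl(\mathbb{C}[\operatorname{link}_v]/(\ell_1,\ldots,\ell_{d-|I_0|}),t\bigr)$, the Hilbert series; the quotient is finite-dimensional, so this is a polynomial, and it is independent of the choice of the $L_p,\ell_q$. Put $\operatorname{fdeg}_w(v)=\deg H_{w,v}(t)$. Frobenius data. Let $\{\partial^{g_+^{(i)}}-\partial^{g_-^{(i)}}\mid i=1,\ldots,m\}$ be the reduced Gröbner basis of $I_A$ with respect to $w$, with $\partial^{g_+^{(i)}}\in\operatorname{in}_w(I_A)$; put $g^{(i)}=g_+^{(i)}-g_-^{(i)}$, $G^{(i)}=I_{-g^{(i)}}\setminus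 I_0$, $C(w)=\sum_{i=1}^m\mathbb{N}g^{(i)}$. For a $\mathbb{Z}$-basis $B=\{b^{(1)},\ldots,b^{(h)}\}$ of $L$ ($h=n-d$), put $(Bs)_j=\sum_{k=1}^h b^{(k)}_js_k\in\mathbb{C}[s]=\mathbb{C}[s_1,\ldots,s_h]$ and $(Bs)^F=\prod_{j\in F}(Bs)_j$ for $F\subseteq[n]$. Let $$\operatorname{NS}_w(v)=\{I_u\mid u\in L,\ u'\in C(w)\text{ for every }u'\in L\text{ with }I_{u'}=I_u\},$$ let $\operatorname{NS}_w^c(v)=\{I_u\mid u\in L\}\setminus\operatorname{NS}_w(v)$, and $K=\bigcap_{I\in\operatorname{NS}_w(v)}I$. Define the ideals and element of $\mathbb{C}[s]$ $$P=\langle(Bs)^{(I\cup J)\setminus K}\mid I\in\operatorname{NS}_w(v),\ J\in\operatorname{NS}_w^c(v)\rangle,\quad m(s)=(Bs)^{I_0\setminus K},\quad P_B=\langle(Bs)^{G^{(i)}}\mid i=1,\ldots,m\rangle.$$ Series solutions. A series solution with exponent $v$ in the direction $w$ is a solution of $H_A(\beta)$ of the form $\phi=x^v\sum_{u\in L}g_u(\log x)x^u$ with $g_0\neq0$, where the $g_u\in\mathbb{C}[\log x_1,\ldots,\log x_n]$ have uniformly bounded degree and $\{u\mid g_u\neq0\}$ lies in a pointed rational cone on which $w\cdot u>0$ for $u\neq0$ (the usual convention for series in the direction $w$). $C_v$ is the vector space consisting of $0$ and all leading coefficients $g_0$ of such solutions, and $C_v(q)=C_v\cap\mathbb{C}[\log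 x_1,\ldots,\log x_n]_q$ is its part homogeneous of degree $q$. *)

theory Defs
  imports
    "HOL-Analysis.Analysis"
    "HOL-Library.Poly_Mapping"
    "HOL-Computational_Algebra.Polynomial_FPS"
begin

type_synonym 'x cpoly = "('x \<Rightarrow>\<^sub>0 nat) \<Rightarrow>\<^sub>0 complex"

definition monom :: "('x \<Rightarrow>\<^sub>0 nat) \<Rightarrow> 'x cpoly" where
  "monom u = Poly_Mapping.single u 1"

definition var :: "'x \<Rightarrow> 'x cpoly" where
  "var j = monom (Poly_Mapping.single j 1)"

definition const :: "complex \<Rightarrow> 'x cpoly" where
  "const c = Poly_Mapping.single 0 c"

definition cscale :: "complex \<Rightarrow> 'x cpoly \<Rightarrow> 'x cpoly" where
  "cscale c p = const c * p"

interpretation cpoly: vector_space "cscale :: complex \<Rightarrow> 'x cpoly \<Rightarrow> 'x cpoly"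
proof unfold_locales
  show "cscale c (cscale d p) = cscale (c * d) p" for c d and p :: "'x cpoly"
    unfolding cscale_def const_def mult.assoc[symmetric] mult_single by simp
qed (simp_all add: cscale_def const_def single_add distrib_left distrib_right)

definition peval :: "complex ^ 'n \<Rightarrow> 'n::finite cpoly \<Rightarrow> complex" where
  "peval v p = (\<Sum>u\<in>Poly_Mapping.keys p.
     Poly_Mapping.lookup p u * (\<Prod>j\<in>UNIV. (v $ j) ^ Poly_Mapping.lookup u j))"

definition pdiff :: "'x \<Rightarrow> 'x cpoly \<Rightarrow> 'x cpoly" where
  "pdiff j p = (\<Sum>u\<in>Poly_Mapping.keys p.
     Poly_Mapping.single (u - Poly_Mapping.single j 1)
       (of_nat (Poly_Mapping.lookup u j) * Poly_Mapping.lookup p u))"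

definition mdeg :: "('x \<Rightarrow>\<^sub>0 nat) \<Rightarrow> nat" where
  "mdeg u = (\<Sum>j\<in>Poly_Mapping.keys u. Poly_Mapping.lookup u j)"

definition homog :: "nat \<Rightarrow> 'x cpoly set" where
  "homog q = {p. \<forall>u\<in>Poly_Mapping.keys p. mdeg u = q}"

definition polys_in :: "'x set \<Rightarrow> 'x cpoly set" where
  "polys_in V = {p. \<forall>u\<in>Poly_Mapping.keys p. Poly_Mapping.keys u \<subseteq> V}"

definition linear_forms :: "'x set \<Rightarrow> 'x cpoly set" where
  "linear_forms V = polys_in V \<inter> homog 1"

definition ideal :: "'x cpoly set \<Rightarrow> 'x cpoly set" where
  "ideal S = module.span (*) S"

definition ideal_in :: "'x set \<Rightarrow> 'x cpoly set \<Rightarrow> 'x cpoly set" where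
  "ideal_in V S = {\<Sum>g\<in>F. c g * g | F c. finite F \<and> F \<subseteq> S \<and> (\<forall>g\<in>F. c g \<in> polys_in V)}"
  \<comment> \<open>for \<open>S \<subseteq> polys_in V\<close>: the ideal generated by \<open>S\<close> in the polynomial ring with variables \<open>V\<close>\<close>

definition monomial_ideal :: "'x cpoly set \<Rightarrow> bool" where
  "monomial_ideal M \<longleftrightarrow> (\<exists>U. M = ideal (monom ` U))"

definition weight :: "real ^ 'n \<Rightarrow> ('n::finite \<Rightarrow>\<^sub>0 nat) \<Rightarrow> real" where
  "weight w u = (\<Sum>j\<in>UNIV. w $ j * real (Poly_Mapping.lookup u j))"

definition init_form :: "real ^ 'n \<Rightarrow> 'n::finite cpoly \<Rightarrow> 'n cpoly" where
  "init_form w f =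
     (\<Sum>u\<in>{u \<in> Poly_Mapping.keys f. \<forall>u'\<in>Poly_Mapping.keys f. weight w u' \<le> weight w u}.
        Poly_Mapping.single u (Poly_Mapping.lookup f u))"

definition init_ideal :: "real ^ 'n \<Rightarrow> 'n::finite cpoly set \<Rightarrow> 'n cpoly set" where
  "init_ideal w I = ideal (init_form w ` I)"

definition reduced_groebner_basis ::
    "real ^ 'n \<Rightarrow> 'n::finite cpoly set \<Rightarrow> 'n cpoly set \<Rightarrow> bool" where
  "reduced_groebner_basis w I G \<longleftrightarrow>
     finite G \<and> G \<subseteq> I \<and> ideal (init_form w ` G) = init_ideal w I \<and>
     (\<forall>g\<in>G. \<exists>u. init_form w g = monom u \<and>
        monom u \<notin> ideal (init_form w ` (G - {g})) \<and>
        (\<forall>u'\<in>Poly_Mapping.keys g - {u}. monom u' \<notin> init_ideal w I))"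

definition standard_pairs :: "'n cpoly set \<Rightarrow> (('n \<Rightarrow>\<^sub>0 nat) \<times> 'n set) set" where
  "standard_pairs M = {(a, \<sigma>).
     (\<forall>i\<in>\<sigma>. Poly_Mapping.lookup a i = 0) \<and>
     (\<forall>b. Poly_Mapping.keys b \<subseteq> \<sigma> \<longrightarrow> monom (a + b) \<notin> M) \<and>
     (\<forall>l. l \<notin> \<sigma> \<longrightarrow> (\<exists>b. Poly_Mapping.keys b \<subseteq> insert l \<sigma> \<and> monom (a + b) \<in> M))}"

text \<open>A formal series \<open>\<Sum>z. g\<^sub>z(log x) x\<^sup>z\<close> over exponents \<open>z \<in> \<complex>\<^sup>n\<close> is represented by the
  function \<open>z \<mapsto> g\<^sub>z\<close>, the polynomial variable \<open>j\<close> of \<open>g\<^sub>z\<close> standing for \<open>log x\<^sub>j\<close>.\<close>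

type_synonym 'n logseries = "complex ^ 'n \<Rightarrow> 'n cpoly"

definition x_op :: "'n::finite \<Rightarrow> 'n logseries \<Rightarrow> 'n logseries" where
  "x_op j \<phi> = (\<lambda>z. \<phi> (z - axis j 1))"

text \<open>\<open>\<partial>\<^sub>j (g(log x) x\<^sup>y) = (y\<^sub>j g + \<partial>g/\<partial>(log x\<^sub>j))(log x) x\<^bsup>y - e\<^sub>j\<^esup>\<close>, read off at \<open>z = y - e\<^sub>j\<close>.\<close>

definition d_op :: "'n::finite \<Rightarrow> 'n logseries \<Rightarrow> 'n logseries" where
  "d_op j \<phi> = (\<lambda>z. cscale (z $ j + 1) (\<phi> (z + axis j 1)) + pdiff j (\<phi> (z + axis j 1)))"

definition theta_op :: "'n::finite \<Rightarrow> 'n logseries \<Rightarrow> 'n logseries" where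
  "theta_op j = x_op j \<circ> d_op j"

text \<open>The Weyl algebra \<open>D\<close>, realised as the algebra of operators on logarithmic series generated
  by the \<open>x\<^sub>j\<close> and \<open>\<partial>\<^sub>j\<close>. These satisfy the Weyl relations (proved below), and since the Weyl
  algebra over \<open>\<complex>\<close> is simple, this nonzero representation is faithful.\<close>

inductive_set weyl :: "('n::finite logseries \<Rightarrow> 'n logseries) set" where
  scalar: "(\<lambda>\<phi> z. cscale c (\<phi> z)) \<in> weyl"
| x: "x_op j \<in> weyl"
| d: "d_op j \<in> weyl"
| add: "P \<in> weyl \<Longrightarrow> Q \<in> weyl \<Longrightarrow> (\<lambda>\<phi> z. P \<phi> z + Q \<phi> z) \<in> weyl"
| mult: "P \<in> weyl \<Longrightarrow> Q \<in> weyl \<Longrightarrow> P \<circ> Q \<in> weyl"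

inductive_set left_ideal ::
    "('n::finite logseries \<Rightarrow> 'n logseries) set \<Rightarrow> ('n logseries \<Rightarrow> 'n logseries) set"
  for S where
  zero: "(\<lambda>\<phi> z. 0) \<in> left_ideal S"
| gen: "P \<in> S \<Longrightarrow> P \<in> left_ideal S"
| add: "P \<in> left_ideal S \<Longrightarrow> Q \<in> left_ideal S \<Longrightarrow> (\<lambda>\<phi> z. P \<phi> z + Q \<phi> z) \<in> left_ideal S"
| mult: "P \<in> weyl \<Longrightarrow> Q \<in> left_ideal S \<Longrightarrow> P \<circ> Q \<in> left_ideal S"

text \<open>Substitution of operators into a polynomial. It is only used for the commuting families
  \<open>d_op\<close> and \<open>theta_op\<close>, for which the fold does not depend on the order of the factors.\<close>

definition mon_op ::
    "('n \<Rightarrow> 'n logseries \<Rightarrow> 'n logseries) \<Rightarrow> ('n::finite \<Rightarrow>\<^sub>0 nat) \<Rightarrow> 'n logseries \<Rightarrow> 'n logseries" where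
  "mon_op T u = Finite_Set.fold (\<lambda>j S. (T j ^^ Poly_Mapping.lookup u j) \<circ> S) id UNIV"

definition poly_op ::
    "('n \<Rightarrow> 'n logseries \<Rightarrow> 'n logseries) \<Rightarrow> 'n::finite cpoly \<Rightarrow> 'n logseries \<Rightarrow> 'n logseries" where
  "poly_op T p = (\<lambda>\<phi> z. \<Sum>u\<in>Poly_Mapping.keys p. cscale (Poly_Mapping.lookup p u) (mon_op T u \<phi> z))"

definition expo :: "('n::finite \<Rightarrow>\<^sub>0 nat) \<Rightarrow> int ^ 'n" where
  "expo u = (\<chi> j. int (Poly_Mapping.lookup u j))"

definition cvec :: "int ^ 'n \<Rightarrow> complex ^ 'n::finite" where
  "cvec u = (\<chi> j. of_int (u $ j))"

definition rvec :: "int ^ 'n \<Rightarrow> real ^ 'n::finite" where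
  "rvec u = (\<chi> j. of_int (u $ j))"

definition kerZ :: "int ^ 'n ^ 'd::finite \<Rightarrow> (int ^ 'n::finite) set" where
  "kerZ A = {u. A *v u = 0}"

definition toric_ideal :: "int ^ 'n ^ 'd::finite \<Rightarrow> 'n::finite cpoly set" where
  "toric_ideal A = ideal {monom u - monom u' | u u'. A *v expo u = A *v expo u'}"

definition Aform :: "int ^ 'n ^ 'd::finite \<Rightarrow> 'd \<Rightarrow> 'n::finite cpoly" where
  "Aform A i = (\<Sum>j\<in>UNIV. cscale (of_int (A $ i $ j)) (var j))"

definition hypergeometric_ideal ::
    "int ^ 'n ^ 'd::finite \<Rightarrow> complex ^ 'd \<Rightarrow> ('n::finite logseries \<Rightarrow> 'n logseries) set" where
  "hypergeometric_ideal A \<beta> =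
     left_ideal (poly_op d_op ` toric_ideal A \<union>
                 {poly_op theta_op (Aform A i - const (\<beta> $ i)) | i. True})"

definition generic_weight :: "int ^ 'n ^ 'd::finite \<Rightarrow> real ^ 'n::finite \<Rightarrow> bool" where
  "generic_weight A w \<longleftrightarrow> monomial_ideal (init_ideal w (toric_ideal A))"

definition fake_indicial_ideal ::
    "int ^ 'n ^ 'd::finite \<Rightarrow> complex ^ 'd \<Rightarrow> real ^ 'n::finite \<Rightarrow> 'n cpoly set" where
  "fake_indicial_ideal A \<beta> w =
     {p + q | p q.
        poly_op theta_op p \<in> left_ideal (poly_op d_op ` init_ideal w (toric_ideal A)) \<and>
        q \<in> ideal {Aform A i - const (\<beta> $ i) | i. True}}"

definition fake_exponent ::
    "int ^ 'n ^ 'd::finite \<Rightarrow> complex ^ 'd \<Rightarrow> real ^ 'n::finite \<Rightarrow> complex ^ 'n \<Rightarrow> bool" where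
  "fake_exponent A \<beta> w v \<longleftrightarrow> (\<forall>p\<in>fake_indicial_ideal A \<beta> w. peval v p = 0)"

definition nsupp :: "complex ^ 'n \<Rightarrow> 'n::finite set" where
  "nsupp z = {j. \<exists>k::int. k < 0 \<and> z $ j = of_int k}"

definition nsuppL :: "complex ^ 'n \<Rightarrow> int ^ 'n \<Rightarrow> 'n::finite set" where
  "nsuppL v u = nsupp (v + cvec u)"

definition std_pairs_at ::
    "int ^ 'n ^ 'd::finite \<Rightarrow> real ^ 'n::finite \<Rightarrow> complex ^ 'n \<Rightarrow> (('n \<Rightarrow>\<^sub>0 nat) \<times> 'n set) set" where
  "std_pairs_at A w v = {(a, \<sigma>) \<in> standard_pairs (init_ideal w (toric_ideal A)).
     \<forall>j. j \<notin> \<sigma> \<longrightarrow> v $ j = of_nat (Poly_Mapping.lookup a j)}"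

definition Delta ::
    "int ^ 'n ^ 'd::finite \<Rightarrow> real ^ 'n::finite \<Rightarrow> complex ^ 'n \<Rightarrow> 'n set set" where
  "Delta A w v = {\<tau>. \<exists>(a, \<sigma>)\<in>std_pairs_at A w v. \<tau> \<subseteq> \<sigma>}"

definition link ::
    "int ^ 'n ^ 'd::finite \<Rightarrow> real ^ 'n::finite \<Rightarrow> complex ^ 'n \<Rightarrow> 'n set set" where
  "link A w v = {\<tau> \<in> Delta A w v. \<tau> \<inter> nsupp v = {} \<and> \<tau> \<union> nsupp v \<in> Delta A w v}"

definition stanley_reisner_ideal :: "'x set \<Rightarrow> 'x set set \<Rightarrow> 'x cpoly set" where
  "stanley_reisner_ideal V \<Delta> = ideal_in V {\<Prod>i\<in>\<tau>. var i | \<tau>. \<tau> \<subseteq> V \<and> \<tau> \<notin> \<Delta>}"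

definition row_reduction ::
    "int ^ 'n ^ 'd::finite \<Rightarrow> 'n::finite set \<Rightarrow> ('n \<Rightarrow> 'n cpoly) \<Rightarrow> (nat \<Rightarrow> 'n cpoly) \<Rightarrow> bool" where
  "row_reduction A I Lf ell \<longleftrightarrow>
     (\<forall>p\<in>I. Lf p \<in> linear_forms (- I)) \<and>
     (\<forall>q < CARD('d) - card I. ell q \<in> linear_forms (- I)) \<and>
     ideal (range (Aform A)) =
       ideal ({var p - Lf p | p. p \<in> I} \<union> {ell q | q. q < CARD('d) - card I})"

definition quotient_hilbert_series :: "'x::finite set \<Rightarrow> 'x cpoly set \<Rightarrow> int fps" where
  "quotient_hilbert_series V J = Abs_fps (\<lambda>q.
     int (cpoly.dim (polys_in V \<inter> homog q)) - int (cpoly.dim (J \<inter> homog q)))"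
  \<comment> \<open>\<open>J \<subseteq> polys_in V\<close> a homogeneous ideal; the degree \<open>q\<close> part of the polynomial ring is
     finite-dimensional, so the coefficient is the dimension of the degree \<open>q\<close> part of the quotient\<close>

definition H_series ::
    "int ^ 'n ^ 'd::finite \<Rightarrow> real ^ 'n::finite \<Rightarrow> complex ^ 'n \<Rightarrow> (nat \<Rightarrow> 'n cpoly) \<Rightarrow> int fps" where
  "H_series A w v ell =
     quotient_hilbert_series (- nsupp v)
       (ideal_in (- nsupp v)
          (stanley_reisner_ideal (- nsupp v) (link A w v) \<union>
           {ell q | q. q < CARD('d) - card (nsupp v)}))"

definition H_poly ::
    "int ^ 'n ^ 'd::finite \<Rightarrow> real ^ 'n::finite \<Rightarrow> complex ^ 'n \<Rightarrow> (nat \<Rightarrow> 'n cpoly) \<Rightarrow> int poly" where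
  "H_poly A w v ell = (THE p. fps_of_poly p = H_series A w v ell)"

definition fdeg ::
    "int ^ 'n ^ 'd::finite \<Rightarrow> real ^ 'n::finite \<Rightarrow> complex ^ 'n \<Rightarrow> (nat \<Rightarrow> 'n cpoly) \<Rightarrow> nat" where
  "fdeg A w v ell = degree (H_poly A w v ell)"

text \<open>A Groebner basis of binomials \<open>\<partial>\<^sup>p - \<partial>\<^sup>q\<close> with \<open>\<partial>\<^sup>p\<close> initial is given by the set \<open>G\<close> of
  the exponent pairs \<open>(p, q)\<close>.\<close>

definition binomial_groebner_basis ::
    "int ^ 'n ^ 'd::finite \<Rightarrow> real ^ 'n::finite \<Rightarrow> (('n \<Rightarrow>\<^sub>0 nat) \<times> ('n \<Rightarrow>\<^sub>0 nat)) set \<Rightarrow> bool" where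
  "binomial_groebner_basis A w G \<longleftrightarrow>
     reduced_groebner_basis w (toric_ideal A) ((\<lambda>(p, q). monom p - monom q) ` G) \<and>
     (\<forall>(p, q)\<in>G. monom p \<in> init_ideal w (toric_ideal A))"

definition gvec :: "('n \<Rightarrow>\<^sub>0 nat) \<times> ('n \<Rightarrow>\<^sub>0 nat) \<Rightarrow> int ^ 'n::finite" where
  "gvec g = expo (fst g) - expo (snd g)"

definition Cw :: "(('n \<Rightarrow>\<^sub>0 nat) \<times> ('n \<Rightarrow>\<^sub>0 nat)) set \<Rightarrow> (int ^ 'n::finite) set" where
  "Cw G = {\<Sum>g\<in>G. int (c g) *s gvec g | c. True}"

definition NS ::
    "int ^ 'n ^ 'd::finite \<Rightarrow> complex ^ 'n \<Rightarrow> (('n \<Rightarrow>\<^sub>0 nat) \<times> ('n \<Rightarrow>\<^sub>0 nat)) set \<Rightarrow> 'n::finite set set" where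
  "NS A v G = {nsuppL v u | u. u \<in> kerZ A \<and>
     (\<forall>u'\<in>kerZ A. nsuppL v u' = nsuppL v u \<longrightarrow> u' \<in> Cw G)}"

definition NSc ::
    "int ^ 'n ^ 'd::finite \<Rightarrow> complex ^ 'n \<Rightarrow> (('n \<Rightarrow>\<^sub>0 nat) \<times> ('n \<Rightarrow>\<^sub>0 nat)) set \<Rightarrow> 'n::finite set set" where
  "NSc A v G = nsuppL v ` kerZ A - NS A v G"

definition Z_basis :: "nat \<Rightarrow> (nat \<Rightarrow> int ^ 'n) \<Rightarrow> (int ^ 'n::finite) set \<Rightarrow> bool" where
  "Z_basis h b L \<longleftrightarrow> inj_on b {..<h} \<and> \<not> module.dependent (*s) (b ` {..<h}) \<and>
     module.span (*s) (b ` {..<h}) = L"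

definition Bs :: "nat \<Rightarrow> (nat \<Rightarrow> int ^ 'n) \<Rightarrow> 'n::finite \<Rightarrow> nat cpoly" where
  "Bs h b j = (\<Sum>k<h. cscale (of_int (b k $ j)) (var k))"

definition Bs_prod :: "nat \<Rightarrow> (nat \<Rightarrow> int ^ 'n) \<Rightarrow> 'n::finite set \<Rightarrow> nat cpoly" where
  "Bs_prod h b F = (\<Prod>j\<in>F. Bs h b j)"

definition P_ideal ::
    "int ^ 'n ^ 'd::finite \<Rightarrow> complex ^ 'n \<Rightarrow> (('n \<Rightarrow>\<^sub>0 nat) \<times> ('n \<Rightarrow>\<^sub>0 nat)) set \<Rightarrow>
      nat \<Rightarrow> (nat \<Rightarrow> int ^ 'n::finite) \<Rightarrow> nat cpoly set" where
  "P_ideal A v G h b =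
     ideal_in {..<h} {Bs_prod h b ((I \<union> J) - \<Inter> (NS A v G)) | I J. I \<in> NS A v G \<and> J \<in> NSc A v G}"

definition m_elem ::
    "int ^ 'n ^ 'd::finite \<Rightarrow> complex ^ 'n \<Rightarrow> (('n \<Rightarrow>\<^sub>0 nat) \<times> ('n \<Rightarrow>\<^sub>0 nat)) set \<Rightarrow>
      nat \<Rightarrow> (nat \<Rightarrow> int ^ 'n::finite) \<Rightarrow> nat cpoly" where
  "m_elem A v G h b = Bs_prod h b (nsupp v - \<Inter> (NS A v G))"

definition PB_ideal ::
    "complex ^ 'n \<Rightarrow> (('n \<Rightarrow>\<^sub>0 nat) \<times> ('n \<Rightarrow>\<^sub>0 nat)) set \<Rightarrow>
      nat \<Rightarrow> (nat \<Rightarrow> int ^ 'n::finite) \<Rightarrow> nat cpoly set" where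
  "PB_ideal v G h b = ideal_in {..<h} {Bs_prod h b (nsuppL v (- gvec g) - nsupp v) | g. g \<in> G}"

definition rational_cone :: "(real ^ 'n::finite) set \<Rightarrow> bool" where
  "rational_cone S \<longleftrightarrow> (\<exists>F. finite F \<and> S = convex_cone hull (rvec ` F))"

definition pointed_cone :: "(real ^ 'n::finite) set \<Rightarrow> bool" where
  "pointed_cone S \<longleftrightarrow> (\<forall>x\<in>S. - x \<in> S \<longrightarrow> x = 0)"

definition series_solution ::
    "int ^ 'n ^ 'd::finite \<Rightarrow> complex ^ 'd \<Rightarrow> real ^ 'n::finite \<Rightarrow> complex ^ 'n \<Rightarrow> 'n logseries \<Rightarrow> bool" where
  "series_solution A \<beta> w v \<phi> \<longleftrightarrow>
     (\<forall>T\<in>hypergeometric_ideal A \<beta>. T \<phi> = (\<lambda>z. 0)) \<and>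
     (\<forall>z. \<phi> z \<noteq> 0 \<longrightarrow> (\<exists>u\<in>kerZ A. z = v + cvec u)) \<and>
     \<phi> v \<noteq> 0 \<and>
     (\<exists>N. \<forall>z. \<forall>m\<in>Poly_Mapping.keys (\<phi> z). mdeg m \<le> N) \<and>
     (\<exists>S. rational_cone S \<and> pointed_cone S \<and> (\<forall>x\<in>S. x \<noteq> 0 \<longrightarrow> w \<bullet> x > 0) \<and>
          (\<forall>u\<in>kerZ A. \<phi> (v + cvec u) \<noteq> 0 \<longrightarrow> rvec u \<in> S))"

definition Cv ::
    "int ^ 'n ^ 'd::finite \<Rightarrow> complex ^ 'd \<Rightarrow> real ^ 'n::finite \<Rightarrow> complex ^ 'n \<Rightarrow> 'n cpoly set" where
  "Cv A \<beta> w v = insert 0 {\<phi> v | \<phi>. series_solution A \<beta> w v \<phi>}"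

definition Cv_deg ::
    "int ^ 'n ^ 'd::finite \<Rightarrow> complex ^ 'd \<Rightarrow> real ^ 'n::finite \<Rightarrow> complex ^ 'n \<Rightarrow> nat \<Rightarrow> 'n cpoly set" where
  "Cv_deg A \<beta> w v q = Cv A \<beta> w v \<inter> homog q"

lemma lookup_cscale: "Poly_Mapping.lookup (cscale c p) u = c * Poly_Mapping.lookup p u"
proof -
  have "cscale c p = Poly_Mapping.map ((*) c) p"
    unfolding cscale_def const_def by (simp add: mult_map_scale_conv_mult)
  then show ?thesis by (simp add: Poly_Mapping.map.rep_eq when_def)
qed

lemma lookup_pdiff:
  "Poly_Mapping.lookup (pdiff j p) u =
     of_nat (Poly_Mapping.lookup u j + 1) * Poly_Mapping.lookup p (u + Poly_Mapping.single j 1)"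
proof -
  let ?e = "Poly_Mapping.single j (1::nat)"
  let ?f = "\<lambda>t. of_nat (Poly_Mapping.lookup t j) * Poly_Mapping.lookup p t"
  have eq: "t = u + ?e" if "t - ?e = u" "Poly_Mapping.lookup t j \<noteq> 0" for t
  proof (rule poly_mapping_eqI)
    fix i
    have "Poly_Mapping.lookup u i = Poly_Mapping.lookup t i - Poly_Mapping.lookup ?e i"
      using that(1) lookup_minus by metis
    then show "Poly_Mapping.lookup t i = Poly_Mapping.lookup (u + ?e) i"
      using that(2) by (auto simp: lookup_add lookup_single when_def)
  qed
  have "Poly_Mapping.lookup (pdiff j p) u = (\<Sum>t\<in>Poly_Mapping.keys p. ?f t when t - ?e = u)"
    by (simp add: pdiff_def lookup_sum lookup_single)
  also have "\<dots> = (\<Sum>t\<in>Poly_Mapping.keys p. if t = u + ?e then ?f t else 0)"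
  proof (rule sum.cong[OF refl])
    fix t
    show "(?f t when t - ?e = u) = (if t = u + ?e then ?f t else 0)"
    proof (cases "Poly_Mapping.lookup t j = 0")
      case False
      have "t - ?e = u \<longleftrightarrow> t = u + ?e"
      proof
        show "t = u + ?e" if "t - ?e = u"
          by (rule eq[OF that False])
        show "t - ?e = u" if "t = u + ?e"
          unfolding that by (rule add_diff_cancel_right')
      qed
      then show ?thesis by (simp only: when_def)
    next
      case True
      then have "?f t = 0" by simp
      then show ?thesis by (simp only: when_def if_cancel)
    qed
  qed
  also have "\<dots> = ?f (u + ?e)"
    by (simp add: in_keys_iff)
  finally show ?thesis by (simp add: lookup_add)
qed

lemma x_op_commute: "x_op i \<circ> x_op j = x_op j \<circ> x_op i"
  by (auto simp: fun_eq_iff x_op_def algebra_simps)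

lemma d_op_commute: "d_op i \<circ> d_op j = d_op j \<circ> d_op i"
proof (cases "i = j")
  case False
  show ?thesis
  proof (intro ext poly_mapping_eqI)
    fix \<phi> :: "'a logseries" and z u
    have "z + axis i 1 + axis j 1 = z + axis j 1 + axis i (1::complex)"
      by (simp add: algebra_simps)
    moreover have "u + Poly_Mapping.single i 1 + Poly_Mapping.single j (1::nat)
        = u + Poly_Mapping.single j 1 + Poly_Mapping.single i 1"
      by (simp add: algebra_simps)
    ultimately show "Poly_Mapping.lookup ((d_op i \<circ> d_op j) \<phi> z) u =
        Poly_Mapping.lookup ((d_op j \<circ> d_op i) \<phi> z) u"
      using False by (simp add: d_op_def lookup_add lookup_cscale lookup_pdiff axis_def
          lookup_single when_def algebra_simps)
  qed
qed simp

lemma d_x_op: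
  "d_op i (x_op j \<phi>) = (\<lambda>z. x_op j (d_op i \<phi>) z + (if i = j then \<phi> z else 0))"
proof (intro ext poly_mapping_eqI)
  fix z u
  have "z + axis i 1 - axis j 1 = z - axis j 1 + axis i (1::complex)"
    by (simp add: algebra_simps)
  then show "Poly_Mapping.lookup (d_op i (x_op j \<phi>) z) u =
      Poly_Mapping.lookup (x_op j (d_op i \<phi>) z + (if i = j then \<phi> z else 0)) u"
    by (auto simp: d_op_def x_op_def lookup_add lookup_cscale lookup_pdiff axis_def
        algebra_simps)
qed

lemma theta_op_apply: "theta_op j \<phi> z = cscale (z $ j) (\<phi> z) + pdiff j (\<phi> z)"
  by (simp add: theta_op_def d_op_def x_op_def)

lemma theta_op_commute: "theta_op i \<circ> theta_op j = theta_op j \<circ> theta_op i"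
proof (cases "i = j")
  case False
  show ?thesis
  proof (intro ext poly_mapping_eqI)
    fix \<phi> :: "'a logseries" and z u
    have "u + Poly_Mapping.single i 1 + Poly_Mapping.single j (1::nat)
        = u + Poly_Mapping.single j 1 + Poly_Mapping.single i 1"
      by (simp add: algebra_simps)
    then show "Poly_Mapping.lookup ((theta_op i \<circ> theta_op j) \<phi> z) u =
        Poly_Mapping.lookup ((theta_op j \<circ> theta_op i) \<phi> z) u"
      using False by (simp add: theta_op_apply lookup_add lookup_cscale lookup_pdiff
          lookup_single when_def algebra_simps)
  qed
qed simp

end

theory Submission
  imports Defs
begin

text \<open>
  Write \<open>D\<^sub>j\<close> for the derivative with respect to \<open>log x\<^sub>j\<close>. Reading off the lowest terms of the
  equations shows that a leading coefficient \<open>f\<close> satisfies \<open>A D f = 0\<close> and \<open>D\<^bsup>G\<^esup> f = 0\<close> for the sets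
  \<open>G = I\<^bsub>-g\<^esub> - I\<^sub>0\<close> of the Groebner basis elements \<open>g\<close>, because \<open>c + D\<^sub>j\<close> is invertible on
  polynomials for \<open>c \<noteq> 0\<close>. Let \<open>Q\<close> be the space of all such \<open>f\<close>.

  Conversely, each \<open>D\<^sub>j\<close> with \<open>j \<in> I\<^sub>0 - K\<close> is surjective on the solutions of \<open>A D q = 0\<close>, so
  \<open>f = D\<^bsup>I\<^sub>0 - K\<^esup> q\<close> for some such \<open>q\<close>; the hypothesis \<open>P = m P\<^sub>B\<close> then says that \<open>D\<^bsup>(I \<union> J) - K\<^esup>\<close>
  annihilates \<open>q\<close> for \<open>I \<in> NS\<close>, \<open>J \<in> NS\<^sup>c\<close>. The Frobenius series with coefficients
  \<open>unit \<cdot> D\<^bsup>I\<^sub>u - K\<^esup> q\<close> for \<open>I\<^sub>u \<in> NS\<close>, and \<open>0\<close> otherwise, therefore solves the system, and its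
  leading coefficient is \<open>f\<close> since \<open>I\<^sub>0 \<in> NS\<close> by Groebner reduction. Hence \<open>C\<^sub>v = Q\<close>.

  The nonfaces of the link are exactly the subsets of \<open>V\<close> containing some \<open>G\<close>, so the part of \<open>Q\<close>
  of degree \<open>q\<close> is dual to that of the Stanley-Reisner ring modulo the linear forms. It vanishes
  for large \<open>q\<close> because the columns of \<open>A\<close> indexed by a face are linearly independent.
\<close>

text \<open>The obstacle is that a factor \<open>c + D\<^sub>j\<close> is invertible on polynomials
  only for nonzero c. Lowering an exponent at j from 0 to -1 produces the bare
  \<open>D\<^sub>j\<close>, so the usual Gamma quotients cannot be used as they stand. The
  coefficient at u therefore carries the product of the \<open>D\<^sub>j\<close> over
  \<open>I\<^sub>u - K\<close>, which absorbs these factors. With this normalisation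
  \<open>\<partial>\<^sup>p\<close> carries the coefficient at u + p to the one at u, whatever p is.
  The two terms of a toric binomial then agree unless exactly one of their exponents lies over NS.
  In that case \<open>I\<^sub>u\<close> contains both negative supports I and J, and the coefficient
  at u has the factor over (I \<union> J) - K: this is where the hypothesis enters. The hypothesis
  lives in the ring of the variables s. Replacing each s by a suitable linear form in the D turns
  the form (Bs) at j into \<open>D\<^sub>j\<close> modulo the Euler operators, because 1 - RA, with
  R a right inverse of A, factors through the basis. The duality is the apolarity pairing, the
  constant term of g(D) f. Under it, eliminating the variables of \<open>I\<^sub>0\<close> is
  adjoint to extending a polynomial in the logarithms over V to a solution of the Euler
  equations.\<close>

abbreviation "lookup \<equiv> Poly_Mapping.lookup"
abbreviation "keys \<equiv> Poly_Mapping.keys"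
abbreviation "single \<equiv> Poly_Mapping.single"

section \<open>Polynomials\<close>

lemma cpoly_induct [case_names single add]:
  fixes p :: "'x cpoly"
  assumes "\<And>u c. P (single u c)" and "\<And>p q. P p \<Longrightarrow> P q \<Longrightarrow> P (p + q)"
  shows "P p"
proof -
  have expand: "p = (\<Sum>u\<in>keys p. single u (lookup p u))"
    by (rule poly_mapping_eqI) (auto simp: lookup_sum lookup_single when_def in_keys_iff)
  have "P (\<Sum>u\<in>S. single u (c u))" if "finite S" for S :: "('x \<Rightarrow>\<^sub>0 nat) set" and c
    using that
  proof (induction S)
    case empty
    show ?case using assms(1)[of 0 0] by simp
  qed (simp add: assms)
  from this[of "keys p" "lookup p"] expand show ?thesis by simp
qed

text \<open>Linear maps on polynomials are written as sums over \<open>keys\<close>, and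
  cancellation can make \<open>keys (p + q)\<close> smaller than the union; \<open>F u 0 = 0\<close>
  makes the missing terms harmless.\<close>

lemma sum_keys_add:
  fixes p q :: "'x cpoly"
  assumes "\<And>u. F u 0 = 0" "\<And>u a b. F u (a + b) = F u a + F u b"
  shows "(\<Sum>u\<in>keys (p + q). F u (lookup (p + q) u) :: 'b::comm_monoid_add)
    = (\<Sum>u\<in>keys p. F u (lookup p u)) + (\<Sum>u\<in>keys q. F u (lookup q u))"
  by (rule setsum_keys_plus_distrib) (use assms in auto)

lemma sum_keys_single:
  assumes "\<And>u. F u 0 = 0"
  shows "(\<Sum>u\<in>keys (single t c). F u (lookup (single t c) u)) = F t (c::complex)"
  using assms by (cases "c = 0") auto

lemma const_0 [simp]: "const 0 = 0" and const_1 [simp]: "const 1 = 1"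
  by (simp_all add: const_def)

lemma const_add: "const (a + b) = const a + const b"
  and const_mult: "const (a * b) = const a * const b"
  and const_uminus: "const (- a) = - const a"
  and const_diff: "const (a - b) = const a - const b"
  by (simp_all add: const_def single_add mult_single single_uminus single_diff)

lemma const_sum: "const (sum f S) = (\<Sum>x\<in>S. const (f x))"
  by (induction S rule: infinite_finite_induct) (auto simp: const_add)

lemma const_prod: "const (prod f S) = (\<Prod>x\<in>S. const (f x))"
  by (induction S rule: infinite_finite_induct) (auto simp: const_mult)

lemma const_power: "const (a ^ k) = const a ^ k"
  by (induction k) (auto simp: const_mult)

lemma const_eq_iff [simp]: "const a = const b \<longleftrightarrow> a = b"
  unfolding const_def by (metis lookup_single_eq)

lemma const_eq_0_iff [simp]: "const c = 0 \<longleftrightarrow> c = 0"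
  using const_eq_iff[of c 0] by simp

lemma monom_0 [simp]: "monom 0 = 1"
  by (simp add: monom_def)

lemma monom_add: "monom (u + t) = monom u * monom t"
  by (simp add: monom_def mult_single)

lemma single_eq: "single u c = const c * monom u"
  by (simp add: const_def monom_def mult_single)

lemma lookup_monom: "lookup (monom u) t = (1 when u = t)"
  by (simp add: monom_def lookup_single)

lemma keys_monom [simp]: "keys (monom u) = {u}"
  by (simp add: monom_def)

lemma monom_eq_iff [simp]: "monom u = monom t \<longleftrightarrow> u = t"
  by (metis keys_monom singleton_inject)

lemma monom_neq_0 [simp]: "monom u \<noteq> 0"
  by (metis keys_monom keys_zero insert_not_empty)

lemma keys_add_nat: "keys (u + t) = keys u \<union> keys (t :: 'x \<Rightarrow>\<^sub>0 nat)"
  by (auto simp: in_keys_iff lookup_add)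

lemma mdeg_superset: "finite S \<Longrightarrow> keys u \<subseteq> S \<Longrightarrow> mdeg u = (\<Sum>j\<in>S. lookup u j)"
  unfolding mdeg_def by (rule sum.mono_neutral_left) (auto simp: in_keys_iff)

lemma mdeg_add [simp]: "mdeg (u + t) = mdeg u + mdeg t"
proof -
  have "mdeg u = (\<Sum>j\<in>keys u \<union> keys t. lookup u j)" "mdeg t = (\<Sum>j\<in>keys u \<union> keys t. lookup t j)"
    by (rule mdeg_superset; simp)+
  then show ?thesis
    by (simp add: mdeg_def[of "u + t"] keys_add_nat lookup_add sum.distrib)
qed

lemma mdeg_0 [simp]: "mdeg 0 = 0"
  by (simp add: mdeg_def)

lemma mdeg_single [simp]: "mdeg (single j k) = k"
  by (cases "k = 0") (auto simp: mdeg_def)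

subsection \<open>Substitution\<close>

text \<open>The product runs over \<open>keys u\<close> because the polynomials in s have their
  variables in the infinite type \<open>nat\<close>.\<close>

definition mpow :: "('x \<Rightarrow> 'r::comm_ring_1) \<Rightarrow> ('x \<Rightarrow>\<^sub>0 nat) \<Rightarrow> 'r" where
  "mpow \<sigma> u = (\<Prod>j\<in>keys u. \<sigma> j ^ lookup u j)"

lemma mpow_superset: "finite S \<Longrightarrow> keys u \<subseteq> S \<Longrightarrow> mpow \<sigma> u = (\<Prod>j\<in>S. \<sigma> j ^ lookup u j)"
  unfolding mpow_def by (rule prod.mono_neutral_left) (auto simp: in_keys_iff)

lemma mpow_add: "mpow \<sigma> (u + t) = mpow \<sigma> u * mpow \<sigma> t"
proof -
  have "mpow \<sigma> u = (\<Prod>j\<in>keys u \<union> keys t. \<sigma> j ^ lookup u j)"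
    "mpow \<sigma> t = (\<Prod>j\<in>keys u \<union> keys t. \<sigma> j ^ lookup t j)"
    by (rule mpow_superset; simp)+
  then show ?thesis
    by (simp add: mpow_def[of _ "u + t"] keys_add_nat lookup_add power_add prod.distrib)
qed

lemma mpow_0 [simp]: "mpow \<sigma> 0 = 1"
  by (simp add: mpow_def)

lemma mpow_single [simp]: "mpow \<sigma> (single j k) = \<sigma> j ^ k"
  by (cases "k = 0") (auto simp: mpow_def)

definition subst :: "('x \<Rightarrow> 'y cpoly) \<Rightarrow> 'x cpoly \<Rightarrow> 'y cpoly" where
  "subst \<sigma> p = (\<Sum>u\<in>keys p. const (lookup p u) * mpow \<sigma> u)"

lemma subst_add: "subst \<sigma> (p + q) = subst \<sigma> p + subst \<sigma> q"
  unfolding subst_def by (rule sum_keys_add) (auto simp: const_add distrib_right)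

lemma subst_single: "subst \<sigma> (single u c) = const c * mpow \<sigma> u"
  unfolding subst_def by (rule sum_keys_single) simp

lemma subst_0 [simp]: "subst \<sigma> 0 = 0"
  by (simp add: subst_def)

lemma subst_const [simp]: "subst \<sigma> (const c) = const c"
  by (simp add: const_def subst_single)

lemma subst_monom: "subst \<sigma> (monom u) = mpow \<sigma> u"
  by (simp add: monom_def subst_single)

lemma subst_var [simp]: "subst \<sigma> (var j) = \<sigma> j"
  by (simp add: var_def subst_monom)

lemma subst_mult: "subst \<sigma> (p * q) = subst \<sigma> p * subst \<sigma> q"
proof (induction p rule: cpoly_induct)
  case (single u c)
  show ?case
    by (induction q rule: cpoly_induct)
      (simp_all add: mult_single subst_single subst_add const_mult mpow_add algebra_simps)
qed (simp add: subst_add distrib_right)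

lemma subst_uminus: "subst \<sigma> (- p) = - subst \<sigma> p"
  using subst_add[of \<sigma> p "- p"] by (simp add: eq_neg_iff_add_eq_0 add.commute)

lemma subst_diff: "subst \<sigma> (p - q) = subst \<sigma> p - subst \<sigma> q"
  using subst_add[of \<sigma> p "- q"] by (simp add: subst_uminus)

lemma subst_1 [simp]: "subst \<sigma> 1 = 1"
  using subst_const[of \<sigma> 1] by simp

lemma subst_sum: "subst \<sigma> (sum f S) = (\<Sum>x\<in>S. subst \<sigma> (f x))"
  by (induction S rule: infinite_finite_induct) (auto simp: subst_add)

lemma subst_prod: "subst \<sigma> (prod f S) = (\<Prod>x\<in>S. subst \<sigma> (f x))"
  by (induction S rule: infinite_finite_induct) (auto simp: subst_mult)

lemma subst_cscale: "subst \<sigma> (cscale c p) = cscale c (subst \<sigma> p)"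
  by (simp add: cscale_def subst_mult)

lemma var_power: "var j ^ k = monom (single j k)"
  by (induction k) (simp_all add: var_def monom_add[symmetric] single_add[symmetric])

lemma monom_eq_mpow_var: "monom u = mpow var u"
proof -
  have "monom (\<Sum>j\<in>S. single j (lookup u j)) = (\<Prod>j\<in>S. var j ^ lookup u j)" if "finite S" for S
    using that by (induction S) (simp_all add: var_power monom_add)
  moreover have "u = (\<Sum>j\<in>keys u. single j (lookup u j))"
    by (rule poly_mapping_eqI) (auto simp: lookup_sum lookup_single when_def in_keys_iff)
  ultimately show ?thesis
    by (metis finite_keys mpow_def)
qed

text \<open>Evaluation is substitution of constants, so the rules for \<open>subst\<close> also
  serve for \<open>peval\<close>.\<close>

lemma subst_const_eq_peval: "subst (\<lambda>j. const (v $ j)) p = const (peval v p)"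
  by (simp add: subst_def peval_def const_sum const_mult const_prod const_power
      mpow_superset[of UNIV])

subsection \<open>Ideals\<close>

interpretation cring: module "(*) :: 'x cpoly \<Rightarrow> 'x cpoly \<Rightarrow> 'x cpoly"
  by unfold_locales (simp_all add: distrib_left distrib_right mult.assoc)

lemma ideal_induct [consumes 1, case_names zero step]:
  assumes "p \<in> ideal S" "P 0" "\<And>c g p. g \<in> S \<Longrightarrow> P p \<Longrightarrow> P (c * g + p)"
  shows "P p"
  using assms unfolding ideal_def by (rule cring.span_induct_alt)

lemma ideal_base: "g \<in> S \<Longrightarrow> g \<in> ideal S"
  and ideal_0: "0 \<in> ideal S"
  and ideal_add: "p \<in> ideal S \<Longrightarrow> q \<in> ideal S \<Longrightarrow> p + q \<in> ideal S"
  and ideal_diff: "p \<in> ideal S \<Longrightarrow> q \<in> ideal S \<Longrightarrow> p - q \<in> ideal S"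
  and ideal_mult: "p \<in> ideal S \<Longrightarrow> c * p \<in> ideal S"
  by (simp_all add: ideal_def cring.span_base cring.span_zero cring.span_add cring.span_diff
      cring.span_scale)

text \<open>Every term of a multiple of a monomial is divisible by it, and addition creates no new
  exponents. Hence membership in a monomial ideal is decided term by term.\<close>

lemma keys_monomial_ideal:
  assumes "f \<in> ideal (monom ` U)" "m \<in> keys f"
  shows "\<exists>p\<in>U. \<exists>r. m = p + r"
  using assms
proof (induction arbitrary: m rule: ideal_induct)
  case (step c g p)
  then obtain t where t: "t \<in> U" "g = monom t" by auto
  consider "m \<in> keys (c * g)" | "m \<in> keys p"
    using step.prems keys_add[of "c * g" p] by auto
  then show ?case
  proof cases
    case 1
    with keys_mult[of c g] t obtain s where "m = s + t" by auto
    with t show ?thesis by (metis add.commute)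
  qed (use step.IH in auto)
qed simp

lemma monom_in_monomial_ideal:
  "monom m \<in> ideal (monom ` U) \<longleftrightarrow> (\<exists>p\<in>U. \<exists>r. m = p + r)"
proof
  show "\<exists>p\<in>U. \<exists>r. m = p + r" if "monom m \<in> ideal (monom ` U)"
    using keys_monomial_ideal[OF that] by simp
  show "monom m \<in> ideal (monom ` U)" if "\<exists>p\<in>U. \<exists>r. m = p + r"
  proof -
    from that obtain p r where "p \<in> U" "m = p + r" by auto
    then show ?thesis
      using ideal_mult[OF ideal_base, of "monom p" "monom ` U" "monom r"]
      by (simp add: monom_add mult.commute)
  qed
qed

lemma ideal_in_induct [consumes 1, case_names zero step]:
  assumes "p \<in> ideal_in V S" "P 0"
    and "\<And>c g p. c \<in> polys_in V \<Longrightarrow> g \<in> S \<Longrightarrow> P p \<Longrightarrow> P (c * g + p)"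
  shows "P p"
proof -
  obtain F c where F: "finite F" "F \<subseteq> S" "\<forall>g\<in>F. c g \<in> polys_in V" and p: "p = (\<Sum>g\<in>F. c g * g)"
    using assms(1) by (auto simp: ideal_in_def)
  have "P (\<Sum>g\<in>F. c g * g)"
    using F by (induction F) (auto intro: assms)
  then show ?thesis by (simp add: p)
qed

lemma polys_in_0: "0 \<in> polys_in V"
  and polys_in_1: "1 \<in> polys_in V"
  and polys_in_const: "const c \<in> polys_in V"
  by (auto simp: polys_in_def const_def)

lemma polys_in_add: "p \<in> polys_in V \<Longrightarrow> q \<in> polys_in V \<Longrightarrow> p + q \<in> polys_in V"
  unfolding polys_in_def using keys_add[of p q] by blast

lemma polys_in_mult: "p \<in> polys_in V \<Longrightarrow> q \<in> polys_in V \<Longrightarrow> p * q \<in> polys_in V"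
  unfolding polys_in_def using keys_mult[of p q] by (fastforce simp: keys_add_nat)

lemma polys_in_sum: "(\<And>x. x \<in> S \<Longrightarrow> f x \<in> polys_in V) \<Longrightarrow> sum f S \<in> polys_in V"
  by (induction S rule: infinite_finite_induct) (auto intro: polys_in_add polys_in_0)

lemma polys_in_prod: "(\<And>x. x \<in> S \<Longrightarrow> f x \<in> polys_in V) \<Longrightarrow> prod f S \<in> polys_in V"
  by (induction S rule: infinite_finite_induct) (auto intro: polys_in_mult polys_in_1)

lemma polys_in_power: "p \<in> polys_in V \<Longrightarrow> p ^ k \<in> polys_in V"
  by (induction k) (auto intro: polys_in_mult polys_in_1)

lemma polys_in_var: "j \<in> V \<Longrightarrow> var j \<in> polys_in V"
  by (auto simp: polys_in_def var_def)

lemma polys_in_subst: "(\<And>j. \<sigma> j \<in> polys_in V) \<Longrightarrow> subst \<sigma> p \<in> polys_in V"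
  unfolding subst_def mpow_def
  by (intro polys_in_sum polys_in_mult polys_in_prod polys_in_power polys_in_const)

lemma ideal_in_0: "0 \<in> ideal_in V S"
  unfolding ideal_in_def by (intro CollectI exI[of _ "{}"]) auto

lemma ideal_in_base_mult:
  assumes "g \<in> S" "c \<in> polys_in V" shows "c * g \<in> ideal_in V S"
  unfolding ideal_in_def using assms
  by (intro CollectI exI[of _ "{g}"] exI[of _ "\<lambda>_. c"]) auto

lemma ideal_in_base: "g \<in> S \<Longrightarrow> g \<in> ideal_in V S"
  using ideal_in_base_mult[of g S 1] polys_in_1 by auto

lemma ideal_in_add:
  assumes "p \<in> ideal_in V S" "q \<in> ideal_in V S" shows "p + q \<in> ideal_in V S"
proof -
  obtain F c where F: "finite F" "F \<subseteq> S" "\<forall>g\<in>F. c g \<in> polys_in V" and p: "p = (\<Sum>g\<in>F. c g * g)"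
    using assms(1) by (auto simp: ideal_in_def)
  obtain F' c' where F': "finite F'" "F' \<subseteq> S" "\<forall>g\<in>F'. c' g \<in> polys_in V"
    and q: "q = (\<Sum>g\<in>F'. c' g * g)"
    using assms(2) by (auto simp: ideal_in_def)
  let ?c = "\<lambda>g. (if g \<in> F then c g else 0) + (if g \<in> F' then c' g else 0)"
  have "p = (\<Sum>g\<in>F \<union> F'. (if g \<in> F then c g else 0) * g)"
    unfolding p by (rule sum.mono_neutral_cong_left) (use F F' in auto)
  moreover have "q = (\<Sum>g\<in>F \<union> F'. (if g \<in> F' then c' g else 0) * g)"
    unfolding q by (rule sum.mono_neutral_cong_left) (use F F' in auto)
  ultimately have "p + q = (\<Sum>g\<in>F \<union> F'. ?c g * g)"
    by (simp add: sum.distrib distrib_right)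
  moreover have "?c g \<in> polys_in V" for g
    using F F' by (intro polys_in_add) (auto simp: polys_in_0)
  ultimately show ?thesis
    unfolding ideal_in_def using F F' by (intro CollectI exI[of _ "F \<union> F'"] exI[of _ ?c]) auto
qed

lemma ideal_in_mult:
  assumes "p \<in> ideal_in V S" "c \<in> polys_in V" shows "c * p \<in> ideal_in V S"
  using assms(1)
proof (induction rule: ideal_in_induct)
  case (step d g p)
  have "c * d \<in> polys_in V"
    by (intro polys_in_mult assms step.hyps)
  then have "(c * d) * g + c * p \<in> ideal_in V S"
    by (intro ideal_in_add ideal_in_base_mult step)
  then show ?case
    by (simp only: distrib_left mult.assoc)
qed (simp add: ideal_in_0)

lemma ideal_in_subset:
  assumes "S \<subseteq> polys_in V" shows "ideal_in V S \<subseteq> polys_in V"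
proof
  fix p assume "p \<in> ideal_in V S"
  then show "p \<in> polys_in V"
    by (induction rule: ideal_in_induct) (use assms in \<open>auto intro: polys_in_0 polys_in_add polys_in_mult\<close>)
qed

subsection \<open>Homogeneous polynomials\<close>

lemma homog_0: "0 \<in> homog q"
  by (simp add: homog_def)

lemma homog_add: "p \<in> homog k \<Longrightarrow> q \<in> homog k \<Longrightarrow> p + q \<in> homog k"
  unfolding homog_def using keys_add[of p q] by blast

lemma homog_sum: "(\<And>x. x \<in> S \<Longrightarrow> f x \<in> homog k) \<Longrightarrow> sum f S \<in> homog k"
  by (induction S rule: infinite_finite_induct) (auto intro: homog_add homog_0)

lemma homog_mult: "p \<in> homog k \<Longrightarrow> q \<in> homog l \<Longrightarrow> p * q \<in> homog (k + l)"
  unfolding homog_def using keys_mult[of p q] by fastforce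

lemma homog_const: "const c \<in> homog 0"
  by (auto simp: homog_def const_def)

lemma homog_1: "1 \<in> homog 0"
  by (auto simp: homog_def)

lemma homog_monom: "monom u \<in> homog (mdeg u)"
  by (auto simp: homog_def)

lemma homog_var: "var j \<in> homog 1"
  by (auto simp: homog_def var_def)

lemma homog_power: "p \<in> homog k \<Longrightarrow> p ^ l \<in> homog (l * k)"
proof (induction l)
  case (Suc l)
  then show ?case using homog_mult[of p k "p ^ l" "l * k"] by simp
qed (simp add: homog_1)

lemma homog_prod: "(\<And>x. x \<in> S \<Longrightarrow> f x \<in> homog (k x)) \<Longrightarrow> prod f S \<in> homog (sum k S)"
  by (induction S rule: infinite_finite_induct) (auto simp: homog_1 intro: homog_mult)

lemma homog_cscale: "p \<in> homog k \<Longrightarrow> cscale c p \<in> homog k"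
  unfolding cscale_def using homog_mult[OF homog_const] by fastforce

lemma homog_subst:
  assumes "\<And>j. \<sigma> j \<in> homog 1" "p \<in> homog k" shows "subst \<sigma> p \<in> homog k"
  unfolding subst_def
proof (rule homog_sum)
  fix u assume u: "u \<in> keys p"
  have "mpow \<sigma> u \<in> homog (\<Sum>j\<in>keys u. lookup u j * 1)"
    unfolding mpow_def by (intro homog_prod homog_power assms)
  with u assms(2) have "mpow \<sigma> u \<in> homog k"
    by (auto simp: homog_def mdeg_def)
  then show "const (lookup p u) * mpow \<sigma> u \<in> homog k"
    using homog_mult[OF homog_const] by fastforce
qed

section \<open>The action of polynomials by constant coefficient differential operators\<close>

text \<open>The multifactorial u!. In the basis of divided powers a monomial differential operator
  only shifts exponents.\<close>

definition mfact :: "('n::finite \<Rightarrow>\<^sub>0 nat) \<Rightarrow> complex" where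
  "mfact u = (\<Prod>j\<in>UNIV. fact (lookup u j))"

lemma mfact_neq_0 [simp]: "mfact u \<noteq> 0"
  by (simp add: mfact_def)

lemma mfact_0 [simp]: "mfact 0 = 1"
  by (simp add: mfact_def)

lemma mfact_add_single: "mfact (u + single j 1) = of_nat (lookup u j + 1) * mfact u"
proof -
  have "mfact (u + single j 1) = (\<Prod>i\<in>UNIV. (if i = j then of_nat (lookup u j + 1) else 1) * fact (lookup u i))"
    unfolding mfact_def by (rule prod.cong) (auto simp: lookup_add lookup_single when_def)
  then show ?thesis
    by (simp add: prod.distrib mfact_def)
qed

text \<open>This is p(D) f. The number \<open>mfact t * lookup f t\<close> is the coefficient of f
  at the divided power of exponent t, so \<open>monom u\<close> acts as a shift by u and
  \<open>act_mult\<close> becomes associativity of adding exponents. That the support is finite is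
  shown in \<open>lookup_act\<close>.\<close>

definition act :: "'n::finite cpoly \<Rightarrow> 'n cpoly \<Rightarrow> 'n cpoly" where
  "act p f = Abs_poly_mapping (\<lambda>t.
     (\<Sum>u\<in>keys p. lookup p u * (mfact (t + u) * lookup f (t + u))) / mfact t)"

lemma lookup_act:
  "lookup (act p f) t = (\<Sum>u\<in>keys p. lookup p u * (mfact (t + u) * lookup f (t + u))) / mfact t"
proof -
  define g where "g t = (\<Sum>u\<in>keys p. lookup p u * (mfact (t + u) * lookup f (t + u))) / mfact t" for t
  have "\<exists>u\<in>keys p. lookup f (t + u) \<noteq> 0" if "g t \<noteq> 0" for t
    using that by (rule contrapos_np) (simp add: g_def)
  then have "{t. g t \<noteq> 0} \<subseteq> (\<Union>u\<in>keys p. (\<lambda>t. t + u) -` keys f)"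
    by (auto simp: in_keys_iff)
  moreover have "finite (\<Union>u\<in>keys p. (\<lambda>t. t + u) -` keys f)"
    by (intro finite_UN_I finite_keys finite_vimageI injI) simp
  ultimately have "finite {t. g t \<noteq> 0}"
    by (rule finite_subset)
  then show ?thesis
    unfolding act_def by (simp add: g_def)
qed

lemma lookup_act_single:
  "lookup (act (single u c) f) t = c * (mfact (t + u) * lookup f (t + u)) / mfact t"
  by (cases "c = 0") (auto simp: lookup_act)

lemma act_add_left: "act (p + q) f = act p f + act q f"
proof (rule poly_mapping_eqI)
  fix t
  have "(\<Sum>u\<in>keys (p + q). lookup (p + q) u * (mfact (t + u) * lookup f (t + u)))
    = (\<Sum>u\<in>keys p. lookup p u * (mfact (t + u) * lookup f (t + u)))
      + (\<Sum>u\<in>keys q. lookup q u * (mfact (t + u) * lookup f (t + u)))"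
    by (rule sum_keys_add) (auto simp: distrib_right)
  then show "lookup (act (p + q) f) t = lookup (act p f + act q f) t"
    by (simp only: lookup_act lookup_add[of "act p f"] add_divide_distrib)
qed

lemma act_add_right: "act p (f + g) = act p f + act p g"
  by (rule poly_mapping_eqI) (simp add: lookup_act lookup_add sum.distrib algebra_simps add_divide_distrib)

lemma act_0_left [simp]: "act 0 f = 0"
  by (rule poly_mapping_eqI) (simp add: lookup_act)

lemma act_0_right [simp]: "act p 0 = 0"
  by (rule poly_mapping_eqI) (simp add: lookup_act)

lemma act_mult: "act (p * q) f = act p (act q f)"
proof (induction p rule: cpoly_induct)
  case (single u c)
  show ?case
  proof (induction q rule: cpoly_induct)
    case (single u' c')
    show ?case
      by (rule poly_mapping_eqI) (simp add: mult_single lookup_act_single add.assoc)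
  qed (simp add: distrib_left act_add_left act_add_right)
qed (simp add: distrib_right act_add_left)

lemma act_const: "act (const c) f = cscale c f"
  by (rule poly_mapping_eqI) (simp add: const_def lookup_act_single lookup_cscale)

lemma act_1 [simp]: "act 1 f = f"
  using act_const[of 1 f] by simp

lemma act_var: "act (var j) f = pdiff j f"
  by (rule poly_mapping_eqI)
    (simp only: var_def monom_def lookup_act_single mfact_add_single lookup_pdiff, simp)

lemma act_uminus_left: "act (- p) f = - act p f"
  using act_add_left[of p "- p" f] by (simp add: eq_neg_iff_add_eq_0 add.commute)

lemma act_diff_left: "act (p - q) f = act p f - act q f"
  using act_add_left[of p "- q" f] by (simp add: act_uminus_left)

lemma act_uminus_right: "act p (- f) = - act p f"
  using act_add_right[of p f "- f"] by (simp add: eq_neg_iff_add_eq_0 add.commute)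

lemma act_diff_right: "act p (f - g) = act p f - act p g"
  using act_add_right[of p f "- g"] by (simp add: act_uminus_right)

lemma act_sum_left: "act (sum p S) f = (\<Sum>x\<in>S. act (p x) f)"
  by (induction S rule: infinite_finite_induct) (auto simp: act_add_left)

lemma act_sum_right: "act p (sum f S) = (\<Sum>x\<in>S. act p (f x))"
  by (induction S rule: infinite_finite_induct) (auto simp: act_add_right)

lemma act_commute: "act p (act q f) = act q (act p f)"
  by (simp add: act_mult[symmetric] mult.commute)

lemma act_cscale_left: "act (cscale c p) f = cscale c (act p f)"
  by (simp add: cscale_def act_mult) (simp add: act_const cscale_def)

lemma act_cscale_right: "act p (cscale c f) = cscale c (act p f)"
  by (simp add: act_const[symmetric] act_commute)

lemma act_ideal:
  assumes "\<And>g. g \<in> S \<Longrightarrow> act g f = 0" "p \<in> ideal S" shows "act p f = 0"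
  using assms(2) by (induction rule: ideal_induct) (auto simp: act_add_left act_mult assms(1))

lemma keys_act: "t \<in> keys (act p f) \<Longrightarrow> \<exists>u\<in>keys p. t + u \<in> keys f"
  by (rule ccontr) (auto simp: in_keys_iff lookup_act)

lemma act_monom_eq_0:
  assumes "\<And>t. t \<in> keys f \<Longrightarrow> mdeg t < mdeg u" shows "act (monom u) f = 0"
proof -
  have "t \<notin> keys (act (monom u) f)" for t
    using keys_act[of t "monom u" f] assms by fastforce
  then have "keys (act (monom u) f) = {}" by blast
  then show ?thesis by simp
qed

lemma lookup_act_monom_0: "lookup (act (monom u) f) 0 = mfact u * lookup f u"
  by (simp add: monom_def lookup_act_single)

text \<open>The truncated geometric series inverts \<open>c + D\<^sub>j\<close> on polynomials of bounded degree.\<close>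

definition inv_lin :: "nat \<Rightarrow> complex \<Rightarrow> 'n \<Rightarrow> 'n::finite cpoly" where
  "inv_lin N c j = const (1 / c) * (\<Sum>i<N. (const (- 1 / c) * var j) ^ i)"

lemma act_inv_lin:
  assumes "c \<noteq> 0" "\<And>t. t \<in> keys f \<Longrightarrow> mdeg t < N"
  shows "act ((const c + var j) * inv_lin N c j) f = f"
proof -
  let ?y = "const (- 1 / c) * var j"
  have "const c * ?y = - var j"
    using assms(1) by (simp add: mult.assoc[symmetric] const_mult[symmetric] const_uminus)
  \<comment> \<open>With y = -D/c the operator c + D is c(1 - y); the geometric sum leaves only the
    error y^N, which kills f for reasons of degree.\<close>
  then have 1: "const c + var j = const c * (1 - ?y)"
    by (simp only: right_diff_distrib mult_1_right diff_minus_eq_add)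
  have "(const c + var j) * inv_lin N c j = const c * const (1 / c) * ((1 - ?y) * (\<Sum>i<N. ?y ^ i))"
    unfolding 1 inv_lin_def by (simp only: mult_ac)
  also have "const c * const (1 / c) = 1"
    using assms(1) by (simp add: const_mult[symmetric])
  finally have "(const c + var j) * inv_lin N c j = (1 - ?y) * (\<Sum>i<N. ?y ^ i)"
    by (simp only: mult_1_left)
  also have "\<dots> = 1 - ?y ^ N"
    by (rule one_diff_power_eq[symmetric])
  finally have "act ((const c + var j) * inv_lin N c j) f = f - act (const (- 1 / c) ^ N) (act (var j ^ N) f)"
    by (simp add: act_diff_left act_mult power_mult_distrib)
  also have "act (var j ^ N) f = 0"
    unfolding var_power by (rule act_monom_eq_0) (use assms in simp)
  finally show ?thesis by simp
qed

lemma act_lin_eq_0: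
  assumes "c \<noteq> 0" "act (const c + var j) f = 0" shows "f = 0"
proof -
  \<comment> \<open>N exceeds every degree occurring in f; the inserted 0 keeps \<open>Max\<close>
    meaningful for f = 0.\<close>
  define N where "N = Suc (Max (insert 0 (mdeg ` keys f)))"
  have "mdeg t < N" if "t \<in> keys f" for t
    using that by (simp add: N_def less_Suc_eq_le)
  then have "f = act (inv_lin N c j * (const c + var j)) f"
    using act_inv_lin[OF assms(1), of f N j] by (simp add: mult.commute)
  then show ?thesis
    using assms(2) by (simp add: act_mult)
qed

text \<open>Each factor with nonzero constant term is injective on polynomials and can be stripped
  from an annihilating operator.\<close>

lemma act_prod_lin_eq_0:
  assumes "finite S" "\<And>x. x \<in> S \<Longrightarrow> c x \<noteq> 0" "act ((\<Prod>x\<in>S. const (c x) + var (j x)) * p) f = 0"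
  shows "act p f = 0"
  using assms
proof (induction S)
  case (insert x S)
  have "act (const (c x) + var (j x)) (act ((\<Prod>x\<in>S. const (c x) + var (j x)) * p) f) = 0"
    using insert.prems(2) unfolding prod.insert[OF insert.hyps] mult.assoc act_mult .
  then have "act ((\<Prod>x\<in>S. const (c x) + var (j x)) * p) f = 0"
    using insert.prems(1) by (rule_tac act_lin_eq_0[of "c x" "j x"]) simp_all
  with insert.IH insert.prems(1) show ?case by blast
qed simp

section \<open>Operators on logarithmic series\<close>

text \<open>A product over part of the variables, so that facts about \<open>mon_op\<close> can be
  proved by induction on F.\<close>

definition mon_op_on ::
    "('n \<Rightarrow> 'n logseries \<Rightarrow> 'n logseries) \<Rightarrow> ('n::finite \<Rightarrow>\<^sub>0 nat) \<Rightarrow> 'n set \<Rightarrow> 'n logseries \<Rightarrow> 'n logseries" where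
  "mon_op_on T u F = Finite_Set.fold (\<lambda>j S. (T j ^^ lookup u j) \<circ> S) id F"

lemma mon_op_on_empty: "mon_op_on T u {} = id"
  by (simp add: mon_op_on_def)

lemma mon_op_on_insert:
  assumes comm: "\<And>i j. T i \<circ> T j = T j \<circ> T i" and "finite F" "j \<notin> F"
  shows "mon_op_on T u (insert j F) \<phi> = (T j ^^ lookup u j) (mon_op_on T u F \<phi>)"
proof -
  have 1: "T i ((T j ^^ b) x) = (T j ^^ b) (T i x)" for i j b x
  proof (induction b)
    case (Suc b)
    then show ?case
      using comm[of i j, THEN fun_cong, of "(T j ^^ b) x"] by simp
  qed simp
  \<comment> \<open>Commuting powers are what makes the fold independent of the order of the
    variables.\<close>
  have 2: "(T i ^^ a) ((T j ^^ b) x) = (T j ^^ b) ((T i ^^ a) x)" for i j a b x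
    by (induction a) (auto simp: 1)
  interpret comp_fun_commute "\<lambda>j S. (T j ^^ lookup u j) \<circ> S"
    by unfold_locales (auto simp: fun_eq_iff 2)
  show ?thesis
    using fold_insert[OF assms(2,3), of id] by (simp only: mon_op_on_def o_apply)
qed

text \<open>The rising factorial (z+1+D)(z+2+D)...(z+k+D): what k applications of
  \<open>d_op j\<close> do to a coefficient, z being the exponent at which the result is
  read.\<close>

definition dfactor :: "complex \<Rightarrow> 'n \<Rightarrow> nat \<Rightarrow> 'n cpoly" where
  "dfactor z j k = (\<Prod>i<k. const (z + of_nat i + 1) + var j)"

lemma d_op_act: "d_op j \<phi> z = act (const (z $ j + 1) + var j) (\<phi> (z + axis j 1))"
  by (simp add: d_op_def act_add_left act_const act_var)

lemma theta_op_act: "theta_op j \<phi> z = act (const (z $ j) + var j) (\<phi> z)"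
  by (simp add: theta_op_apply act_add_left act_const act_var)

lemma d_op_funpow: "(d_op j ^^ k) \<phi> z = act (dfactor (z $ j) j k) (\<phi> (z + axis j (of_nat k)))"
proof (induction k arbitrary: z)
  case (Suc k)
  have "z + axis j 1 + axis j (of_nat k) = z + axis j (of_nat (Suc k) :: complex)"
    by (simp add: vec_eq_iff axis_def)
  then show ?case
    by (simp add: d_op_act[of j "(d_op j ^^ k) \<phi>"] Suc.IH act_mult[symmetric] dfactor_def
        prod.lessThan_Suc_shift add.assoc del: prod.lessThan_Suc)
qed (simp add: dfactor_def axis_def zero_vec_def[symmetric])

lemma cvec_expo: "cvec (expo u) = (\<Sum>j\<in>UNIV. axis j (of_nat (lookup u j)))"
  by (simp add: vec_eq_iff cvec_def expo_def axis_def)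

lemma mon_op_d_op:
  "mon_op d_op u \<phi> z = act (\<Prod>j\<in>UNIV. dfactor (z $ j) j (lookup u j)) (\<phi> (z + cvec (expo u)))"
proof -
  have "mon_op_on d_op u F \<phi> z
    = act (\<Prod>j\<in>F. dfactor (z $ j) j (lookup u j)) (\<phi> (z + (\<Sum>j\<in>F. axis j (of_nat (lookup u j)))))"
    if "finite F" for F
    using that
  proof (induction F arbitrary: z)
    case (insert j F)
    \<comment> \<open>The operator for j moves the exponent only in coordinate j, which lies outside
      F.\<close>
    have "(\<Prod>i\<in>F. dfactor ((z + axis j (of_nat (lookup u j))) $ i) i (lookup u i))
      = (\<Prod>i\<in>F. dfactor (z $ i) i (lookup u i))"
      by (rule prod.cong) (use insert.hyps in \<open>auto simp: axis_def\<close>)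
    then show ?case
      using insert.hyps
      by (simp add: mon_op_on_insert[OF d_op_commute insert.hyps] d_op_funpow insert.IH act_mult add.assoc)
  qed (simp add: mon_op_on_empty)
  from this[of UNIV] show ?thesis
    unfolding mon_op_def mon_op_on_def cvec_expo by simp
qed

lemma mon_op_theta_op: "mon_op theta_op u \<phi> z = act (mpow (\<lambda>j. const (z $ j) + var j) u) (\<phi> z)"
proof -
  have pw: "(theta_op j ^^ k) \<phi> z = act ((const (z $ j) + var j) ^ k) (\<phi> z)" for j k \<phi>
    by (induction k) (simp_all add: theta_op_act act_mult)
  have "mon_op_on theta_op u F \<phi> z
    = act (\<Prod>j\<in>F. (const (z $ j) + var j) ^ lookup u j) (\<phi> z)"
    if "finite F" for F
    using that
  proof (induction F)
    case (insert j F)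
    show ?case
      using insert.hyps
      by (simp add: mon_op_on_insert[OF theta_op_commute insert.hyps] pw insert.IH act_mult)
  qed (simp add: mon_op_on_empty)
  from this[of UNIV] show ?thesis
    unfolding mon_op_def mon_op_on_def by (simp add: mpow_superset[of UNIV])
qed

text \<open>\<open>theta_op\<close> preserves exponents, so the coefficients at different z
  decouple.\<close>

lemma poly_op_theta_op: "poly_op theta_op p \<phi> z = act (subst (\<lambda>j. const (z $ j) + var j) p) (\<phi> z)"
  by (simp add: poly_op_def mon_op_theta_op subst_def act_sum_left act_mult) (simp add: act_const)

lemma poly_op_add: "poly_op T (p + q) \<phi> z = poly_op T p \<phi> z + poly_op T q \<phi> z"
  unfolding poly_op_def by (rule sum_keys_add) (auto simp: cpoly.scale_left_distrib)

lemma poly_op_single: "poly_op T (single u c) \<phi> z = cscale c (mon_op T u \<phi> z)"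
  unfolding poly_op_def by (rule sum_keys_single) simp

lemma poly_op_0: "poly_op T 0 = (\<lambda>\<phi> z. 0)"
  by (simp add: poly_op_def fun_eq_iff)

lemma poly_op_monom: "poly_op T (monom u) \<phi> z = mon_op T u \<phi> z"
  by (simp add: monom_def poly_op_single)

lemma poly_op_cscale: "poly_op T (cscale c p) \<phi> z = cscale c (poly_op T p \<phi> z)"
proof (induction p rule: cpoly_induct)
  case (single u d)
  have "cscale c (single u d) = single u (c * d)"
    by (simp add: cscale_def const_def mult_single)
  then show ?case by (simp add: poly_op_single)
qed (simp add: cpoly.scale_right_distrib poly_op_add)

lemma poly_op_diff: "poly_op T (p - q) \<phi> z = poly_op T p \<phi> z - poly_op T q \<phi> z"
  using poly_op_add[of T "p - q" q \<phi> z] by simp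

lemma left_ideal_annihilates:
  assumes "T \<in> left_ideal S" "\<And>P. P \<in> S \<Longrightarrow> P \<phi> = (\<lambda>z. 0)" shows "T \<phi> = (\<lambda>z. 0)"
proof -
  have weyl_0: "P (\<lambda>z. 0) = (\<lambda>z. 0)" if "P \<in> weyl" for P :: "'a logseries \<Rightarrow> 'a logseries"
    using that by induction (auto simp: x_op_def d_op_act[abs_def])
  from assms(1) show ?thesis
    by induction (auto simp: assms(2) weyl_0)
qed

text \<open>This operator is multiplication by \<open>x\<^sup>u\<close>; it is needed to turn
  \<open>\<partial>\<^sup>u\<close> into a polynomial in the \<open>theta_op\<close>.\<close>

lemma weyl_shift: "(\<lambda>\<phi> z. \<phi> (z - cvec (expo u))) \<in> weyl"
proof -
  have id: "(\<lambda>\<phi>. \<phi>) \<in> weyl"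
    using weyl.scalar[of 1] by simp
  have x_pow: "(\<lambda>\<phi> z. \<phi> (z - axis j (of_nat k))) \<in> weyl" for j :: 'a and k
  proof (induction k)
    case (Suc k)
    have "x_op j \<circ> (\<lambda>\<phi> z. \<phi> (z - axis j (of_nat k))) = (\<lambda>\<phi> z. \<phi> (z - axis j (of_nat (Suc k))))"
    proof (intro ext)
      fix \<phi> :: "'a logseries" and z :: "complex ^ 'a"
      have "z - axis j 1 - axis j (of_nat k) = z - axis j (of_nat (Suc k))"
        by (simp add: vec_eq_iff axis_def)
      then show "(x_op j \<circ> (\<lambda>\<phi> z. \<phi> (z - axis j (of_nat k)))) \<phi> z = \<phi> (z - axis j (of_nat (Suc k)))"
        by (simp only: x_op_def o_apply)
    qed
    with weyl.mult[OF weyl.x[of j] Suc] show ?case by (simp only:)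
  qed (use id in \<open>simp add: axis_def zero_vec_def[symmetric]\<close>)
  have "(\<lambda>\<phi> z. \<phi> (z - (\<Sum>j\<in>F. axis j (of_nat (lookup u j))))) \<in> weyl" if "finite F" for F
    using that
  proof (induction F)
    case (insert j F)
    then show ?case
      using weyl.mult[OF x_pow[of j "lookup u j"] insert.IH]
      by (simp add: comp_def algebra_simps)
  qed (use id in simp)
  from this[of UNIV] show ?thesis
    by (simp add: cvec_expo)
qed

section \<open>Toric ideals and their Groebner bases\<close>

lemma exponent_dvd_iff:
  "(\<exists>r. m = p + r) \<longleftrightarrow> (\<forall>j. lookup p j \<le> lookup m j)" for m :: "'x \<Rightarrow>\<^sub>0 nat"
proof
  assume "\<forall>j. lookup p j \<le> lookup m j"
  then have "m = p + (m - p)"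
    by (intro poly_mapping_eqI) (simp add: lookup_add lookup_minus)
  then show "\<exists>r. m = p + r" ..
qed (auto simp: lookup_add)

definition of_fun :: "('n::finite \<Rightarrow> nat) \<Rightarrow> 'n \<Rightarrow>\<^sub>0 nat" where
  "of_fun f = Abs_poly_mapping f"

lemma lookup_of_fun [simp]: "lookup (of_fun f) = f"
  by (simp add: of_fun_def)

lemma finite_mdeg_eq: "finite {u :: 'n::finite \<Rightarrow>\<^sub>0 nat. mdeg u = N}"
proof -
  have "lookup u j \<le> mdeg u" for u :: "'n \<Rightarrow>\<^sub>0 nat" and j
    unfolding mdeg_superset[of UNIV u, simplified] by (rule member_le_sum) auto
  then have "lookup ` {u :: 'n \<Rightarrow>\<^sub>0 nat. mdeg u = N} \<subseteq> UNIV \<rightarrow>\<^sub>E {..N}"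
    by auto
  then have "finite (lookup ` {u :: 'n \<Rightarrow>\<^sub>0 nat. mdeg u = N})"
    by (rule finite_subset) (auto intro: finite_PiE)
  then show ?thesis
    by (rule finite_imageD) (rule inj_onI, rule poly_mapping_eqI, simp)
qed

lemma expo_add: "expo (u + t) = expo u + expo t"
  by (simp add: expo_def vec_eq_iff lookup_add)

text \<open>Used to replace ideal membership by linear span: the toric ideal is spanned by its
  binomials as a vector space, since monomial multiples of binomials are binomials of the same
  kind.\<close>

lemma cpoly_span_mult:
  assumes "\<And>u g. g \<in> S \<Longrightarrow> monom u * g \<in> cpoly.span S" "p \<in> ideal S"
  shows "p \<in> cpoly.span S"
  using assms(2)
proof (induction rule: ideal_induct)
  case (step c g p)
  have "c * g \<in> cpoly.span S"
  proof (induction c rule: cpoly_induct)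
    case (single u a)
    have "single u a * g = cscale a (monom u * g)"
      by (simp only: single_eq cscale_def mult.assoc)
    then show ?case
      using assms(1)[OF step.hyps] by (simp only: cpoly.span_scale)
  qed (simp add: distrib_right cpoly.span_add)
  then show ?case by (intro cpoly.span_add step.IH)
qed (rule cpoly.span_zero)

lemma toric_ideal_span:
  assumes "p \<in> toric_ideal A"
  shows "p \<in> cpoly.span {monom u - monom u' | u u'. A *v expo u = A *v expo u'}"
proof (rule cpoly_span_mult[OF _ assms[unfolded toric_ideal_def]])
  fix t g
  assume "g \<in> {monom u - monom u' | u u'. A *v expo u = A *v expo u'}"
  then obtain u u' where "g = monom u - monom u'" "A *v expo u = A *v expo u'" by auto
  then have "monom t * g = monom (t + u) - monom (t + u')"
    "A *v expo (t + u) = A *v expo (t + u')"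
    by (auto simp: right_diff_distrib monom_add expo_add matrix_vector_right_distrib)
  then show "monom t * g \<in> cpoly.span {monom u - monom u' | u u'. A *v expo u = A *v expo u'}"
    by (intro cpoly.span_base) blast
qed

text \<open>The two terms of a generating binomial lie in one fibre with opposite coefficients. This
  invariant shows that a binomial in the ideal cannot join two different fibres.\<close>

lemma toric_ideal_fibre_sum:
  assumes "f \<in> toric_ideal A"
  shows "(\<Sum>u\<in>keys f. if A *v expo u = a then lookup f u else 0) = 0"
  using toric_ideal_span[OF assms]
proof (induction rule: cpoly.span_induct_alt)
  case (step c g p)
  let ?s = "\<lambda>f :: 'a cpoly. \<Sum>u\<in>keys f. if A *v expo u = a then lookup f u else 0"
  have add: "?s (p + q) = ?s p + ?s q" for p q
    by (rule sum_keys_add[where F = "\<lambda>u x. if A *v expo u = a then x else 0"]) auto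
  have single: "?s (single u c) = (if A *v expo u = a then c else 0)" for u c
    by (rule sum_keys_single[where F = "\<lambda>u x. if A *v expo u = a then x else 0"]) auto
  from step.hyps obtain u u' where g: "g = monom u - monom u'" "A *v expo u = A *v expo u'" by auto
  have "cscale c g = single u c + single u' (- c)"
    by (simp only: g single_eq cscale_def right_diff_distrib const_uminus) simp
  then have "?s (cscale c g) = 0"
    by (simp only: add single g) simp
  then show ?case
    unfolding add step.IH by simp
qed simp

lemma binomial_in_toric_ideal: "monom p - monom q \<in> toric_ideal A \<longleftrightarrow> A *v expo p = A *v expo q"
proof
  show "monom p - monom q \<in> toric_ideal A" if "A *v expo p = A *v expo q"
    using that unfolding toric_ideal_def by (intro ideal_base) auto
  assume *: "monom p - monom q \<in> toric_ideal A"
  show "A *v expo p = A *v expo q"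
  proof (rule ccontr)
    assume neq: "A *v expo p \<noteq> A *v expo q"
    then have "p \<noteq> q" by auto
    then have "keys (monom p - monom q) = {p, q}"
      by (auto simp: in_keys_iff lookup_minus lookup_monom when_def split: if_splits)
    with toric_ideal_fibre_sum[OF *, of "A *v expo p"] neq \<open>p \<noteq> q\<close> show False
      by (auto simp: lookup_minus lookup_monom)
  qed
qed

lemma init_form_binomial:
  assumes "p \<noteq> q"
  shows "init_form w (monom p - monom q) =
    (if weight w q < weight w p then monom p else if weight w p < weight w q then - monom q
     else monom p - monom q)"
proof -
  let ?f = "monom p - monom q"
  have k: "keys ?f = {p, q}"
    using assms by (auto simp: in_keys_iff lookup_minus lookup_monom when_def split: if_splits)
  have l: "lookup ?f p = 1" "lookup ?f q = - 1"
    using assms by (auto simp: lookup_minus lookup_monom)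
  have "{u \<in> keys ?f. \<forall>u'\<in>keys ?f. weight w u' \<le> weight w u} =
    (if weight w q < weight w p then {p} else if weight w p < weight w q then {q} else {p, q})"
    unfolding k by auto
  then show ?thesis
    unfolding init_form_def using assms by (simp add: l) (simp add: monom_def single_uminus)
qed

section \<open>Groebner reduction, fibres and the cone C(w)\<close>

locale toric_groebner =
  fixes A :: "int ^ 'n::finite ^ 'd::finite" and w :: "real ^ 'n"
    and G :: "(('n \<Rightarrow>\<^sub>0 nat) \<times> ('n \<Rightarrow>\<^sub>0 nat)) set"
  assumes hyperplane: "\<exists>(c :: rat ^ 'd) r. c \<noteq> 0 \<and> r \<noteq> 0 \<and> (\<forall>j. (\<Sum>i\<in>UNIV. c $ i * of_int (A $ i $ j)) = r)"
    and groebner: "binomial_groebner_basis A w G"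
begin

abbreviation "M \<equiv> init_ideal w (toric_ideal A)"

text \<open>The basis property provides only some monic monomial as initial form. Comparing
  coefficients excludes \<open>- monom q\<close> and the whole binomial, so p strictly outweighs
  q.\<close>

lemma
  assumes "(p, q) \<in> G"
  shows groebner_neq: "p \<noteq> q" and groebner_weight: "weight w q < weight w p"
    and groebner_fibre: "A *v expo p = A *v expo q"
    and groebner_init: "init_form w (monom p - monom q) = monom p"
    and groebner_reduced:
      "monom p \<notin> ideal (init_form w ` ((\<lambda>(p, q). monom p - monom q) ` G - {monom p - monom q}))"
proof -
  let ?B = "(\<lambda>(p, q). monom p - monom q) ` G"
  have in_B: "monom p - monom q \<in> ?B" using assms by auto
  with groebner obtain u where u: "init_form w (monom p - monom q) = monom u"
    "monom u \<notin> ideal (init_form w ` (?B - {monom p - monom q}))"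
    unfolding binomial_groebner_basis_def reduced_groebner_basis_def by blast
  have "monom p - monom q \<in> toric_ideal A"
    using groebner in_B unfolding binomial_groebner_basis_def reduced_groebner_basis_def by blast
  then show "A *v expo p = A *v expo q" by (simp add: binomial_in_toric_ideal)
  show "p \<noteq> q"
  proof
    assume "p = q"
    with u(1) have "monom u = 0" by (simp add: init_form_def)
    then show False by simp
  qed
  have "- monom q \<noteq> monom u"
  proof
    assume "- monom q = monom u"
    then have "lookup (- monom q) u = lookup (monom u) u" by simp
    then show False by (simp add: lookup_monom when_def split: if_splits)
  qed
  moreover have "monom p - monom q \<noteq> monom u"
  proof
    assume *: "monom p - monom q = monom u"
    then have "lookup (monom p - monom q) q = lookup (monom u) q" by simp
    with \<open>p \<noteq> q\<close> show False by (simp add: lookup_minus lookup_monom when_def split: if_splits)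
  qed
  ultimately show w: "weight w q < weight w p"
    using u(1) init_form_binomial[OF \<open>p \<noteq> q\<close>, of w] by (auto split: if_splits)
  show i: "init_form w (monom p - monom q) = monom p"
    using init_form_binomial[OF \<open>p \<noteq> q\<close>, of w] w by simp
  with u show "monom p \<notin> ideal (init_form w ` (?B - {monom p - monom q}))"
    by simp
qed

lemma init_ideal_eq: "M = ideal (monom ` fst ` G)"
proof -
  have "init_form w ` (\<lambda>(p, q). monom p - monom q) ` G = monom ` fst ` G"
    unfolding image_image by (rule image_cong) (auto simp: groebner_init)
  with groebner show ?thesis
    unfolding binomial_groebner_basis_def reduced_groebner_basis_def by metis
qed

lemma in_init_ideal_iff: "monom m \<in> M \<longleftrightarrow> (\<exists>(p, q)\<in>G. \<forall>j. lookup p j \<le> lookup m j)"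
  unfolding init_ideal_eq monom_in_monomial_ideal exponent_dvd_iff
  by (auto simp: Bex_def split_beta image_iff)

text \<open>Finiteness is known for the set of binomials; a pair is recovered from its binomial
  because the initial form determines p.\<close>

lemma finite_G: "finite G"
proof (rule finite_imageD)
  show "finite ((\<lambda>(p, q). monom p - monom q) ` G)"
    using groebner unfolding binomial_groebner_basis_def reduced_groebner_basis_def by blast
  show "inj_on (\<lambda>(p, q). monom p - monom q) G"
  proof (rule inj_onI, clarify)
    fix p q p' q'
    assume *: "(p, q) \<in> G" "(p', q') \<in> G" "monom p - monom q = monom p' - monom q'"
    then have "monom p = monom p'"
      using groebner_init by metis
    with *(3) show "p = p' \<and> q = q'" by simp
  qed
qed

text \<open>The initial form of a binomial whose terms have equal weight is the binomial itself; it then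
  lies in a monomial ideal, so both terms do.\<close>

lemma standard_unique:
  assumes "A *v expo m = A *v expo m'" "monom m \<notin> M" "monom m' \<notin> M"
  shows "m = m'"
proof (rule ccontr)
  assume neq: "m \<noteq> m'"
  let ?f = "init_form w (monom m - monom m')"
  have "?f \<in> M"
    unfolding init_ideal_def using assms(1) by (intro ideal_base imageI) (simp add: binomial_in_toric_ideal)
  moreover have "m \<in> keys ?f \<or> m' \<in> keys ?f"
    using neq unfolding init_form_binomial[OF neq]
    by (auto simp: in_keys_iff lookup_minus lookup_monom)
  ultimately have "\<exists>t\<in>{m, m'}. \<exists>p\<in>fst ` G. \<exists>r. t = p + r"
    unfolding init_ideal_eq using keys_monomial_ideal by blast
  then show False
    using assms(2,3) unfolding init_ideal_eq monom_in_monomial_ideal by blast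
qed

text \<open>If the variable j divided both terms, cancelling it would give a binomial of the toric
  ideal whose initial monomial p' properly divides p. Some basis element with another initial
  monomial would then divide p' and hence p, against reducedness.\<close>

lemma groebner_disjoint:
  assumes "(p, q) \<in> G" shows "lookup p j = 0 \<or> lookup q j = 0"
proof (rule ccontr)
  assume "\<not> ?thesis"
  then have pos: "1 \<le> lookup p j" "1 \<le> lookup q j" by auto
  let ?e = "single j (1::nat)"
  have le: "\<forall>i. lookup ?e i \<le> lookup p i" "\<forall>i. lookup ?e i \<le> lookup q i"
    using pos by (auto simp: lookup_single when_def)
  then obtain p' q' where pq: "p = ?e + p'" "q = ?e + q'"
    unfolding exponent_dvd_iff[symmetric] by blast
  have neq: "p' \<noteq> q'"
    using groebner_neq[OF assms] by (auto simp: pq)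
  have "weight w q' < weight w p'"
    using groebner_weight[OF assms]
    by (simp add: weight_def pq lookup_add distrib_left sum.distrib)
  then have init: "init_form w (monom p' - monom q') = monom p'"
    by (simp add: init_form_binomial[OF neq])
  have "monom p' - monom q' \<in> toric_ideal A"
    using groebner_fibre[OF assms]
    by (simp add: binomial_in_toric_ideal pq expo_add matrix_vector_right_distrib)
  then have "init_form w (monom p' - monom q') \<in> M"
    unfolding init_ideal_def by (intro ideal_base imageI)
  then have "monom p' \<in> M"
    unfolding init .
  then obtain a b where ab: "(a, b) \<in> G" "\<forall>i. lookup a i \<le> lookup p' i"
    unfolding in_init_ideal_iff by blast
  have "lookup p' j < lookup p j"
    by (simp add: pq lookup_add)
  with ab(2)[rule_format, of j] have "a \<noteq> p" by auto
  have "monom a - monom b \<noteq> monom p - monom q"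
    using groebner_init[OF assms] groebner_init[OF ab(1)] \<open>a \<noteq> p\<close> by auto
  then have "monom a \<in> init_form w ` ((\<lambda>(p, q). monom p - monom q) ` G - {monom p - monom q})"
    using ab(1) groebner_init[OF ab(1)] by (intro image_eqI[of _ _ "monom a - monom b"]) auto
  moreover obtain r where "p = r + a"
  proof -
    have "\<forall>i. lookup a i \<le> lookup p i"
      using ab(2) by (auto simp: pq lookup_add intro: trans_le_add2)
    then show ?thesis
      using that unfolding exponent_dvd_iff[symmetric] by (metis add.commute)
  qed
  ultimately show False
    using groebner_reduced[OF assms] ideal_mult[OF ideal_base] by (metis monom_add)
qed

text \<open>The functional c sends A m to r times the degree of m, so all monomials in a fibre have
  the same degree. Since w may have negative entries, this is what makes reduction inside a fibre
  terminate.\<close>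

lemma finite_fibre: "finite {m. A *v expo m = a}"
proof -
  obtain c :: "rat ^ 'd" and r where r: "r \<noteq> 0"
    and c: "\<And>j. (\<Sum>i\<in>UNIV. c $ i * of_int (A $ i $ j)) = r"
    using hyperplane by blast
  let ?s = "\<Sum>i\<in>UNIV. c $ i * of_int (a $ i)"
  have "mdeg m = nat \<lfloor>?s / r\<rfloor>" if "A *v expo m = a" for m
  proof -
    have "?s = (\<Sum>i\<in>UNIV. \<Sum>j\<in>UNIV. c $ i * of_int (A $ i $ j) * of_nat (lookup m j))"
      unfolding that[symmetric]
      by (simp add: matrix_vector_mult_def expo_def sum_distrib_left mult.assoc)
    also have "\<dots> = (\<Sum>j\<in>UNIV. (\<Sum>i\<in>UNIV. c $ i * of_int (A $ i $ j)) * of_nat (lookup m j))"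
      unfolding sum_distrib_right by (rule sum.swap)
    also have "\<dots> = r * of_nat (mdeg m)"
      by (simp add: c mdeg_superset[of UNIV] sum_distrib_left)
    finally show ?thesis
      using r by simp
  qed
  then have "{m. A *v expo m = a} \<subseteq> {m. mdeg m = nat \<lfloor>?s / r\<rfloor>}" by blast
  then show ?thesis
    by (rule finite_subset) (rule finite_mdeg_eq)
qed

lemma Cw_0: "0 \<in> Cw G"
  unfolding Cw_def by (intro CollectI exI[of _ "\<lambda>_. 0"]) (simp add: vec_eq_iff)

lemma Cw_add_gvec:
  assumes "u \<in> Cw G" "g \<in> G" shows "u + gvec g \<in> Cw G"
proof -
  obtain c where c: "u = (\<Sum>g\<in>G. int (c g) *s gvec g)"
    using assms(1) by (auto simp: Cw_def)
  have "(\<Sum>x\<in>G. int (if x = g then 1 else 0) *s gvec x) = gvec g"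
    using assms(2) finite_G by (subst sum.remove[of _ g]) (auto intro!: sum.neutral)
  then have "u + gvec g = (\<Sum>x\<in>G. int (c x + (if x = g then 1 else 0)) *s gvec x)"
    unfolding c of_nat_add vector_sadd_rdistrib sum.distrib by simp
  then show ?thesis
    unfolding Cw_def by (intro CollectI exI[of _ "\<lambda>x. c x + (if x = g then 1 else 0)"]) simp
qed

text \<open>Each reduction step replaces p + r by q + r and so subtracts one \<open>gvec\<close>; it
  ends at s, the only standard monomial of the fibre. The induction counts the lighter monomials of
  the fibre.\<close>

lemma reduction_in_Cw:
  assumes "A *v expo m = A *v expo s" "monom s \<notin> M"
  shows "expo m - expo s \<in> Cw G"
  using assms(1)
proof (induction m rule: measure_induct_rule[of "\<lambda>m. card {x. A *v expo x = A *v expo s \<and> weight w x < weight w m}"])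
  case (less m)
  show ?case
  proof (cases "monom m \<in> M")
    case False
    with standard_unique[OF less.prems] assms(2) show ?thesis
      by (simp add: Cw_0)
  next
    case True
    then obtain p q where pq: "(p, q) \<in> G" "\<forall>j. lookup p j \<le> lookup m j"
      unfolding in_init_ideal_iff by blast
    then obtain r where m: "m = p + r"
      unfolding exponent_dvd_iff[symmetric] by blast
    let ?m' = "q + r"
    have fib: "A *v expo ?m' = A *v expo s"
      using less.prems groebner_fibre[OF pq(1)] by (simp add: m expo_add matrix_vector_right_distrib)
    have wt: "weight w ?m' < weight w m"
      using groebner_weight[OF pq(1)] by (simp add: weight_def m lookup_add distrib_left sum.distrib)
    have "finite {x. A *v expo x = A *v expo s \<and> weight w x < weight w m}"
      by (rule finite_subset[OF _ finite_fibre[of "A *v expo s"]]) auto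
    then have "card {x. A *v expo x = A *v expo s \<and> weight w x < weight w ?m'}
      < card {x. A *v expo x = A *v expo s \<and> weight w x < weight w m}"
      using wt fib by (intro psubset_card_mono) auto
    from less.IH[OF this fib] have "expo ?m' - expo s \<in> Cw G" .
    from Cw_add_gvec[OF this pq(1)] show ?thesis
      by (simp add: m expo_add gvec_def algebra_simps)
  qed
qed

lemma inner_gvec_pos: "g \<in> G \<Longrightarrow> 0 < w \<bullet> rvec (gvec g)"
  using groebner_weight[of "fst g" "snd g"]
  by (simp add: weight_def inner_vec_def rvec_def gvec_def expo_def right_diff_distrib sum_subtractf)

end

section \<open>Standard pairs and the link\<close>

text \<open>The coordinates at which the falling factorial v(v-1)...(v-p+1) vanishes. For a Groebner
  basis element with initial exponent p it is the set
  \<open>G = I\<^sub>-\<^sub>g - I\<^sub>0\<close>, by \<open>nsuppL_gvec\<close>.\<close>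

definition zset :: "complex ^ 'n \<Rightarrow> ('n \<Rightarrow>\<^sub>0 nat) \<Rightarrow> 'n::finite set" where
  "zset v p = {j. \<exists>k. k < lookup p j \<and> v $ j = of_nat k}"

lemma zset_subset_keys: "zset v p \<subseteq> keys p"
  by (auto simp: zset_def in_keys_iff)

lemma nsupp_not_nat: "j \<in> nsupp v \<Longrightarrow> v $ j \<noteq> of_nat k"
proof
  assume "j \<in> nsupp v" "v $ j = of_nat k"
  then obtain i :: int where "i < 0" "(of_int i :: complex) = of_int (int k)"
    by (auto simp: nsupp_def)
  then show False unfolding of_int_eq_iff by simp
qed

context toric_groebner
begin

text \<open>The point v - g is v - p + q. By disjointness of p and q, a coordinate that leaves the
  natural numbers does so by subtracting p alone, which means that p exceeds it.\<close>

lemma nsuppL_gvec: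
  assumes "(p, q) \<in> G" shows "nsuppL v (- gvec (p, q)) - nsupp v = zset v p"
proof (intro set_eqI iffI)
  fix j assume "j \<in> nsuppL v (- gvec (p, q)) - nsupp v"
  then obtain k :: int where k: "k < 0" "v $ j + (of_nat (lookup q j) - of_nat (lookup p j)) = of_int k"
    and j: "j \<notin> nsupp v"
    by (auto simp: nsuppL_def nsupp_def cvec_def gvec_def expo_def)
  define i where "i = k + int (lookup p j) - int (lookup q j)"
  have v: "v $ j = of_int i"
    using k(2) by (simp add: i_def algebra_simps)
  with j have "0 \<le> i"
    unfolding nsupp_def by (metis (mono_tags, lifting) linorder_not_le mem_Collect_eq)
  then have "v $ j = of_nat (nat i)" "nat i < lookup p j"
    using v k(1) by (auto simp: i_def)
  then show "j \<in> zset v p" unfolding zset_def by blast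
next
  fix j assume j: "j \<in> zset v p"
  then obtain k where k: "k < lookup p j" "v $ j = of_nat k"
    by (auto simp: zset_def)
  then have "lookup q j = 0"
    using groebner_disjoint[OF assms, of j] by auto
  then have "(v + cvec (- gvec (p, q))) $ j = of_int (int k - int (lookup p j))"
    by (simp add: cvec_def gvec_def expo_def k)
  with k(1) have "j \<in> nsuppL v (- gvec (p, q))"
    unfolding nsuppL_def nsupp_def by (intro CollectI exI[of _ "int k - int (lookup p j)"]) simp
  moreover have "j \<notin> nsupp v"
    using k(2) nsupp_not_nat by metis
  ultimately show "j \<in> nsuppL v (- gvec (p, q)) - nsupp v" by blast
qed

text \<open>The free directions of a standard pair can be raised arbitrarily, so divisibility by p
  is decided at the coordinates where p exceeds v, that is by \<open>zset v p\<close>. Conversely, a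
  maximal set avoiding all \<open>zset\<close> and containing the required coordinates is the
  \<sigma> of a standard pair.\<close>

lemma link_iff:
  assumes "\<tau> \<subseteq> - nsupp v"
  shows "\<tau> \<in> link A w v \<longleftrightarrow> (\<forall>p q. (p, q) \<in> G \<longrightarrow> \<not> zset v p \<subseteq> \<tau>)"
proof
  assume "\<tau> \<in> link A w v"
  then obtain a \<sigma> where a: "(a, \<sigma>) \<in> std_pairs_at A w v" "\<tau> \<union> nsupp v \<subseteq> \<sigma>"
    by (auto simp: link_def Delta_def)
  show "\<forall>p q. (p, q) \<in> G \<longrightarrow> \<not> zset v p \<subseteq> \<tau>"
  proof (clarify)
    fix p q assume pq: "(p, q) \<in> G" and sub: "zset v p \<subseteq> \<tau>"
    \<comment> \<open>Raising a by b reaches p inside \<sigma>. Outside, a agrees with v and is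
      already at least p, since otherwise the coordinate would lie in
      \<open>zset v p\<close>.\<close>
    define b where "b = of_fun (\<lambda>j. if j \<in> \<sigma> then lookup p j else 0)"
    have "lookup p j \<le> lookup (a + b) j" for j
    proof (cases "j \<in> \<sigma>")
      case False
      then have "v $ j = of_nat (lookup a j)"
        using a(1) by (auto simp: std_pairs_at_def)
      moreover have "j \<notin> zset v p"
        using False a(2) sub by auto
      ultimately show ?thesis
        by (auto simp: zset_def lookup_add b_def False)
    qed (simp add: b_def lookup_add)
    then have "monom (a + b) \<in> M"
      unfolding in_init_ideal_iff using pq by blast
    moreover have "keys b \<subseteq> \<sigma>"
      by (auto simp: b_def in_keys_iff split: if_splits)
    ultimately show False
      using a(1) by (auto simp: std_pairs_at_def standard_pairs_def)
  qed
next
  assume no: "\<forall>p q. (p, q) \<in> G \<longrightarrow> \<not> zset v p \<subseteq> \<tau>"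
  \<comment> \<open>Off \<sigma> a standard pair has to agree with v, so all non-natural coordinates
    go into \<sigma>. This completes no \<open>zset\<close>, because those contain natural
    coordinates only. Maximality of \<sigma> later yields the third condition on standard
    pairs.\<close>
  define good where "good \<sigma> \<longleftrightarrow> \<tau> \<union> {j. v $ j \<notin> \<nat>} \<subseteq> \<sigma> \<and> (\<forall>p q. (p, q) \<in> G \<longrightarrow> \<not> zset v p \<subseteq> \<sigma>)" for \<sigma>
  have "good (\<tau> \<union> {j. v $ j \<notin> \<nat>})"
    using no unfolding good_def zset_def by fastforce
  then obtain \<sigma> where \<sigma>: "good \<sigma>" "\<And>\<sigma>'. good \<sigma>' \<Longrightarrow> \<sigma> \<subseteq> \<sigma>' \<Longrightarrow> \<sigma> = \<sigma>'"
    using finite_has_maximal[of "{\<sigma>. good \<sigma>}"] by auto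
  define nt where "nt j = nat \<lfloor>Re (v $ j)\<rfloor>" for j
  have nt: "v $ j = of_nat (nt j)" if "j \<notin> \<sigma>" for j
  proof -
    have "v $ j \<in> \<nat>" using that \<sigma>(1) by (auto simp: good_def)
    then obtain k where "v $ j = of_nat k" by (auto elim: Nats_cases)
    then show ?thesis by (simp add: nt_def)
  qed
  define a where "a = of_fun (\<lambda>j. if j \<in> \<sigma> then 0 else nt j)"
  have "(a, \<sigma>) \<in> std_pairs_at A w v"
    unfolding std_pairs_at_def standard_pairs_def
  proof (intro CollectI case_prodI conjI allI impI ballI)
    fix b :: "'n \<Rightarrow>\<^sub>0 nat" assume b: "keys b \<subseteq> \<sigma>"
    show "monom (a + b) \<notin> M"
    proof
      assume "monom (a + b) \<in> M"
      then obtain p q where pq: "(p, q) \<in> G" "\<forall>j. lookup p j \<le> lookup (a + b) j"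
        unfolding in_init_ideal_iff by blast
      then obtain j where j: "j \<in> zset v p" "j \<notin> \<sigma>"
        using \<sigma>(1) unfolding good_def by blast
      then have "nt j < lookup p j"
        using nt[of j] by (auto simp: zset_def)
      moreover have "lookup b j = 0"
        using b j(2) by (auto simp: in_keys_iff)
      ultimately show False
        using pq(2)[rule_format, of j] j(2) by (simp add: lookup_add a_def)
    qed
  next
    fix l assume l: "l \<notin> \<sigma>"
    have "\<not> good (insert l \<sigma>)"
      using \<sigma>(2)[of "insert l \<sigma>"] l by auto
    then obtain p q where pq: "(p, q) \<in> G" "zset v p \<subseteq> insert l \<sigma>"
      using \<sigma>(1) by (auto simp: good_def)
    define b where "b = of_fun (\<lambda>j. if j \<in> insert l \<sigma> then lookup p j else 0)"
    have "lookup p j \<le> lookup (a + b) j" for j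
    proof (cases "j \<in> insert l \<sigma>")
      case False
      then have "j \<notin> zset v p" "v $ j = of_nat (nt j)"
        using pq(2) nt by auto
      then show ?thesis
        using False by (auto simp: zset_def lookup_add a_def b_def)
    qed (simp add: b_def lookup_add)
    then have "monom (a + b) \<in> M"
      unfolding in_init_ideal_iff using pq(1) by blast
    moreover have "keys b \<subseteq> insert l \<sigma>"
      by (auto simp: b_def in_keys_iff split: if_splits)
    ultimately show "\<exists>b. keys b \<subseteq> insert l \<sigma> \<and> monom (a + b) \<in> M" by blast
  qed (auto simp: a_def nt)
  moreover have "nsupp v \<subseteq> {j. v $ j \<notin> \<nat>}"
    by (auto simp: Nats_def dest: nsupp_not_nat)
  then have "\<tau> \<union> nsupp v \<subseteq> \<sigma>"
    using \<sigma>(1) by (auto simp: good_def)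
  ultimately show "\<tau> \<in> link A w v"
    using assms unfolding link_def Delta_def by blast
qed

text \<open>The positive and negative parts of x are exponents in one fibre. Both are supported on
  \<tau>, hence standard: a dividing p would have \<open>zset v p\<close> inside \<tau>. A fibre has
  at most one standard monomial, so the parts coincide.\<close>

lemma columns_independent:
  assumes no: "\<forall>p q. (p, q) \<in> G \<longrightarrow> \<not> zset v p \<subseteq> \<tau>"
    and x: "A *v x = 0" "\<And>j. j \<notin> \<tau> \<Longrightarrow> x $ j = 0"
  shows "x = 0"
proof -
  define c where "c = of_fun (\<lambda>j. nat (x $ j))"
  define d where "d = of_fun (\<lambda>j. nat (- x $ j))"
  have cd: "expo c - expo d = x"
    by (simp add: c_def d_def expo_def vec_eq_iff)
  have std: "monom m \<notin> M" if "keys m \<subseteq> \<tau>" for m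
  proof
    assume "monom m \<in> M"
    then obtain p q where pq: "(p, q) \<in> G" "\<forall>j. lookup p j \<le> lookup m j"
      unfolding in_init_ideal_iff by blast
    then have "lookup m j \<noteq> 0" if "lookup p j \<noteq> 0" for j
      using that by (metis le_zero_eq)
    then have "keys p \<subseteq> keys m"
      by (auto simp: in_keys_iff)
    then have "zset v p \<subseteq> \<tau>"
      using that zset_subset_keys[of v p] by (metis subset_trans)
    with no pq(1) show False by blast
  qed
  have "keys c \<subseteq> \<tau>" "keys d \<subseteq> \<tau>"
    using x(2) by (force simp: c_def d_def in_keys_iff)+
  moreover have "A *v expo c = A *v expo d"
    using x(1) unfolding cd[symmetric] matrix_vector_mult_diff_distrib by simp
  ultimately have "c = d"
    using standard_unique std by blast
  with cd show ?thesis by simp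
qed

text \<open>Any kernel vector u with the negative support of v is a difference m - s with s standard
  in the fibre of m, so \<open>reduction_in_Cw\<close> applies.\<close>

lemma nsupp_in_NS:
  assumes "\<forall>p q. (p, q) \<in> G \<longrightarrow> zset v p \<noteq> {}"
  shows "nsupp v \<in> NS A v G"
proof -
  have v0: "nsuppL v 0 = nsupp v"
    by (simp add: nsuppL_def cvec_def zero_vec_def[symmetric])
  have "u \<in> Cw G" if u: "u \<in> kerZ A" "nsuppL v u = nsupp v" for u
  proof -
    define nt where "nt j = nat \<lfloor>Re (v $ j)\<rfloor>" for j
    have nt: "v $ j = of_nat (nt j)" if "v $ j \<in> \<nat>" for j
    proof -
      from that obtain k where "v $ j = of_nat k" by (auto elim: Nats_cases)
      then show ?thesis by (simp add: nt_def)
    qed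
    \<comment> \<open>On natural coordinates s equals v, which some coordinate of every p exceeds;
      this makes s standard. Elsewhere s is chosen just large enough that s + u is
      nonnegative.\<close>
    define s where "s = of_fun (\<lambda>j. if v $ j \<in> \<nat> then nt j else nat (- u $ j))"
    define m where "m = of_fun (\<lambda>j. nat (int (lookup s j) + u $ j))"
    have "0 \<le> int (lookup s j) + u $ j" for j
    proof (cases "v $ j \<in> \<nat>")
      case True
      have "j \<notin> nsuppL v u"
        unfolding u(2) using nt[OF True] nsupp_not_nat by metis
      moreover have "(v + cvec u) $ j = of_int (int (nt j) + u $ j)"
        using nt[OF True] by (simp add: cvec_def)
      ultimately show ?thesis
        using True unfolding nsuppL_def nsupp_def s_def by (auto simp: not_less)
    qed (simp add: s_def)
    then have um: "expo m - expo s = u"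
      by (simp add: expo_def m_def vec_eq_iff)
    have "monom s \<notin> M"
    proof
      assume "monom s \<in> M"
      then obtain p q where pq: "(p, q) \<in> G" "\<forall>j. lookup p j \<le> lookup s j"
        unfolding in_init_ideal_iff by blast
      then obtain j k where "k < lookup p j" "v $ j = of_nat k"
        using assms by (fastforce simp: zset_def)
      moreover from this nt[of j] have "lookup s j = k"
        by (simp add: s_def)
      ultimately show False
        using pq(2)[rule_format, of j] by simp
    qed
    moreover have "A *v expo m = A *v expo s"
      using u(1) unfolding kerZ_def um[symmetric] by (simp add: matrix_vector_mult_diff_distrib)
    ultimately show ?thesis
      using reduction_in_Cw um by metis
  qed
  then have "nsuppL v 0 \<in> NS A v G"
    unfolding NS_def using v0 by (intro CollectI exI[of _ 0]) (auto simp: kerZ_def)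
  then show ?thesis by (simp add: v0)
qed

end

section \<open>Linear algebra\<close>

subsection \<open>Rational matrices\<close>

lemma common_denominator:
  fixes x :: "rat ^ 'n::finite"
  obtains N :: int and u :: "int ^ 'n" where "0 < N" "\<And>j. of_int N * x $ j = of_int (u $ j)"
proof -
  have "\<exists>a b :: int. 0 < b \<and> of_int b * x $ j = of_int a" for j
  proof (cases "x $ j")
    case (Fract a b)
    then show ?thesis
      by (intro exI[of _ a] exI[of _ b]) (simp add: Fract_of_int_quotient)
  qed
  then obtain a b :: "'n \<Rightarrow> int" where b: "\<And>j. 0 < b j" "\<And>j. of_int (b j) * x $ j = of_int (a j)"
    by metis
  show ?thesis
  proof (rule that)
    show "0 < (\<Prod>j\<in>UNIV. b j)" by (simp add: prod_pos b)
    show "of_int (\<Prod>j\<in>UNIV. b j) * x $ j = of_int ((\<chi> j. (\<Prod>i\<in>UNIV - {j}. b i) * a j) $ j)" for j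
    proof -
      have "of_int (\<Prod>j\<in>UNIV. b j) * x $ j = of_int (\<Prod>i\<in>UNIV - {j}. b i) * (of_int (b j) * x $ j)"
        by (subst prod.remove[of UNIV j]) (simp_all add: mult_ac)
      then show ?thesis by (simp add: b)
    qed
  qed
qed

text \<open>The rank is the dimension of the set of rows. Its equality with the number of indices
  forces the rows to be distinct as well as independent, so the indexed family is
  independent.\<close>

lemma full_row_rank_right_inverse:
  fixes B :: "'a::field ^ 'n::finite ^ 'd::finite"
  assumes "rank B = CARD('d)"
  obtains R :: "'a ^ 'd ^ 'n" where "B ** R = mat 1"
proof -
  have rows: "rows B = range (\<lambda>i. row i B)"
    by (auto simp: rows_def)
  have "card (rows B) \<le> CARD('d)"
    unfolding rows by (rule card_image_le) simp
  moreover have "vec.dim (rows B) \<le> card (rows B)"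
    by (rule vec.dim_le_card[OF vec.span_superset]) (simp add: rows)
  ultimately have card: "card (rows B) = CARD('d)" "card (rows B) = vec.dim (rows B)"
    using assms by (auto simp: row_rank_def_gen)
  have ind: "\<not> vec.dependent (rows B)"
    by (rule vec.card_le_dim_spanning[of _ "rows B"]) (use card in \<open>auto simp: vec.span_superset rows\<close>)
  have inj: "inj (\<lambda>i. row i B)"
    using card(1) unfolding rows by (intro eq_card_imp_inj_on) auto
  have "c i = 0" if c: "(\<Sum>i\<in>UNIV. c i *s row i B) = 0" for c i
  proof -
    let ?r = "\<lambda>i. row i B"
    have "(\<Sum>x\<in>rows B. c (inv ?r x) *s x) = (\<Sum>i\<in>UNIV. c i *s row i B)"
      unfolding rows by (subst sum.reindex[OF inj]) (simp add: inv_f_f[OF inj])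
    with c have "c (inv ?r (?r i)) = 0"
      by (intro vec.independentD[OF ind, of "rows B" "\<lambda>x. c (inv ?r x)" "?r i"]) (auto simp: rows)
    then show ?thesis by (simp add: inv_f_f[OF inj])
  qed
  then have "\<exists>R :: 'a ^ 'd ^ 'n. B ** R = mat 1"
    unfolding matrix_right_invertible_independent_rows by simp
  then show ?thesis using that by auto
qed

text \<open>Clearing denominators extends independence from integer to rational vectors, so A has a
  left inverse on the vectors supported on \<tau>; y is its j-th row. Modulo the Euler operators
  this expresses \<open>D\<^sub>j\<close> by derivatives outside \<tau>.\<close>

lemma dual_functional:
  fixes A :: "int ^ 'n::finite ^ 'd::finite"
  assumes ind: "\<And>x. A *v x = 0 \<Longrightarrow> (\<And>j. j \<notin> \<tau> \<Longrightarrow> x $ j = 0) \<Longrightarrow> x = 0" and "j \<in> \<tau>"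
  obtains y :: "'d \<Rightarrow> complex"
  where "\<And>k. k \<in> \<tau> \<Longrightarrow> (\<Sum>i\<in>UNIV. y i * of_int (A $ i $ k)) = (if k = j then 1 else 0)"
proof -
  let ?A = "map_matrix of_int A :: rat ^ 'n ^ 'd"
  let ?V = "{x :: rat ^ 'n. \<forall>j. j \<notin> \<tau> \<longrightarrow> x $ j = 0}"
  have sub: "vec.subspace ?V"
    by (auto simp: vec.subspace_def)
  have "x = 0" if x: "x \<in> ?V" "?A *v x = 0" for x
  proof -
    obtain N u where N: "0 < N" "\<And>j. of_int N * x $ j = of_int (u $ j)"
      using common_denominator[of x] by blast
    have "of_int ((A *v u) $ i) = of_int N * (?A *v x) $ i" for i
      by (simp add: matrix_vector_mult_def sum_distrib_left map_matrix_def N(2)[symmetric] mult_ac)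
    then have "(of_int ((A *v u) $ i) :: rat) = 0" for i
      using x(2) by simp
    then have "A *v u = 0"
      by (simp add: vec_eq_iff)
    moreover have "u $ j = 0" if "j \<notin> \<tau>" for j
      using N(2)[of j] x(1) that by simp
    ultimately have "u = 0" by (rule ind)
    then have "of_int N * x $ j = 0" for j using N(2)[of j] by simp
    with N(1) show ?thesis by (simp add: vec_eq_iff)
  qed
  then have inj: "inj_on ((*v) ?A) ?V"
    by (subst vec.linear_inj_on_iff_eq_0[OF matrix_vector_mul_linear_gen sub]) auto
  obtain g :: "rat ^ 'd \<Rightarrow> rat ^ 'n" where g: "Vector_Spaces.linear (*s) (*s) g" "\<forall>x\<in>?V. g (?A *v x) = x"
    using vec.linear_exists_left_inverse_on[OF matrix_vector_mul_linear_gen sub inj] by (elim exE conjE)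
  define y where "y i = matrix g $ j $ i" for i
  have "(\<Sum>i\<in>UNIV. y i * of_int (A $ i $ k)) = (if k = j then 1 else 0)" if "k \<in> \<tau>" for k
  proof -
    have "axis k 1 \<in> ?V" using that by (auto simp: axis_def)
    from bspec[OF g(2) this] have "(matrix g *v (?A *v axis k 1)) $ j = axis k 1 $ j"
      by (simp add: matrix_works[OF g(1)])
    moreover have "?A *v axis k 1 = (\<chi> i. of_int (A $ i $ k))"
      by (simp add: matrix_vector_mult_def vec_eq_iff map_matrix_def axis_def if_distrib cong: if_cong)
    ultimately have "(matrix g *v (\<chi> i. of_int (A $ i $ k))) $ j = axis k 1 $ j"
      by (simp only:)
    then show ?thesis
      by (auto simp: matrix_vector_mult_def y_def axis_def)
  qed
  then have "of_rat (\<Sum>i\<in>UNIV. y i * of_int (A $ i $ k)) = (if k = j then 1 else 0 :: complex)"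
    if "k \<in> \<tau>" for k
    using that by simp
  then show ?thesis
    by (intro that[of "\<lambda>i. of_rat (y i)"]) (simp add: of_rat_sum of_rat_mult)
qed

lemma int_span_image:
  fixes b :: "nat \<Rightarrow> int ^ 'n::finite"
  assumes "u \<in> module.span (*s) (b ` {..<h})"
  obtains c where "u = (\<Sum>k<h. c k *s b k)"
proof -
  interpret zmod: module "(*s) :: int \<Rightarrow> int ^ 'n \<Rightarrow> int ^ 'n"
    by unfold_locales (simp_all add: vector_add_ldistrib vector_sadd_rdistrib)
  from assms have "\<exists>c. u = (\<Sum>k<h. c k *s b k)"
  proof (induction rule: zmod.span_induct_alt)
    case base
    show ?case by (intro exI[of _ "\<lambda>_. 0"]) simp
  next
    case (step a x y)
    then obtain k c where k: "k < h" "x = b k" and y: "y = (\<Sum>k<h. c k *s b k)" by auto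
    have "(\<Sum>i<h. (if i = k then a else 0) *s b i) = a *s b k"
      using k(1) by (subst sum.remove[of _ k]) (auto intro!: sum.neutral)
    then show ?case
      by (intro exI[of _ "\<lambda>i. (if i = k then a else 0) + c i"])
        (simp only: vector_sadd_rdistrib sum.distrib k y)
  qed
  then show ?thesis using that by blast
qed

text \<open>With \<open>R\<close> a right inverse of \<open>A\<close>, the matrix \<open>1 - RA\<close> maps into the kernel of \<open>A\<close> and hence
  factors through the basis of the integer kernel.\<close>

lemma kernel_section:
  fixes A :: "int ^ 'n::finite ^ 'd::finite"
  assumes "rank (map_matrix of_int A :: rat ^ 'n ^ 'd) = CARD('d)"
    and "Z_basis h b (kerZ A)"
  shows "\<exists>(c :: nat \<Rightarrow> 'n \<Rightarrow> complex) (R :: 'n \<Rightarrow> 'd \<Rightarrow> complex). \<forall>j l.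
    (\<Sum>k<h. of_int (b k $ j) * c k l)
    = (if j = l then 1 else 0) - (\<Sum>i\<in>UNIV. R j i * of_int (A $ i $ l))"
proof -
  let ?A = "map_matrix of_int A :: rat ^ 'n ^ 'd"
  obtain R :: "rat ^ 'd ^ 'n" where R: "?A ** R = mat 1"
    using full_row_rank_right_inverse[OF assms(1)] .
  have "\<exists>c. \<forall>j. (\<Sum>k<h. of_int (b k $ j) * c k)
    = (if j = l then 1 else 0) - (\<Sum>i\<in>UNIV. R $ j $ i * of_int (A $ i $ l))" for l
  proof -
    \<comment> \<open>This is column l of 1 - RA. A multiple N x is an integer kernel vector; its
      coordinates in the basis, divided by N, give c.\<close>
    define x where "x = axis l 1 - R *v (?A *v axis l 1)"
    have Ae: "?A *v axis l 1 = (\<chi> i. of_int (A $ i $ l))"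
      by (simp add: matrix_vector_mult_def vec_eq_iff map_matrix_def axis_def if_distrib cong: if_cong)
    have xj: "x $ j = (if j = l then 1 else 0) - (\<Sum>i\<in>UNIV. R $ j $ i * of_int (A $ i $ l))" for j
      by (simp add: x_def Ae) (simp add: matrix_vector_mult_def axis_def)
    have Ax: "?A *v x = 0"
      unfolding x_def matrix_vector_mult_diff_distrib matrix_vector_mul_assoc[of ?A R] R
      by (simp add: matrix_vector_mul_lid)
    obtain N u where N: "0 < N" "\<And>j. of_int N * x $ j = of_int (u $ j)"
      using common_denominator[of x] by blast
    have "of_int ((A *v u) $ i) = of_int N * (?A *v x) $ i" for i
      by (simp add: matrix_vector_mult_def sum_distrib_left map_matrix_def N(2)[symmetric] mult_ac)
    then have "(of_int ((A *v u) $ i) :: rat) = 0" for i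
      using Ax by simp
    then have "u \<in> kerZ A"
      by (simp add: vec_eq_iff kerZ_def)
    with assms(2) have "u \<in> module.span (*s) (b ` {..<h})"
      by (simp add: Z_basis_def)
    then obtain m where m: "u = (\<Sum>k<h. m k *s b k)"
      by (rule int_span_image)
    have "(\<Sum>k<h. of_int (b k $ j) * (of_int (m k) / of_int N)) = x $ j" for j
    proof -
      have "of_int N * x $ j = (\<Sum>k<h. of_int (b k $ j) * of_int (m k))"
        unfolding N(2) by (simp add: m mult.commute)
      then show ?thesis
        using N(1) by (simp add: sum_divide_distrib[symmetric] field_simps)
    qed
    then show ?thesis
      unfolding xj by (intro exI[of _ "\<lambda>k. of_int (m k) / of_int N"]) simp
  qed
  then obtain c where c: "\<And>j l. (\<Sum>k<h. of_int (b k $ j) * c l k)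
    = (if j = l then 1 else 0) - (\<Sum>i\<in>UNIV. R $ j $ i * of_int (A $ i $ l))"
    by metis
  have "of_rat (\<Sum>k<h. of_int (b k $ j) * c l k)
    = (of_rat ((if j = l then 1 else 0) - (\<Sum>i\<in>UNIV. R $ j $ i * of_int (A $ i $ l))) :: complex)" for j l
    by (simp only: c)
  then show ?thesis
    by (intro exI[of _ "\<lambda>k l. of_rat (c l k)"] exI[of _ "\<lambda>j i. of_rat (R $ j $ i)"])
      (simp add: of_rat_sum of_rat_mult of_rat_diff if_distrib[of of_rat])
qed

subsection \<open>Dimensions of spaces of polynomials\<close>

text \<open>The apolarity pairing. Distinct monomials are orthogonal, a monomial u pairs with itself
  to u!, and multiplication by q is adjoint to \<open>act q\<close>.\<close>

definition pairing :: "'n::finite cpoly \<Rightarrow> 'n cpoly \<Rightarrow> complex" where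
  "pairing g f = lookup (act g f) 0"

lemma pairing_add_left: "pairing (g + g') f = pairing g f + pairing g' f"
  and pairing_add_right: "pairing g (f + f') = pairing g f + pairing g f'"
  and pairing_diff_left: "pairing (g - g') f = pairing g f - pairing g' f"
  and pairing_diff_right: "pairing g (f - f') = pairing g f - pairing g f'"
  and pairing_cscale_left: "pairing (cscale c g) f = c * pairing g f"
  and pairing_cscale_right: "pairing g (cscale c f) = c * pairing g f"
  and pairing_0_left [simp]: "pairing 0 f = 0"
  and pairing_0_right [simp]: "pairing g 0 = 0"
  by (simp_all add: pairing_def act_add_left act_add_right act_diff_left act_diff_right
      act_cscale_left act_cscale_right lookup_add lookup_minus lookup_cscale)

lemma pairing_sum_right: "pairing g (sum f S) = (\<Sum>x\<in>S. pairing g (f x))"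
  by (simp add: pairing_def act_sum_right lookup_sum)

lemma pairing_monom: "pairing (monom u) f = mfact u * lookup f u"
  by (simp add: pairing_def lookup_act_monom_0)

lemma pairing_mult: "pairing (p * q) f = pairing p (act q f)"
  by (simp add: pairing_def act_mult)

lemma eq_0_if_pairing: "(\<And>u. pairing (monom u) f = 0) \<Longrightarrow> f = 0"
  by (rule poly_mapping_eqI) (simp add: pairing_monom)

lemma pairing_homog_neq: "g \<in> homog k \<Longrightarrow> f \<in> homog l \<Longrightarrow> k \<noteq> l \<Longrightarrow> pairing g f = 0"
  unfolding pairing_def
proof (rule ccontr)
  assume *: "g \<in> homog k" "f \<in> homog l" "k \<noteq> l" "lookup (act g f) 0 \<noteq> 0"
  then obtain u where "u \<in> keys g" "u \<in> keys f"
    using keys_act[of 0 g f] by (auto simp: in_keys_iff)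
  with *(1-3) show False by (auto simp: homog_def)
qed

lemma span_monom: "cpoly.span (monom ` S) = {p. keys p \<subseteq> S}"
proof (intro equalityI subsetI)
  fix p assume "p \<in> cpoly.span (monom ` S)"
  then show "p \<in> {p. keys p \<subseteq> S}"
  proof (induction rule: cpoly.span_induct_alt)
    case (step c g p)
    then show ?case
      by (auto simp: in_keys_iff lookup_add lookup_cscale lookup_monom when_def split: if_splits)
  qed simp
next
  fix p :: "'a cpoly" assume p: "p \<in> {p. keys p \<subseteq> S}"
  have eq: "p = (\<Sum>u\<in>keys p. cscale (lookup p u) (monom u))"
    by (rule poly_mapping_eqI) (auto simp: lookup_sum lookup_cscale lookup_monom when_def in_keys_iff if_distrib cong: if_cong)
  show "p \<in> cpoly.span (monom ` S)"
    by (subst eq, intro cpoly.span_sum cpoly.span_scale cpoly.span_base) (use p in auto)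
qed

text \<open>The pairing is perfect on the span of finitely many monomials. Extend a basis E of W to
  a basis E' of the whole; the dual basis vectors belonging to E' - E form a basis of the orthogonal
  space.\<close>

lemma dim_orthogonal:
  fixes S :: "('n::finite \<Rightarrow>\<^sub>0 nat) set"
  assumes "finite S" and W: "cpoly.subspace W" "W \<subseteq> cpoly.span (monom ` S)"
  shows "cpoly.dim {f \<in> cpoly.span (monom ` S). \<forall>g\<in>W. pairing g f = 0} + cpoly.dim W
    = cpoly.dim (cpoly.span (monom ` S))"
proof -
  let ?U = "cpoly.span (monom ` S)"
  obtain E where E: "E \<subseteq> W" "cpoly.independent E" "W \<subseteq> cpoly.span E"
    using cpoly.maximal_independent_subset by blast
  obtain E' where E': "E \<subseteq> E'" "E' \<subseteq> ?U" "cpoly.independent E'" "?U \<subseteq> cpoly.span E'"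
    using cpoly.maximal_independent_subset_extend[of E ?U] E W(2) by blast
  have spanE': "cpoly.span E' = ?U"
    using E'(2,4) by (metis cpoly.span_minimal cpoly.subspace_span subset_antisym)
  have fin: "finite E'"
    using cpoly.independent_span_bound[of "monom ` S" E'] E' assms(1) by auto
  have keysU: "keys f \<subseteq> S" if "f \<in> ?U" for f
    using that by (simp add: span_monom)
  interpret vp: vector_space_pair "cscale :: complex \<Rightarrow> 'n cpoly \<Rightarrow> 'n cpoly" "(*) :: complex \<Rightarrow> complex \<Rightarrow> complex"
    by unfold_locales
  have "\<exists>l. Vector_Spaces.linear cscale (*) l \<and> (\<forall>x\<in>E'. l x = (if x = e then 1 else 0))" for e
    using vp.linear_independent_extend[OF E'(3)] .
  then obtain l where l: "\<And>e. Vector_Spaces.linear cscale (*) (l e)"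
    "\<And>e x. x \<in> E' \<Longrightarrow> l e x = (if x = e then 1 else 0)"
    by metis
  \<comment> \<open>The polynomial representing the coordinate functional \<open>l e\<close>; the
    division by \<open>mfact u\<close> compensates for the pairing of u with itself.\<close>
  define d where "d e = (\<Sum>u\<in>S. cscale (l e (monom u) / mfact u) (monom u))" for e
  have d_lookup: "lookup (d e) u = l e (monom u) / mfact u" if "u \<in> S" for e u
    using that assms(1) by (simp add: d_def lookup_sum lookup_cscale lookup_monom when_def if_distrib cong: if_cong)
  have dU: "d e \<in> ?U" for e
    unfolding d_def by (intro cpoly.span_sum cpoly.span_scale cpoly.span_base) auto
  have dl: "pairing g (d e) = l e g" if "g \<in> ?U" for g e
    using that
  proof (induction rule: cpoly.span_induct_alt)
    case base
    show ?case using vp.linear_0[OF l(1)] by simp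
  next
    case (step c g p)
    then show ?case
      by (auto simp: pairing_add_left pairing_cscale_left vp.linear_add[OF l(1)] vp.linear_scale[OF l(1)]
          pairing_monom d_lookup)
  qed
  have dual: "pairing e (d e') = (if e = e' then 1 else 0)" if "e \<in> E'" for e e'
    using that E'(2) by (simp add: dl l(2) subset_iff)
  have inj: "inj_on d E'"
  proof (rule inj_onI)
    fix e e' assume "e \<in> E'" "e' \<in> E'" "d e = d e'"
    with dual[of e e] dual[of e e'] show "e = e'" by (auto split: if_splits)
  qed
  let ?F = "d ` (E' - E)"
  have indF: "cpoly.independent ?F"
    unfolding cpoly.independent_explicit_module
  proof (intro allI impI)
    fix T c g
    assume T: "finite T" "T \<subseteq> ?F" "(\<Sum>g\<in>T. cscale (c g) g) = 0" "g \<in> T"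
    then obtain e where e: "e \<in> E'" "g = d e" by auto
    have "pairing e (\<Sum>g\<in>T. cscale (c g) g) = (\<Sum>x\<in>T. if x = g then c g else 0)"
      unfolding pairing_sum_right
    proof (rule sum.cong)
      fix x assume "x \<in> T"
      with T(2) obtain e' where "x = d e'" "e' \<in> E'" by auto
      then show "pairing e (cscale (c x) x) = (if x = g then c g else 0)"
        using e inj dual[of e e'] by (auto simp: pairing_cscale_right inj_on_eq_iff)
    qed simp
    with T show "c g = 0" by simp
  qed
  let ?O = "{f \<in> ?U. \<forall>g\<in>W. pairing g f = 0}"
  have F_O: "?F \<subseteq> ?O"
  proof
    fix f assume "f \<in> ?F"
    then obtain e where e: "e \<in> E'" "e \<notin> E" "f = d e" by auto
    have "pairing g f = 0" if "g \<in> W" for g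
    proof -
      from that E(3) have "g \<in> cpoly.span E" by auto
      then show ?thesis
      proof (induction rule: cpoly.span_induct_alt)
        case (step c x p)
        have "x \<in> E'" "x \<noteq> e" using step.hyps E'(1) e by auto
        with dual[of x e] step.IH show ?case
          by (simp add: pairing_add_left pairing_cscale_left e(3))
      qed simp
    qed
    then show "f \<in> ?O" using dU e(3) by auto
  qed
  have O_F: "?O \<subseteq> cpoly.span ?F"
  proof
    fix f assume f: "f \<in> ?O"
    define r where "r = f - (\<Sum>e\<in>E'. cscale (pairing e f) (d e))"
    have rU: "r \<in> ?U"
      unfolding r_def using f by (intro cpoly.span_diff cpoly.span_sum cpoly.span_scale dU) auto
    have "pairing g r = 0" if "g \<in> ?U" for g
    proof -
      have "g \<in> cpoly.span E'" using that spanE' by simp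
      then show ?thesis
      proof (induction rule: cpoly.span_induct_alt)
        case (step c x p)
        have "pairing x r = pairing x f - (\<Sum>e\<in>E'. pairing e f * (if x = e then 1 else 0))"
          using step.hyps dual by (simp add: r_def pairing_diff_right pairing_sum_right pairing_cscale_right)
        then have "pairing x r = 0"
          using step.hyps fin by (simp add: if_distrib cong: if_cong)
        with step.IH show ?case by (simp add: pairing_add_left pairing_cscale_left)
      qed simp
    qed
    then have "lookup r u = 0" if "u \<in> S" for u
      using that pairing_monom[of u r] cpoly.span_base[of "monom u" "monom ` S"] by auto
    then have "r = 0"
      using keysU[OF rU] by (intro poly_mapping_eqI) (auto simp: in_keys_iff)
    then have "f = (\<Sum>e\<in>E'. cscale (pairing e f) (d e))"
      by (simp add: r_def)
    also have "\<dots> = (\<Sum>e\<in>E' - E. cscale (pairing e f) (d e))"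
      using fin f E(1) by (intro sum.mono_neutral_right) auto
    also have "\<dots> \<in> cpoly.span ?F"
      by (intro cpoly.span_sum cpoly.span_scale cpoly.span_base) auto
    finally show "f \<in> cpoly.span ?F" .
  qed
  have "cpoly.dim ?O = card ?F"
    by (rule cpoly.basis_card_eq_dim[OF F_O O_F indF, symmetric])
  also have "\<dots> = card (E' - E)"
    by (rule card_image) (rule inj_on_subset[OF inj Diff_subset])
  also have "\<dots> = card E' - card E"
    by (rule card_Diff_subset[OF finite_subset[OF E'(1) fin] E'(1)])
  finally show ?thesis
    using card_mono[OF fin E'(1)] cpoly.basis_card_eq_dim[OF E(1) E(3) E(2)]
      cpoly.basis_card_eq_dim[OF E'(2) E'(4) E'(3)] by simp
qed

lemma dim_injective_image:
  fixes T :: "'x cpoly \<Rightarrow> 'y cpoly"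
  assumes T: "\<And>f g. T (f + g) = T f + T g" "\<And>c f. T (cscale c f) = cscale c (T f)"
    and W: "cpoly.subspace W" and inj: "inj_on T W"
  shows "cpoly.dim (T ` W) = cpoly.dim W"
proof -
  interpret T: Vector_Spaces.linear cscale cscale T
    by unfold_locales (simp_all add: T)
  obtain E where E: "E \<subseteq> W" "cpoly.independent E" "W \<subseteq> cpoly.span E"
    using cpoly.maximal_independent_subset by blast
  have spanE: "cpoly.span E = W"
    using E W by (intro equalityI cpoly.span_minimal) auto
  have "cpoly.independent (T ` E)"
    using E(2) inj by (intro T.independent_injective_image) (simp_all add: spanE)
  moreover have "cpoly.span (T ` E) = T ` W"
    by (simp add: T.span_image spanE)
  ultimately have "cpoly.dim (T ` W) = card (T ` E)"
    by (metis cpoly.dim_eq_card cpoly.span_span)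
  also have "\<dots> = card E"
    using inj E(1) by (intro card_image) (auto intro: inj_on_subset)
  finally show ?thesis
    using cpoly.basis_card_eq_dim[OF E(1) E(3) E(2)] by simp
qed

definition hcomp :: "nat \<Rightarrow> 'x cpoly \<Rightarrow> 'x cpoly" where
  "hcomp q f = Poly_Mapping.mapp (\<lambda>u c. c when mdeg u = q) f"

lemma lookup_hcomp: "lookup (hcomp q f) u = (lookup f u when mdeg u = q)"
  by (auto simp: hcomp_def lookup_mapp when_def in_keys_iff)

lemma hcomp_homog: "hcomp q f \<in> homog q"
  by (auto simp: homog_def in_keys_iff lookup_hcomp when_def split: if_splits)

lemma hcomp_eq: "f \<in> homog q \<Longrightarrow> hcomp p f = (if p = q then f else 0)"
  by (rule poly_mapping_eqI) (auto simp: lookup_hcomp homog_def in_keys_iff when_def)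

lemma hcomp_cscale: "hcomp q (cscale c f) = cscale c (hcomp q f)"
  by (rule poly_mapping_eqI) (simp add: lookup_hcomp lookup_cscale when_def)

lemma hcomp_sum: "hcomp q (sum f S) = (\<Sum>x\<in>S. hcomp q (f x))"
  by (rule poly_mapping_eqI) (auto simp: lookup_hcomp lookup_sum when_def intro!: sum.neutral)

lemma sum_hcomp:
  assumes "\<And>u. u \<in> keys f \<Longrightarrow> mdeg u < N" shows "f = (\<Sum>q<N. hcomp q f)"
proof (rule poly_mapping_eqI)
  fix u
  show "lookup f u = lookup (\<Sum>q<N. hcomp q f) u"
    using assms[of u] by (cases "u \<in> keys f") (auto simp: lookup_sum lookup_hcomp when_def in_keys_iff)
qed

lemma homog_span: "homog q = cpoly.span (monom ` {u. mdeg u = q})"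
  unfolding span_monom homog_def by auto

lemma subspace_homog: "cpoly.subspace (homog q)"
  unfolding homog_span by (rule cpoly.subspace_span)

lemma finite_basis_homog:
  fixes W :: "'n::finite cpoly set"
  assumes "W \<subseteq> homog q"
  obtains E where "E \<subseteq> W" "cpoly.independent E" "W \<subseteq> cpoly.span E" "finite E" "card E = cpoly.dim W"
proof -
  obtain E where E: "E \<subseteq> W" "cpoly.independent E" "W \<subseteq> cpoly.span E"
    using cpoly.maximal_independent_subset by blast
  moreover have "finite E"
    using cpoly.independent_span_bound[of "monom ` {u. mdeg u = q}" E] E assms
    by (auto simp: homog_span finite_mdeg_eq)
  ultimately show ?thesis
    using that cpoly.basis_card_eq_dim by blast
qed

lemma dim_eq_0_homog:
  fixes W :: "'n::finite cpoly set"
  assumes "W \<subseteq> homog q" "0 \<in> W"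
  shows "cpoly.dim W = 0 \<longleftrightarrow> W = {0}"
proof -
  obtain E where "E \<subseteq> W" "cpoly.independent E" "W \<subseteq> cpoly.span E" "finite E" "card E = cpoly.dim W"
    using finite_basis_homog[OF assms(1)] .
  then show ?thesis
    using assms(2) cpoly.dependent_zero[of E] by (cases "E = {}") auto
qed

text \<open>Bases of the homogeneous parts of degree below N together form a basis of W. The finite
  spanning set is stated as well because \<open>cpoly.dim\<close> is 0 on infinite-dimensional
  spaces.\<close>

lemma dim_graded:
  fixes W :: "'n::finite cpoly set"
  assumes W: "cpoly.subspace W" and graded: "\<And>f q. f \<in> W \<Longrightarrow> hcomp q f \<in> W"
    and bounded: "\<And>f u. f \<in> W \<Longrightarrow> u \<in> keys f \<Longrightarrow> mdeg u < N"
  shows "\<exists>S. finite S \<and> W \<subseteq> cpoly.span S"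
    and "cpoly.dim W = (\<Sum>q<N. cpoly.dim (W \<inter> homog q))"
proof -
  have "\<exists>E. E \<subseteq> W \<inter> homog q \<and> cpoly.independent E \<and> W \<inter> homog q \<subseteq> cpoly.span E \<and> finite E \<and>
    card E = cpoly.dim (W \<inter> homog q)" for q
    using finite_basis_homog[of "W \<inter> homog q" q] by (metis inf.cobounded2)
  then obtain E where E: "\<And>q. E q \<subseteq> W \<inter> homog q" "\<And>q. cpoly.independent (E q)"
    "\<And>q. W \<inter> homog q \<subseteq> cpoly.span (E q)" "\<And>q. finite (E q)"
    "\<And>q. card (E q) = cpoly.dim (W \<inter> homog q)"
    by metis
  let ?E = "\<Union>q<N. E q"
  have fin: "finite ?E" using E(4) by simp
  have sub: "?E \<subseteq> W" using E(1) by blast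
  have span: "W \<subseteq> cpoly.span ?E"
  proof
    fix f assume f: "f \<in> W"
    have "hcomp q f \<in> cpoly.span ?E" if "q < N" for q
    proof -
      have "hcomp q f \<in> cpoly.span (E q)"
        using E(3)[of q] graded[OF f] hcomp_homog by blast
      moreover have "cpoly.span (E q) \<subseteq> cpoly.span ?E"
        using that by (intro cpoly.span_mono) blast
      ultimately show ?thesis by blast
    qed
    then have "(\<Sum>q<N. hcomp q f) \<in> cpoly.span ?E"
      by (intro cpoly.span_sum) simp
    with sum_hcomp[of f N] bounded[OF f] show "f \<in> cpoly.span ?E" by simp
  qed
  with fin show "\<exists>S. finite S \<and> W \<subseteq> cpoly.span S" by blast
  have disj: "E p \<inter> E q = {}" if "p \<noteq> q" for p q
  proof -
    have "f = 0" if "f \<in> E p" "f \<in> E q" for f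
    proof -
      have "f \<in> homog p" "f \<in> homog q" using E(1) that by blast+
      with hcomp_eq[of f p p] hcomp_eq[of f q p] \<open>p \<noteq> q\<close> show ?thesis by simp
    qed
    moreover have "0 \<notin> E p" using E(2) cpoly.dependent_zero by blast
    ultimately show ?thesis by blast
  qed
  have ind: "cpoly.independent ?E"
    unfolding cpoly.dependent_finite[OF fin]
  proof (intro notI, elim exE conjE bexE)
    fix c g
    assume g: "g \<in> ?E" "c g \<noteq> 0" and 0: "(\<Sum>x\<in>?E. cscale (c x) x) = 0"
    then obtain q where q: "q < N" "g \<in> E q" by blast
    have "0 = hcomp q (\<Sum>x\<in>?E. cscale (c x) x)"
      unfolding 0 by (rule poly_mapping_eqI) (simp add: lookup_hcomp)
    also have "\<dots> = (\<Sum>x\<in>?E. if x \<in> E q then cscale (c x) x else 0)"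
      unfolding hcomp_sum
    proof (rule sum.cong)
      fix x assume "x \<in> ?E"
      then obtain p where p: "x \<in> E p" by blast
      then have "hcomp q x = (if q = p then x else 0)"
        using E(1)[of p] by (intro hcomp_eq) blast
      moreover have "x \<in> E q \<longleftrightarrow> q = p"
        using p disj[of p q] by blast
      ultimately show "hcomp q (cscale (c x) x) = (if x \<in> E q then cscale (c x) x else 0)"
        by (simp add: hcomp_cscale)
    qed simp
    also have "\<dots> = (\<Sum>x\<in>E q. cscale (c x) x)"
      using fin q(1) by (intro sum.mono_neutral_cong_right) auto
    finally have "(\<Sum>x\<in>E q. cscale (c x) x) = 0" ..
    then have "c g = 0"
      using cpoly.independentD[OF E(2) E(4), of q q c g] q(2) by simp
    with g(2) show False by simp
  qed
  have "cpoly.dim W = card ?E"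
    using cpoly.basis_card_eq_dim[OF sub span ind] by simp
  also have "\<dots> = (\<Sum>q<N. card (E q))"
    by (rule card_UN_disjoint) (use E(4) disj in auto)
  finally show "cpoly.dim W = (\<Sum>q<N. cpoly.dim (W \<inter> homog q))"
    by (simp add: E(5))
qed

section \<open>Leading coefficients of series solutions\<close>

text \<open>\<open>\<partial>\<^sup>p\<close> moves the term at z to z - p; the rising factorial
  starting there, read backwards, is the falling factorial starting at z.\<close>

lemma prod_dfactor_falling:
  "(\<Prod>j\<in>UNIV. dfactor ((z - cvec (expo p)) $ j) j (lookup p j))
    = (\<Prod>j\<in>UNIV. \<Prod>k<lookup p j. const (z $ j - of_nat k) + var j)"
proof (rule prod.cong[OF refl])
  fix j
  have "(\<Prod>k<lookup p j. const (z $ j - of_nat k) + var j)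
    = (\<Prod>i<lookup p j. const (z $ j - of_nat (lookup p j - Suc i)) + var j)"
    by (rule prod.nat_diff_reindex[symmetric])
  also have "\<dots> = (\<Prod>i<lookup p j. const (z $ j - of_nat (lookup p j) + of_nat i + 1) + var j)"
    by (rule prod.cong) (auto simp: of_nat_diff algebra_simps)
  finally show "dfactor ((z - cvec (expo p)) $ j) j (lookup p j)
    = (\<Prod>k<lookup p j. const (z $ j - of_nat k) + var j)"
    by (simp add: dfactor_def cvec_def expo_def)
qed

text \<open>Separates the invertible factors from those with zero constant term. The latter occur at
  most once for each j and contribute the variable j.\<close>

lemma prod_falling_split:
  "(\<Prod>j\<in>UNIV. \<Prod>k<lookup p j. const (z $ j - of_nat k) + var j)
    = (\<Prod>x\<in>{x \<in> SIGMA j:UNIV. {..<lookup p j}. z $ fst x \<noteq> of_nat (snd x)}.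
        const (z $ fst x - of_nat (snd x)) + var (fst x)) * (\<Prod>j\<in>zset z p. var j)"
proof -
  let ?S = "SIGMA j:UNIV. {..<lookup p j}"
  let ?f = "\<lambda>x. const (z $ fst x - of_nat (snd x)) + var (fst x)"
  have "(\<Prod>j\<in>UNIV. \<Prod>k<lookup p j. const (z $ j - of_nat k) + var j) = prod ?f ?S"
    by (subst prod.Sigma) (auto simp: split_beta)
  also have "\<dots> = prod ?f {x \<in> ?S. z $ fst x \<noteq> of_nat (snd x)} * prod ?f {x \<in> ?S. z $ fst x = of_nat (snd x)}"
    by (subst prod.union_disjoint[symmetric]) (auto intro!: prod.cong)
  \<comment> \<open>The only possible k for a given j is the value of z at j, recovered as the floor
    of its real part.\<close>
  also have "prod ?f {x \<in> ?S. z $ fst x = of_nat (snd x)} = (\<Prod>j\<in>zset z p. var j)"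
    by (rule prod.reindex_bij_witness[of _ "\<lambda>j. (j, nat \<lfloor>Re (z $ j)\<rfloor>)" fst]) (auto simp: zset_def)
  finally show ?thesis .
qed

lemma Aform_subst_shift:
  "subst (\<lambda>j. const (z $ j) + var j) (Aform A i)
    = const (\<Sum>j\<in>UNIV. of_int (A $ i $ j) * z $ j) + Aform A i"
  by (simp add: Aform_def subst_sum subst_cscale cpoly.scale_right_distrib sum.distrib const_sum)
    (simp add: cscale_def const_mult)

lemma fake_exponent_eq:
  assumes "fake_exponent A \<beta> w v"
  shows "(\<Sum>j\<in>UNIV. of_int (A $ i $ j) * v $ j) = \<beta> $ i"
proof -
  let ?p = "Aform A i - const (\<beta> $ i)"
  have "?p \<in> fake_indicial_ideal A \<beta> w"
    unfolding fake_indicial_ideal_def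
    by (intro CollectI exI[of _ 0] exI[of _ ?p]) (auto simp: poly_op_0 left_ideal.zero intro: ideal_base)
  then have "peval v ?p = 0"
    using assms by (simp add: fake_exponent_def)
  moreover have "const (peval v ?p) = const ((\<Sum>j\<in>UNIV. of_int (A $ i $ j) * v $ j) - \<beta> $ i)"
    unfolding subst_const_eq_peval[symmetric]
    by (simp add: subst_diff Aform_def subst_sum subst_cscale const_diff const_sum)
      (simp add: cscale_def const_mult)
  ultimately show ?thesis by simp
qed

text \<open>\<open>x\<^sup>p \<partial>\<^sup>p = \<Prod>\<^sub>j \<Prod>\<^sub>k\<^sub><\<^sub>p\<^sub>j (\<theta>\<^sub>j - k)\<close> lies in the fake indicial ideal.\<close>

lemma fake_exponent_zset:
  assumes "fake_exponent A \<beta> w v" "monom p \<in> init_ideal w (toric_ideal A)"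
  shows "zset v p \<noteq> {}"
proof -
  let ?f = "\<Prod>j\<in>UNIV. \<Prod>k<lookup p j. var j - const (of_nat k)"
  have "poly_op theta_op ?f = (\<lambda>\<phi> z. \<phi> (z - cvec (expo p))) \<circ> poly_op d_op (monom p)"
  proof (intro ext)
    fix \<phi> :: "'a logseries" and z
    have "subst (\<lambda>j. const (z $ j) + var j) ?f
      = (\<Prod>j\<in>UNIV. \<Prod>k<lookup p j. const (z $ j - of_nat k) + var j)"
      by (simp add: subst_prod subst_diff const_diff algebra_simps)
    then show "poly_op theta_op ?f \<phi> z = ((\<lambda>\<phi> z. \<phi> (z - cvec (expo p))) \<circ> poly_op d_op (monom p)) \<phi> z"
      by (simp only: poly_op_theta_op o_apply poly_op_monom mon_op_d_op prod_dfactor_falling diff_add_cancel)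
  qed
  also have "\<dots> \<in> left_ideal (poly_op d_op ` init_ideal w (toric_ideal A))"
    by (intro left_ideal.mult weyl_shift left_ideal.gen imageI assms)
  finally have "?f \<in> fake_indicial_ideal A \<beta> w"
    unfolding fake_indicial_ideal_def
    by (intro CollectI exI[of _ ?f] exI[of _ 0]) (auto intro: ideal_0)
  then have "peval v ?f = 0"
    using assms(1) by (simp add: fake_exponent_def)
  moreover have "const (peval v ?f) = const (\<Prod>j\<in>UNIV. \<Prod>k<lookup p j. v $ j - of_nat k)"
    unfolding subst_const_eq_peval[symmetric]
    by (simp add: subst_prod subst_diff const_diff const_prod)
  ultimately have "(\<Prod>j\<in>UNIV. \<Prod>k<lookup p j. v $ j - of_nat k) = 0" by simp
  then show ?thesis
    by (auto simp: zset_def)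
qed

subsection \<open>Integration along the kernel\<close>

lemma pdiff_single: "pdiff l (single t c) = single (t - single l 1) (of_nat (lookup t l) * c)"
  unfolding pdiff_def by (rule sum_keys_single) simp

lemma pdiff_add: "pdiff l (f + g) = pdiff l f + pdiff l g"
  by (rule poly_mapping_eqI) (simp add: lookup_pdiff lookup_add distrib_left)

lemma pdiff_mult: "pdiff l (f * g) = pdiff l f * g + f * pdiff l g"
proof (induction f rule: cpoly_induct)
  case (single t c)
  show ?case
  proof (induction g rule: cpoly_induct)
    case (single s d)
    let ?e = "single l (1::nat)"
    have t: "t + s - ?e = t - ?e + s" if "lookup t l \<noteq> 0"
      using that by (intro poly_mapping_eqI) (auto simp: lookup_add lookup_minus lookup_single when_def)
    have s: "t + s - ?e = t + (s - ?e)" if "lookup s l \<noteq> 0"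
      using that by (intro poly_mapping_eqI) (auto simp: lookup_add lookup_minus lookup_single when_def)
    have "pdiff l (single t c * single s d)
      = single (t + s - ?e) (of_nat (lookup t l) * c * d) + single (t + s - ?e) (of_nat (lookup s l) * c * d)"
      by (simp only: mult_single pdiff_single single_add[symmetric] lookup_add of_nat_add)
        (simp add: algebra_simps)
    also have "single (t + s - ?e) (of_nat (lookup t l) * c * d) = pdiff l (single t c) * single s d"
      using t by (cases "lookup t l = 0") (simp_all add: pdiff_single mult_single)
    also have "single (t + s - ?e) (of_nat (lookup s l) * c * d) = single t c * pdiff l (single s d)"
      using s by (cases "lookup s l = 0") (simp_all add: pdiff_single mult_single mult_ac)
    finally show ?case .
  qed (simp only: distrib_left pdiff_add add_ac)
qed (simp only: distrib_right pdiff_add add_ac)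

lemma act_Aform: "act (Aform A i) f = (\<Sum>j\<in>UNIV. cscale (of_int (A $ i $ j)) (pdiff j f))"
  by (simp add: Aform_def act_sum_left act_cscale_left act_var)

text \<open>A linear form acts as a derivation, so its kernel is a ring. This allows antiderivatives
  to be built from products.\<close>

lemma act_Aform_mult: "act (Aform A i) (f * g) = act (Aform A i) f * g + f * act (Aform A i) g"
  by (simp only: act_Aform pdiff_mult cscale_def distrib_left sum.distrib
      sum_distrib_left sum_distrib_right mult_ac)

definition eulerian :: "int ^ 'n ^ 'd::finite \<Rightarrow> 'n::finite cpoly set" where
  "eulerian A = {f. \<forall>i. act (Aform A i) f = 0}"

lemma eulerian_act: "f \<in> eulerian A \<Longrightarrow> act p f \<in> eulerian A"
  by (simp add: eulerian_def act_commute[of "Aform A _" p])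

lemma eulerian_mult: "f \<in> eulerian A \<Longrightarrow> g \<in> eulerian A \<Longrightarrow> f * g \<in> eulerian A"
  by (simp add: eulerian_def act_Aform_mult)

lemma eulerian_sum: "(\<And>x. x \<in> S \<Longrightarrow> f x \<in> eulerian A) \<Longrightarrow> sum f S \<in> eulerian A"
  by (simp add: eulerian_def act_sum_right)

lemma pdiff_const [simp]: "pdiff l (const c) = 0"
  by (simp add: const_def pdiff_single)

lemma pdiff_var: "pdiff l (var k) = (if l = k then 1 else 0)"
  by (auto simp: var_def monom_def pdiff_single lookup_single)

lemma eulerian_const: "const c \<in> eulerian A"
  by (simp add: eulerian_def act_Aform)

lemma pdiff_cscale: "pdiff l (cscale c f) = cscale c (pdiff l f)"
  by (rule poly_mapping_eqI) (simp add: lookup_pdiff lookup_cscale)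

lemma pdiff_sum: "pdiff l (sum f S) = (\<Sum>x\<in>S. pdiff l (f x))"
  by (rule poly_mapping_eqI) (simp add: lookup_pdiff lookup_sum sum_distrib_left)

text \<open>An antiderivative by repeated integration by parts against the linear form
  \<open>y = \<Sum>\<^sub>l u\<^sub>l log x\<^sub>l\<close>, for which \<open>\<partial>y/\<partial>(log x\<^sub>j) = u\<^sub>j\<close>.\<close>

lemma eulerian_pdiff_surj:
  assumes u: "u \<in> kerZ A" "u $ j \<noteq> 0" and f: "f \<in> eulerian A"
  shows "\<exists>q\<in>eulerian A. act (var j) q = f"
proof -
  define y where "y = (\<Sum>l\<in>UNIV. cscale (of_int (u $ l)) (var l))"
  define N where "N = Suc (Max (insert 0 (mdeg ` keys f)))"
  define g where "g m = act (var j ^ m) f" for m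
  \<comment> \<open>The recursion \<open>dd\<close> fixes these coefficients: differentiating q
    makes the terms telescope to \<open>t 0 - t N\<close>, where \<open>t 0\<close> is f and
    \<open>t N\<close> vanishes by the choice of N.\<close>
  define d :: "nat \<Rightarrow> complex" where "d m = (- 1) ^ m / (fact m * of_int (u $ j) ^ m)" for m
  define q where "q = (\<Sum>m<N. const (- d (Suc m)) * (y ^ Suc m * g m))"
  have dy: "pdiff l y = const (of_int (u $ l))" for l
    by (simp add: y_def pdiff_sum pdiff_cscale pdiff_var if_distrib cong: if_cong)
      (simp add: cscale_def)
  have "act (Aform A i) y = 0" for i
  proof -
    have "act (Aform A i) y = const (of_int ((A *v u) $ i))"
      by (simp add: act_Aform dy matrix_vector_mult_def const_sum cscale_def const_mult)
    then show ?thesis using u(1) by (simp add: kerZ_def)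
  qed
  then have y: "y \<in> eulerian A" by (simp add: eulerian_def)
  have yp: "y ^ m \<in> eulerian A" for m
    using eulerian_const[of 1 A] by (induction m) (auto intro: eulerian_mult y)
  have dyp: "pdiff j (y ^ Suc m) = const (of_nat (Suc m) * of_int (u $ j)) * y ^ m" for m
  proof (induction m)
    case (Suc m)
    have "pdiff j (y ^ Suc (Suc m)) = pdiff j y * y ^ Suc m + y * pdiff j (y ^ Suc m)"
      by (simp only: power_Suc[of y "Suc m"] pdiff_mult)
    also have "\<dots> = const (of_int (u $ j)) * y ^ Suc m + const (of_nat (Suc m) * of_int (u $ j)) * y ^ Suc m"
      unfolding Suc dy by (simp only: power_Suc mult_ac)
    also have "\<dots> = const (of_nat (Suc (Suc m)) * of_int (u $ j)) * y ^ Suc m"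
    proof -
      have "of_nat (Suc (Suc m)) * of_int (u $ j)
        = of_int (u $ j) + of_nat (Suc m) * (of_int (u $ j) :: complex)"
        by (simp add: algebra_simps)
      then show ?thesis by (simp only: const_add distrib_right)
    qed
    finally show ?case .
  qed (simp add: dy)
  have dg: "pdiff j (g m) = g (Suc m)" for m
    by (simp add: g_def act_var[symmetric] act_mult)
  have gN: "g N = 0"
  proof -
    have "mdeg t < N" if "t \<in> keys f" for t
      using that by (simp add: N_def less_Suc_eq_le)
    then show ?thesis
      unfolding g_def var_power by (intro act_monom_eq_0) simp
  qed
  have dd: "- d (Suc m) * (of_nat (Suc m) * of_int (u $ j)) = d m" for m
    using u(2) by (simp add: d_def fact_Suc field_simps del: of_nat_Suc)
  define t where "t m = const (d m) * (y ^ m * g m)" for m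
  have "act (var j) q = (\<Sum>m<N. t m - t (Suc m))"
    unfolding act_var q_def pdiff_sum
  proof (rule sum.cong)
    fix m
    have "pdiff j (const (- d (Suc m)) * (y ^ Suc m * g m))
      = const (- d (Suc m)) * (const (of_nat (Suc m) * of_int (u $ j)) * y ^ m * g m + y ^ Suc m * g (Suc m))"
      by (simp only: pdiff_mult pdiff_const dyp dg mult_zero_left add_0)
    also have "\<dots> = const (- d (Suc m) * (of_nat (Suc m) * of_int (u $ j))) * (y ^ m * g m)
      - const (d (Suc m)) * (y ^ Suc m * g (Suc m))"
      by (simp only: distrib_left const_mult const_uminus mult.assoc mult_minus_left) simp
    finally show "pdiff j (const (- d (Suc m)) * (y ^ Suc m * g m)) = t m - t (Suc m)"
      unfolding dd t_def .
  qed simp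
  also have "\<dots> = t 0 - t N"
    by (rule sum_lessThan_telescope')
  also have "\<dots> = f"
    by (simp add: t_def gN) (simp add: d_def g_def)
  finally have "act (var j) q = f" .
  moreover have "q \<in> eulerian A"
    unfolding q_def g_def by (intro eulerian_sum eulerian_mult eulerian_const yp eulerian_act f)
  ultimately show ?thesis by blast
qed

lemma eulerian_prod_surj:
  assumes "finite S" "\<And>j. j \<in> S \<Longrightarrow> \<exists>u\<in>kerZ A. u $ j \<noteq> 0" "f \<in> eulerian A"
  shows "\<exists>q\<in>eulerian A. act (\<Prod>j\<in>S. var j) q = f"
  using assms(1,2)
proof (induction S)
  case empty
  then show ?case using assms(3) by auto
next
  case (insert j S)
  then obtain q where q: "q \<in> eulerian A" "act (\<Prod>j\<in>S. var j) q = f" by auto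
  moreover obtain u where "u \<in> kerZ A" "u $ j \<noteq> 0" using insert.prems by auto
  ultimately obtain q' where "q' \<in> eulerian A" "act (var j) q' = q"
    using eulerian_pdiff_surj by blast
  then show ?case
    using insert.hyps q by (intro bexI[of _ q']) (simp_all add: mult.commute[of "var j"] act_mult)
qed

subsection \<open>Solutions by the Frobenius method\<close>

lemma cvec_add: "cvec (u + t) = cvec u + cvec t"
  by (simp add: cvec_def vec_eq_iff)

lemma cvec_0 [simp]: "cvec 0 = 0"
  by (simp add: cvec_def vec_eq_iff)

lemma cvec_eq_iff [simp]: "cvec u = cvec t \<longleftrightarrow> u = t"
  by (simp add: cvec_def vec_eq_iff)

lemma cvec_axis: "cvec (axis j k) = axis j (of_int k)"
  by (simp add: cvec_def vec_eq_iff axis_def)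

text \<open>Up to the factors \<open>D\<^sub>j\<close> accounted for separately, \<open>unit_factor\<close> is the ratio
  \<open>\<Gamma>(v\<^sub>j + 1 + D\<^sub>j) / \<Gamma>(v\<^sub>j + k + 1 + D\<^sub>j)\<close>, truncated so as to be exact on polynomials of
  degree less than \<open>N\<close>.\<close>

definition lin_factor :: "complex ^ 'n \<Rightarrow> 'n \<Rightarrow> int \<Rightarrow> 'n::finite cpoly" where
  "lin_factor v j k = (if v $ j + of_int k = 0 then 1 else const (v $ j + of_int k) + var j)"

definition unit_factor :: "nat \<Rightarrow> complex ^ 'n \<Rightarrow> 'n \<Rightarrow> int \<Rightarrow> 'n::finite cpoly" where
  "unit_factor N v j k =
     (\<Prod>i\<in>{1..k}. if v $ j + of_int i = 0 then 1 else inv_lin N (v $ j + of_int i) j) *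
     (\<Prod>i\<in>{k + 1..0}. lin_factor v j i)"

lemma unit_factor_0 [simp]: "unit_factor N v j 0 = 1"
  by (simp add: unit_factor_def)

text \<open>The functional equation of the truncated Gamma quotient. For k at least 1 the linear
  factor cancels the last inverse, exactly on q by the degree bound; for smaller k it is the next
  factor of the second product.\<close>

lemma unit_factor_step:
  assumes "\<And>t. t \<in> keys q \<Longrightarrow> mdeg t < N"
  shows "act (lin_factor v j k * unit_factor N v j k * r) q = act (unit_factor N v j (k - 1) * r) q"
proof (cases "1 \<le> k")
  case True
  let ?i = "\<lambda>i. if v $ j + of_int i = 0 then 1 else inv_lin N (v $ j + of_int i) j"
  have "{1..k} = insert k {1..k - 1}" "{k + 1..0} = {}" "{k - 1 + 1..0} = {}"
    using True by auto
  then have "unit_factor N v j k = ?i k * unit_factor N v j (k - 1)"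
    by (simp add: unit_factor_def)
  then have "act (lin_factor v j k * unit_factor N v j k * r) q
    = act (unit_factor N v j (k - 1) * r * (lin_factor v j k * ?i k)) q"
    by (simp only: mult_ac)
  also have "\<dots> = act (unit_factor N v j (k - 1) * r) (act (lin_factor v j k * ?i k) q)"
    by (rule act_mult)
  also have "act (lin_factor v j k * ?i k) q = q"
    by (cases "v $ j + of_int k = 0") (simp_all add: lin_factor_def act_inv_lin assms)
  finally show ?thesis .
next
  case False
  then have "{k - 1 + 1..0} = insert k {k + 1..0}" "{1..k} = {}" "{1..k - 1} = {}"
    by auto
  then have "unit_factor N v j (k - 1) = lin_factor v j k * unit_factor N v j k"
    by (simp add: unit_factor_def)
  then show ?thesis by simp
qed

text \<open>The unit factors leave out every linear factor with zero constant term; the second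
  product accounts for these. At u = 0 only the product over \<open>nsupp v - K\<close> remains,
  giving the prescribed leading coefficient.\<close>

definition frob_coeff :: "nat \<Rightarrow> complex ^ 'n \<Rightarrow> 'n set \<Rightarrow> 'n cpoly \<Rightarrow> int ^ 'n \<Rightarrow> 'n::finite cpoly" where
  "frob_coeff N v K q u = act ((\<Prod>j\<in>UNIV. unit_factor N v j (u $ j)) * (\<Prod>j\<in>nsuppL v u - K. var j)) q"

lemma mem_nsuppL: "j \<in> nsuppL v u \<longleftrightarrow> (\<exists>k::int. k < 0 \<and> v $ j + of_int (u $ j) = of_int k)"
  by (simp add: nsuppL_def nsupp_def cvec_def)

text \<open>Going down by one in coordinate j, the index j joins the negative support exactly when
  the upper exponent is 0 there, and then the applied operator is the bare \<open>D\<^sub>j\<close>.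
  The assumption on K keeps this new index out of K. Otherwise the support stays the same and the
  operator is the linear factor of \<open>unit_factor_step\<close>.\<close>

lemma frob_coeff_step:
  assumes deg: "\<And>t. t \<in> keys q \<Longrightarrow> mdeg t < N" and K: "K \<subseteq> nsuppL v (u + axis j 1)"
  shows "act (const ((v + cvec u) $ j + 1) + var j) (frob_coeff N v K q (u + axis j 1)) = frob_coeff N v K q u"
proof -
  let ?u = "u + axis j 1"
  let ?k = "u $ j + 1"
  let ?E = "\<Prod>i\<in>UNIV - {j}. unit_factor N v i (u $ i)"
  have E: "(\<Prod>i\<in>UNIV. unit_factor N v i (u $ i)) = unit_factor N v j (?k - 1) * ?E"
    by (subst prod.remove[of UNIV j]) auto
  have E': "(\<Prod>i\<in>UNIV. unit_factor N v i (?u $ i)) = unit_factor N v j ?k * ?E"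
    by (subst prod.remove[of UNIV j]) (auto simp: axis_def intro!: prod.cong arg_cong2[where f = "(*)"])
  have k: "(v + cvec u) $ j + 1 = v $ j + of_int ?k"
    by (simp add: cvec_def)
  have other: "i \<in> nsuppL v ?u \<longleftrightarrow> i \<in> nsuppL v u" if "i \<noteq> j" for i
    using that by (simp add: mem_nsuppL axis_def)
  have F: "(const (v $ j + of_int ?k) + var j) * (\<Prod>i\<in>nsuppL v ?u - K. var i)
    = lin_factor v j ?k * (\<Prod>i\<in>nsuppL v u - K. var i)"
  proof (cases "v $ j + of_int ?k = 0")
    case True
    then have v: "v $ j = of_int (- ?k)"
      by (simp only: of_int_minus eq_neg_iff_add_eq_0)
    have "j \<in> nsuppL v u"
      unfolding mem_nsuppL v by (intro exI[of _ "- 1"]) simp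
    moreover have "j \<notin> nsuppL v ?u"
      unfolding mem_nsuppL v of_int_add[symmetric] of_int_eq_iff by (simp add: axis_def)
    ultimately have "nsuppL v u = insert j (nsuppL v ?u)"
      using other by (intro set_eqI) (metis insert_iff)
    moreover have "j \<notin> K" using K \<open>j \<notin> nsuppL v ?u\<close> by auto
    ultimately have "nsuppL v u - K = insert j (nsuppL v ?u - K)" "j \<notin> nsuppL v ?u - K"
      using \<open>j \<notin> nsuppL v ?u\<close> by auto
    then show ?thesis
      using True by (simp add: lin_factor_def)
  next
    case False
    have "j \<in> nsuppL v ?u \<longleftrightarrow> j \<in> nsuppL v u"
    proof
      assume "j \<in> nsuppL v ?u"
      then obtain m :: int where "m < 0" "v $ j + of_int (?u $ j) = of_int m"
        unfolding mem_nsuppL by blast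
      then show "j \<in> nsuppL v u"
        unfolding mem_nsuppL by (intro exI[of _ "m - 1"]) (simp add: axis_def algebra_simps)
    next
      assume "j \<in> nsuppL v u"
      then obtain m :: int where m: "m < 0" "v $ j + of_int (u $ j) = of_int m"
        unfolding mem_nsuppL by blast
      then have eq: "v $ j + of_int ?k = of_int (m + 1)" by simp
      with False have "m + 1 \<noteq> 0" by (metis of_int_0)
      with m(1) eq show "j \<in> nsuppL v ?u"
        unfolding mem_nsuppL by (intro exI[of _ "m + 1"]) (simp add: axis_def)
    qed
    with other have "nsuppL v ?u = nsuppL v u"
      by (intro set_eqI) metis
    then show ?thesis
      using False by (simp add: lin_factor_def)
  qed
  have "act (const ((v + cvec u) $ j + 1) + var j) (frob_coeff N v K q ?u)
    = act (unit_factor N v j ?k * ?E * ((const (v $ j + of_int ?k) + var j) * (\<Prod>i\<in>nsuppL v ?u - K. var i))) q"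
    unfolding frob_coeff_def k E' act_mult[symmetric] by (simp only: mult_ac)
  also have "\<dots> = act (lin_factor v j ?k * unit_factor N v j ?k * (?E * (\<Prod>i\<in>nsuppL v u - K. var i))) q"
    unfolding F by (simp only: mult_ac)
  also have "\<dots> = act (unit_factor N v j (?k - 1) * (?E * (\<Prod>i\<in>nsuppL v u - K. var i))) q"
    by (rule unit_factor_step[OF deg])
  also have "\<dots> = frob_coeff N v K q u"
    unfolding frob_coeff_def E by (simp only: mult_ac)
  finally show ?thesis .
qed

lemma nsuppL_antimono:
  assumes "\<And>j. u $ j \<le> t $ j" shows "nsuppL v t \<subseteq> nsuppL v u"
proof
  fix j assume "j \<in> nsuppL v t"
  then obtain k :: int where "k < 0" "v $ j + of_int (t $ j) = of_int k"
    unfolding mem_nsuppL by blast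
  then show "j \<in> nsuppL v u"
    unfolding mem_nsuppL using assms[of j]
    by (intro exI[of _ "k - (t $ j - u $ j)"]) (auto simp: algebra_simps)
qed

text \<open>A left inverse of \<open>\<lambda>u. v + cvec u\<close>, so that coefficients indexed by
  integer vectors define a series on all complex exponents.\<close>

definition int_part :: "complex ^ 'n \<Rightarrow> complex ^ 'n \<Rightarrow> int ^ 'n::finite" where
  "int_part v z = (\<chi> j. \<lfloor>Re (z $ j - v $ j)\<rfloor>)"

lemma int_part_eq [simp]: "int_part v (v + cvec u) = u"
  by (simp add: int_part_def cvec_def vec_eq_iff)

text \<open>The result does not involve p, which is what makes the two terms of a binomial
  comparable. Negative supports shrink as exponents grow, so the assumption on K at u + p passes to
  all intermediate exponents.\<close>

lemma mon_op_frob_coeff: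
  assumes deg: "\<And>t. t \<in> keys q \<Longrightarrow> mdeg t < N" and K: "K \<subseteq> nsuppL v (u + expo p)"
  shows "mon_op d_op p (\<lambda>z. frob_coeff N v K q (int_part v z)) (v + cvec u) = frob_coeff N v K q u"
proof -
  let ?\<psi> = "\<lambda>z. frob_coeff N v K q (int_part v z)"
  \<comment> \<open>Only the value of \<phi> at one exponent is prescribed, so this applies to a
    series already differentiated in other variables.\<close>
  have pow: "(d_op j ^^ k) \<phi> (v + cvec u) = frob_coeff N v K q u"
    if "K \<subseteq> nsuppL v (u + axis j (int k))" "\<phi> (v + cvec (u + axis j (int k))) = frob_coeff N v K q (u + axis j (int k))"
    for j k u \<phi>
    using that
  proof (induction k arbitrary: u)
    case 0
    have "u + axis j (int 0) = u"
      by (simp add: axis_def vec_eq_iff)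
    with 0 show ?case by (simp only: funpow.simps id_apply)
  next
    case (Suc k)
    have ax: "u + axis j 1 + axis j (int k) = u + axis j (int (Suc k))"
      by (simp add: axis_def vec_eq_iff)
    have z: "v + cvec u + axis j 1 = v + cvec (u + axis j 1)"
      by (simp add: cvec_add cvec_axis add.assoc)
    have "nsuppL v (u + axis j (int (Suc k))) \<subseteq> nsuppL v (u + axis j 1)"
      by (rule nsuppL_antimono) (simp add: axis_def)
    then have K1: "K \<subseteq> nsuppL v (u + axis j 1)" using Suc.prems by blast
    have "(d_op j ^^ k) \<phi> (v + cvec (u + axis j 1)) = frob_coeff N v K q (u + axis j 1)"
      by (rule Suc.IH) (use Suc.prems in \<open>simp_all only: ax\<close>)
    then show ?case
      using frob_coeff_step[of q N K v u j, OF deg K1]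
      by (simp only: funpow.simps o_apply d_op_act[of j "(d_op j ^^ k) \<phi>"] z)
  qed
  have "mon_op_on d_op p F ?\<psi> (v + cvec u) = frob_coeff N v K q u"
    if "finite F" "K \<subseteq> nsuppL v (u + (\<Sum>j\<in>F. axis j (int (lookup p j))))" for F u
    using that
  proof (induction F arbitrary: u)
    case empty
    then show ?case by (simp add: mon_op_on_empty)
  next
    case (insert j F)
    let ?u = "u + axis j (int (lookup p j))"
    have eq: "u + (\<Sum>j\<in>insert j F. axis j (int (lookup p j))) = ?u + (\<Sum>j\<in>F. axis j (int (lookup p j)))"
      using insert.hyps by (simp add: add.assoc)
    have le: "0 \<le> (\<Sum>j\<in>F. axis j (int (lookup p j))) $ i" for i
      unfolding sum_component by (rule sum_nonneg) (simp add: axis_def)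
    have "nsuppL v (?u + (\<Sum>j\<in>F. axis j (int (lookup p j)))) \<subseteq> nsuppL v ?u"
      by (rule nsuppL_antimono) (use le in simp)
    with insert.prems have K1: "K \<subseteq> nsuppL v ?u" unfolding eq by blast
    show ?case
      unfolding mon_op_on_insert[OF d_op_commute insert.hyps]
      by (rule pow[OF K1], rule insert.IH) (use insert.prems eq in simp)
  qed
  moreover have "expo p = (\<Sum>j\<in>UNIV. axis j (int (lookup p j)))"
    by (simp add: expo_def vec_eq_iff axis_def)
  ultimately have "mon_op_on d_op p UNIV ?\<psi> (v + cvec u) = frob_coeff N v K q u"
    using K by simp
  then show ?thesis
    by (simp only: mon_op_def mon_op_on_def)
qed

section \<open>Equality of the space of leading coefficients with Q\<close>

locale frobenius = toric_groebner A w G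
  for A :: "int ^ 'n::finite ^ 'd::finite" and w G +
  fixes \<beta> :: "complex ^ 'd" and v :: "complex ^ 'n" and h :: nat and b :: "nat \<Rightarrow> int ^ 'n"
  assumes rank: "rank (map_matrix of_int A :: rat ^ 'n ^ 'd) = CARD('d)"
    and fake: "fake_exponent A \<beta> w v"
    and basis: "Z_basis h b (kerZ A)"
    and P_eq: "P_ideal A v G h b = (\<lambda>p. m_elem A v G h b * p) ` PB_ideal v G h b"
begin

definition Q :: "'n cpoly set" where
  "Q = {f \<in> eulerian A. \<forall>p q. (p, q) \<in> G \<longrightarrow> act (\<Prod>j\<in>zset v p. var j) f = 0}"

lemma zset_nonempty: "(p, q) \<in> G \<Longrightarrow> zset v p \<noteq> {}"
  using groebner by (intro fake_exponent_zset[OF fake]) (auto simp: binomial_groebner_basis_def)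

text \<open>The binomial equation is read at the exponent v - p. There
  \<open>\<partial>\<^sup>p\<close> sees the leading coefficient, while
  \<open>\<partial>\<^sup>q\<close> sees the coefficient at v - g.\<close>

lemma leading_coefficient_in_Q:
  assumes "series_solution A \<beta> w v \<phi>" shows "\<phi> v \<in> Q"
proof -
  have ann: "T \<phi> = (\<lambda>z. 0)" if "T \<in> hypergeometric_ideal A \<beta>" for T
    using assms that by (simp add: series_solution_def)
  obtain S where S: "\<forall>x\<in>S. x \<noteq> 0 \<longrightarrow> 0 < w \<bullet> x" "\<forall>u\<in>kerZ A. \<phi> (v + cvec u) \<noteq> 0 \<longrightarrow> rvec u \<in> S"
    using assms unfolding series_solution_def by blast
  have "act (Aform A i) (\<phi> v) = 0" for i
  proof -
    have "poly_op theta_op (Aform A i - const (\<beta> $ i)) \<in> hypergeometric_ideal A \<beta>"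
      unfolding hypergeometric_ideal_def by (intro left_ideal.gen) blast
    from fun_cong[OF ann[OF this], of v] show ?thesis
      by (simp add: poly_op_theta_op subst_diff Aform_subst_shift fake_exponent_eq[OF fake])
  qed
  moreover have "act (\<Prod>j\<in>zset v p. var j) (\<phi> v) = 0" if pq: "(p, q) \<in> G" for p q
  proof -
    have "monom p - monom q \<in> toric_ideal A"
      using groebner_fibre[OF pq] by (simp add: binomial_in_toric_ideal)
    then have "poly_op d_op (monom p - monom q) \<in> hypergeometric_ideal A \<beta>"
      unfolding hypergeometric_ideal_def by (intro left_ideal.gen) blast
    from fun_cong[OF ann[OF this], of "v - cvec (expo p)"]
    have eq: "mon_op d_op p \<phi> (v - cvec (expo p)) = mon_op d_op q \<phi> (v - cvec (expo p))"
      by (simp add: poly_op_diff poly_op_monom)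
    let ?u = "- gvec (p, q)"
    \<comment> \<open>The vector -g has negative weight and so lies outside the cone supporting the
      series.\<close>
    have "\<phi> (v + cvec ?u) = 0"
    proof (rule ccontr)
      assume "\<phi> (v + cvec ?u) \<noteq> 0"
      moreover have "?u \<in> kerZ A"
        using groebner_fibre[OF pq]
        by (simp add: kerZ_def gvec_def matrix_vector_mult_diff_distrib)
      ultimately have "rvec ?u \<in> S" using S(2) by blast
      moreover have "w \<bullet> rvec ?u < 0"
        using inner_gvec_pos[OF pq] by (simp add: rvec_def inner_vec_def sum_negf)
      ultimately show False using S(1) by (metis inner_zero_right less_asym less_irrefl)
    qed
    moreover have "v - cvec (expo p) + cvec (expo q) = v + cvec ?u"
      by (simp add: cvec_def gvec_def vec_eq_iff)
    ultimately have "mon_op d_op p \<phi> (v - cvec (expo p)) = 0"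
      unfolding eq by (simp only: mon_op_d_op act_0_right)
    then have "act (\<Prod>j\<in>UNIV. \<Prod>k<lookup p j. const (v $ j - of_nat k) + var j) (\<phi> v) = 0"
      by (simp only: mon_op_d_op prod_dfactor_falling diff_add_cancel)
    then show ?thesis
      unfolding prod_falling_split by (rule act_prod_lin_eq_0[rotated 2]) auto
  qed
  ultimately show ?thesis by (auto simp: Q_def eulerian_def)
qed

abbreviation "K \<equiv> \<Inter> (NS A v G)"

lemma nsupp_NS: "nsupp v \<in> NS A v G"
  by (rule nsupp_in_NS) (use zset_nonempty in blast)

text \<open>The hypothesis writes the product over (I \<union> J) - K as m(s) r with r in
  \<open>PB_ideal\<close>. Read as operators, m(s) sends q into Q, and r annihilates the
  result.\<close>

lemma P_annihilates:
  assumes q: "q \<in> eulerian A" "act (\<Prod>j\<in>nsupp v - K. var j) q \<in> Q"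
    and IJ: "I \<in> NS A v G" "J \<in> NSc A v G"
  shows "act (\<Prod>j\<in>(I \<union> J) - K. var j) q = 0"
proof -
  obtain c :: "nat \<Rightarrow> 'n \<Rightarrow> complex" and R :: "'n \<Rightarrow> 'd \<Rightarrow> complex"
    where cR: "\<forall>j l. (\<Sum>k<h. of_int (b k $ j) * c k l)
      = (if j = l then 1 else 0) - (\<Sum>i\<in>UNIV. R j i * of_int (A $ i $ l))"
    using kernel_section[OF rank basis] by (elim exE)
  \<comment> \<open>By the choice of c, this substitution sends \<open>Bs h b j\<close> to the
    variable j minus a combination of Euler forms, which vanishes on
    \<open>eulerian A\<close>.\<close>
  define \<sigma> where "\<sigma> k = (\<Sum>l\<in>UNIV. cscale (c k l) (var l))" for k
  have Bs: "subst \<sigma> (Bs h b j) = var j - (\<Sum>i\<in>UNIV. cscale (R j i) (Aform A i))" for j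
  proof (rule poly_mapping_eqI)
    fix u
    have "lookup (subst \<sigma> (Bs h b j)) u = (\<Sum>k<h. \<Sum>l\<in>UNIV. of_int (b k $ j) * c k l * lookup (var l) u)"
      by (simp add: Bs_def subst_sum subst_cscale \<sigma>_def lookup_sum lookup_cscale sum_distrib_left mult.assoc)
    also have "\<dots> = (\<Sum>l\<in>UNIV. (\<Sum>k<h. of_int (b k $ j) * c k l) * lookup (var l) u)"
      unfolding sum_distrib_right by (rule sum.swap)
    also have "\<dots> = (\<Sum>l\<in>UNIV. (if j = l then lookup (var l) u else 0))
      - (\<Sum>l\<in>UNIV. \<Sum>i\<in>UNIV. R j i * (of_int (A $ i $ l) * lookup (var l) u))"
      unfolding cR[rule_format] left_diff_distrib sum_subtractf sum_distrib_right
      by (simp add: mult.assoc if_distrib[of "\<lambda>x. x * _"] cong: if_cong)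
    also have "\<dots> = lookup (var j - (\<Sum>i\<in>UNIV. cscale (R j i) (Aform A i))) u"
      by (subst sum.swap) (simp add: lookup_minus lookup_sum lookup_cscale Aform_def sum_distrib_left)
    finally show "lookup (subst \<sigma> (Bs h b j)) u = lookup (var j - (\<Sum>i\<in>UNIV. cscale (R j i) (Aform A i))) u" .
  qed
  have act1: "act (subst \<sigma> (Bs h b j)) g = act (var j) g" if "g \<in> eulerian A" for j g
    using that by (simp add: Bs act_diff_left act_sum_left act_cscale_left eulerian_def)
  have actF: "act (subst \<sigma> (Bs_prod h b F)) g = act (\<Prod>j\<in>F. var j) g" if "g \<in> eulerian A" for F g
  proof -
    have "finite F" by simp
    then show ?thesis
      unfolding Bs_prod_def subst_prod using that
      by (induction F) (simp_all add: act_mult act1 eulerian_act)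
  qed
  let ?f = "act (\<Prod>j\<in>nsupp v - K. var j) q"
  have PB: "act (subst \<sigma> r) ?f = 0" if "r \<in> PB_ideal v G h b" for r
    using that unfolding PB_ideal_def
  proof (induction rule: ideal_in_induct)
    case (step a g r)
    then obtain p p' where g: "g = Bs_prod h b (nsuppL v (- gvec (p, p')) - nsupp v)" "(p, p') \<in> G"
      by auto
    have "act (subst \<sigma> g) ?f = 0"
      unfolding g(1) nsuppL_gvec[OF g(2)] actF[OF eulerian_act[OF q(1)]]
      using q(2) g(2) by (auto simp: Q_def)
    then show ?case
      by (simp only: subst_add subst_mult act_add_left act_mult step.IH act_0_right add_0)
  qed simp
  have "Bs_prod h b ((I \<union> J) - K) \<in> P_ideal A v G h b"
    unfolding P_ideal_def using IJ by (intro ideal_in_base) blast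
  then obtain r where r: "r \<in> PB_ideal v G h b" "Bs_prod h b ((I \<union> J) - K) = m_elem A v G h b * r"
    unfolding P_eq by blast
  have "act (\<Prod>j\<in>(I \<union> J) - K. var j) q = act (subst \<sigma> (r * Bs_prod h b (nsupp v - K))) q"
    using actF[OF q(1), of "(I \<union> J) - K"] unfolding r(2) m_elem_def by (simp only: mult.commute)
  also have "\<dots> = act (subst \<sigma> r) ?f"
    by (simp only: subst_mult act_mult actF[OF q(1)])
  finally show ?thesis
    using PB[OF r(1)] by simp
qed

lemma Cw_rvec: "u \<in> Cw G \<Longrightarrow> rvec u \<in> convex_cone hull (rvec ` gvec ` G)"
proof -
  assume "u \<in> Cw G"
  then obtain c where "u = (\<Sum>g\<in>G. int (c g) *s gvec g)" by (auto simp: Cw_def)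
  then have u: "rvec u = (\<Sum>g\<in>G. real (c g) *\<^sub>R rvec (gvec g))"
    by (simp add: rvec_def vec_eq_iff)
  have "(\<Sum>g\<in>S. real (c g) *\<^sub>R rvec (gvec g)) \<in> convex_cone hull (rvec ` gvec ` G)" if "finite S" "S \<subseteq> G" for S
    using that
  proof (induction S)
    case empty
    show ?case using convex_cone_contains_0[OF convex_cone_convex_cone_hull] by simp
  next
    case (insert g S)
    have "rvec (gvec g) \<in> convex_cone hull (rvec ` gvec ` G)"
      using insert.prems by (intro hull_inc) auto
    with insert show ?case
      by (auto intro!: convex_cone_add[OF convex_cone_convex_cone_hull] convex_cone_scaleR[OF convex_cone_convex_cone_hull])
  qed
  from this[OF finite_G] show ?thesis unfolding u by simp
qed

text \<open>The open half-space of positive weight together with 0 is a convex cone containing the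
  generators.\<close>

lemma cone_pos:
  assumes "x \<in> convex_cone hull (rvec ` gvec ` G)" "x \<noteq> 0" shows "0 < w \<bullet> x"
proof -
  have "convex_cone {x. x = 0 \<or> 0 < w \<bullet> x}"
    unfolding convex_cone_iff by (auto simp: inner_right_distrib less_eq_real_def intro: add_pos_pos)
  moreover have "rvec ` gvec ` G \<subseteq> {x. x = 0 \<or> 0 < w \<bullet> x}"
    using inner_gvec_pos by auto
  ultimately have "convex_cone hull (rvec ` gvec ` G) \<subseteq> {x. x = 0 \<or> 0 < w \<bullet> x}"
    by (intro hull_minimal)
  with assms show ?thesis by auto
qed

lemma Q_leading_coefficient:
  assumes f: "f \<in> Q" "f \<noteq> 0"
  shows "\<exists>\<phi>. series_solution A \<beta> w v \<phi> \<and> \<phi> v = f"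
proof -
  \<comment> \<open>Some member of NS omits j because j is outside K. As j is in the negative
    support of v, the corresponding u must move it.\<close>
  have "\<exists>u\<in>kerZ A. u $ j \<noteq> 0" if "j \<in> nsupp v - K" for j
  proof -
    from that obtain u where u: "u \<in> kerZ A" "j \<notin> nsuppL v u" by (auto simp: NS_def)
    have "u $ j \<noteq> 0"
      using u(2) that by (auto simp: mem_nsuppL nsupp_def)
    with u(1) show ?thesis by blast
  qed
  then obtain q where q: "q \<in> eulerian A" "act (\<Prod>j\<in>nsupp v - K. var j) q = f"
    using eulerian_prod_surj[of "nsupp v - K" A f] f(1) by (auto simp: Q_def)
  define N where "N = Suc (Max (insert 0 (mdeg ` keys q)))"
  have deg: "mdeg t < N" if "t \<in> keys q" for t
    using that by (simp add: N_def less_Suc_eq_le)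
  define good where "good z \<longleftrightarrow> (\<exists>u\<in>kerZ A. z = v + cvec u \<and> nsuppL v u \<in> NS A v G)" for z
  define \<phi> where "\<phi> z = (if good z then frob_coeff N v K q (int_part v z) else 0)" for z
  have good_v: "good (v + cvec u) \<longleftrightarrow> u \<in> kerZ A \<and> nsuppL v u \<in> NS A v G" for u
    by (auto simp: good_def)
  have \<phi>u: "\<phi> (v + cvec u) = (if u \<in> kerZ A \<and> nsuppL v u \<in> NS A v G then frob_coeff N v K q u else 0)" for u
    by (simp add: \<phi>_def good_v)
  \<comment> \<open>Here p enters only through the question whether z + p lies over NS, so the two
    terms of a binomial can differ only if exactly one exponent does.\<close>
  have mon: "mon_op d_op p \<phi> z = (if good (z + cvec (expo p)) then frob_coeff N v K q (int_part v z) else 0)" for p z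
  proof (cases "good (z + cvec (expo p))")
    case True
    then obtain t where t: "t \<in> kerZ A" "z + cvec (expo p) = v + cvec t" "nsuppL v t \<in> NS A v G"
      by (auto simp: good_def)
    define u where "u = t - expo p"
    have tu: "t = u + expo p" by (simp add: u_def)
    have z: "z = v + cvec u"
      using t(2) by (simp add: tu cvec_add algebra_simps)
    have "K \<subseteq> nsuppL v (u + expo p)"
      using t(3) by (auto simp: tu)
    from mon_op_frob_coeff[OF deg this]
    have "mon_op d_op p (\<lambda>z. frob_coeff N v K q (int_part v z)) z = frob_coeff N v K q u"
      by (simp add: z)
    then show ?thesis
      using True by (simp add: mon_op_d_op \<phi>_def) (simp add: z)
  next
    case False
    then show ?thesis by (simp add: mon_op_d_op \<phi>_def)
  qed
  have binom: "mon_op d_op p \<phi> z = mon_op d_op p' \<phi> z" if pp: "A *v expo p = A *v expo p'" for p p' z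
  proof -
    \<comment> \<open>Both upper exponents dominate u, so the negative support at u contains theirs.
      The coefficient at u thus has the factor annihilated by \<open>P_annihilates\<close>.\<close>
    have half: "frob_coeff N v K q (int_part v z) = 0"
      if pp: "A *v expo p = A *v expo p'" and good: "good (z + cvec (expo p))" "\<not> good (z + cvec (expo p'))" for p p'
    proof -
      obtain t where t: "t \<in> kerZ A" "z + cvec (expo p) = v + cvec t" "nsuppL v t \<in> NS A v G"
        using good(1) by (auto simp: good_def)
      define u where "u = t - expo p"
      have tu: "t = u + expo p" by (simp add: u_def)
      have z: "z = v + cvec u"
        using t(2) by (simp add: tu cvec_add algebra_simps)
      let ?t = "u + expo p'"
      have "?t \<in> kerZ A"
        using t(1) pp by (simp add: kerZ_def tu matrix_vector_right_distrib)
      moreover have "nsuppL v ?t \<notin> NS A v G"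
        using good(2) \<open>?t \<in> kerZ A\<close> by (simp add: z add.assoc good_v flip: cvec_add)
      ultimately have "nsuppL v ?t \<in> NSc A v G"
        by (simp add: NSc_def)
      from P_annihilates[OF q(1) _ t(3) this] f(1) q(2)
      have 0: "act (\<Prod>j\<in>(nsuppL v t \<union> nsuppL v ?t) - K. var j) q = 0" by simp
      have "nsuppL v t \<subseteq> nsuppL v u" "nsuppL v ?t \<subseteq> nsuppL v u"
        by (intro nsuppL_antimono; simp add: tu expo_def)+
      then have sub: "(nsuppL v t \<union> nsuppL v ?t) - K \<subseteq> nsuppL v u - K" by blast
      let ?r = "(\<Prod>j\<in>UNIV. unit_factor N v j (u $ j)) *
        (\<Prod>j\<in>(nsuppL v u - K) - ((nsuppL v t \<union> nsuppL v ?t) - K). var j)"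
      have "frob_coeff N v K q u = act (?r * (\<Prod>j\<in>(nsuppL v t \<union> nsuppL v ?t) - K. var j)) q"
        unfolding frob_coeff_def prod.subset_diff[OF sub finite] by (simp only: mult.assoc)
      also have "\<dots> = 0"
        by (simp only: act_mult[of ?r] 0 act_0_right)
      finally show ?thesis by (simp add: z)
    qed
    show ?thesis
      unfolding mon using half[OF pp] half[OF pp[symmetric]] by auto
  qed
  have toric: "poly_op d_op r \<phi> z = 0" if "r \<in> toric_ideal A" for r z
    using toric_ideal_span[OF that]
  proof (induction rule: cpoly.span_induct_alt)
    case (step c g r)
    then obtain p p' where g: "g = monom p - monom p'" "A *v expo p = A *v expo p'" by auto
    show ?case
      using binom[OF g(2), of z] step.IH
      by (simp add: poly_op_add poly_op_cscale g(1) poly_op_diff poly_op_monom)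
  qed (simp add: poly_op_0)
  have eulerian: "frob_coeff N v K q u \<in> eulerian A" for u
    unfolding frob_coeff_def by (rule eulerian_act[OF q(1)])
  have euler: "poly_op theta_op (Aform A i - const (\<beta> $ i)) \<phi> z = 0" for i z
  proof (cases "good z")
    case True
    then obtain u where u: "u \<in> kerZ A" "z = v + cvec u" by (auto simp: good_def)
    have "(\<Sum>j\<in>UNIV. of_int (A $ i $ j) * z $ j) = \<beta> $ i + of_int ((A *v u) $ i)"
      unfolding u(2) fake_exponent_eq[OF fake, symmetric]
      by (simp add: cvec_def distrib_left sum.distrib matrix_vector_mult_def)
    also have "\<dots> = \<beta> $ i" using u(1) by (simp add: kerZ_def)
    finally show ?thesis
      using eulerian True by (simp add: poly_op_theta_op subst_diff Aform_subst_shift \<phi>_def eulerian_def)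
  qed (simp add: poly_op_theta_op \<phi>_def)
  have sol: "T \<phi> = (\<lambda>z. 0)" if "T \<in> hypergeometric_ideal A \<beta>" for T
    by (rule left_ideal_annihilates[OF that[unfolded hypergeometric_ideal_def]]) (use toric euler in auto)
  have \<phi>v: "\<phi> v = f"
  proof -
    have "nsuppL v 0 = nsupp v" by (simp add: nsuppL_def)
    then show ?thesis
      using \<phi>u[of 0] nsupp_NS q(2) by (simp add: kerZ_def frob_coeff_def)
  qed
  have "series_solution A \<beta> w v \<phi>"
    unfolding series_solution_def
  proof (intro conjI)
    show "\<forall>T\<in>hypergeometric_ideal A \<beta>. T \<phi> = (\<lambda>z. 0)" using sol by blast
    show "\<forall>z. \<phi> z \<noteq> 0 \<longrightarrow> (\<exists>u\<in>kerZ A. z = v + cvec u)"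
      by (auto simp: \<phi>_def good_def)
    show "\<phi> v \<noteq> 0" using \<phi>v f(2) by simp
    have "mdeg m \<le> N" if "m \<in> keys (\<phi> z)" for z m
    proof -
      have "m \<in> keys (frob_coeff N v K q (int_part v z))"
        using that by (auto simp: \<phi>_def split: if_splits)
      then obtain t where "m + t \<in> keys q"
        unfolding frob_coeff_def by (auto dest: keys_act)
      from deg[OF this] show ?thesis by simp
    qed
    then show "\<exists>N. \<forall>z. \<forall>m\<in>keys (\<phi> z). mdeg m \<le> N" by blast
    let ?S = "convex_cone hull (rvec ` gvec ` G)"
    show "\<exists>S. rational_cone S \<and> pointed_cone S \<and> (\<forall>x\<in>S. x \<noteq> 0 \<longrightarrow> 0 < w \<bullet> x) \<and>
      (\<forall>u\<in>kerZ A. \<phi> (v + cvec u) \<noteq> 0 \<longrightarrow> rvec u \<in> S)"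
    proof (intro exI[of _ ?S] conjI ballI impI)
      show "rational_cone ?S"
        unfolding rational_cone_def using finite_G by blast
      show "pointed_cone ?S"
        unfolding pointed_cone_def
      proof (intro ballI impI, rule ccontr)
        fix x assume x: "x \<in> ?S" "- x \<in> ?S" "x \<noteq> 0"
        then show False
          using cone_pos[of x] cone_pos[of "- x"] by simp
      qed
      show "0 < w \<bullet> x" if "x \<in> ?S" "x \<noteq> 0" for x
        using that by (rule cone_pos)
      show "rvec u \<in> ?S" if u: "u \<in> kerZ A" "\<phi> (v + cvec u) \<noteq> 0" for u
      proof (rule Cw_rvec)
        have "nsuppL v u \<in> NS A v G"
          using u by (auto simp: \<phi>u split: if_splits)
        with u(1) show "u \<in> Cw G" unfolding NS_def by blast
      qed
    qed
  qed
  with \<phi>v show ?thesis by blast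
qed

theorem Cv_eq_Q: "Cv A \<beta> w v = Q"
proof -
  have "0 \<in> Q" by (simp add: Q_def eulerian_def)
  then show ?thesis
    unfolding Cv_def using leading_coefficient_in_Q Q_leading_coefficient by blast
qed

end

section \<open>Finiteness and the Hilbert series\<close>

text \<open>An operator homogeneous of degree k lowers degrees by exactly k, so it acts on each
  homogeneous component separately.\<close>

lemma act_hcomp_eq_0:
  assumes "p \<in> homog k" "act p f = 0" shows "act p (hcomp q f) = 0"
proof (rule poly_mapping_eqI)
  fix t
  have "lookup (act p (hcomp q f)) t = (lookup (act p f) t when mdeg t + k = q)"
    unfolding lookup_act using assms(1)
    by (auto simp: lookup_hcomp homog_def when_def intro!: sum.cong sum.neutral arg_cong[where f = "\<lambda>x. x / _"])
  with assms(2) show "lookup (act p (hcomp q f)) t = lookup 0 t" by simp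
qed

lemma homog_Aform: "Aform A i \<in> homog 1"
  unfolding Aform_def by (intro homog_sum homog_cscale homog_var)

lemma homog_prod_var: "(\<Prod>j\<in>S. var j) \<in> homog (\<Sum>j\<in>S. 1)"
  by (intro homog_prod homog_var)

lemma pairing_eq: "pairing g f = (\<Sum>u\<in>keys g. lookup g u * (mfact u * lookup f u))"
  by (simp add: pairing_def lookup_act)

lemma subst_var_eq: "subst var p = p"
proof (induction p rule: cpoly_induct)
  case (single u c)
  show ?case
    unfolding subst_single unfolding single_eq monom_eq_mpow_var ..
qed (simp add: subst_add)

lemma subst_eq_self:
  assumes "\<And>j. j \<in> V \<Longrightarrow> \<sigma> j = var j" "p \<in> polys_in V" shows "subst \<sigma> p = p"
proof -
  have "subst \<sigma> p = subst var p"
    unfolding subst_def mpow_def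
    by (intro sum.cong prod.cong refl arg_cong2[where f = "(*)"] arg_cong2[where f = "(^)"])
      (use assms in \<open>auto simp: polys_in_def\<close>)
  then show ?thesis by (simp add: subst_var_eq)
qed

lemma subst_congruent:
  assumes "\<And>j. \<sigma> j - var j \<in> ideal S" shows "subst \<sigma> p - p \<in> ideal S"
proof -
  have mult: "a * b - a' * b' \<in> ideal S" if "a - a' \<in> ideal S" "b - b' \<in> ideal S" for a b a' b'
  proof -
    have "a * b - a' * b' = b * (a - a') + a' * (b - b')"
      by (simp add: algebra_simps)
    then show ?thesis using that by (simp add: ideal_add ideal_mult)
  qed
  have pow: "\<sigma> j ^ k - var j ^ k \<in> ideal S" for j k
    by (induction k) (simp_all add: ideal_0 mult assms)
  have "(\<Prod>j\<in>F. \<sigma> j ^ k j) - (\<Prod>j\<in>F. var j ^ k j) \<in> ideal S" if "finite F" for F k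
    using that by (induction F) (simp_all add: ideal_0 mult pow)
  then have mpow: "mpow \<sigma> u - monom u \<in> ideal S" for u
    by (simp add: monom_eq_mpow_var mpow_def)
  show ?thesis
  proof (induction p rule: cpoly_induct)
    case (single u c)
    have "subst \<sigma> (single u c) - single u c = const c * (mpow \<sigma> u - monom u)"
      unfolding subst_single unfolding single_eq right_diff_distrib ..
    then show ?case using ideal_mult[OF mpow] by simp
  next
    case (add p q)
    from ideal_add[OF add] show ?case by (simp only: subst_add add_diff_add)
  qed
qed

section \<open>Bounded degree of Q and its duality with the Stanley-Reisner quotient\<close>

context frobenius
begin

text \<open>Descent on the complement of \<tau>. If \<tau> contains some \<open>zset\<close>, the
  product already kills Q. Otherwise the columns of A in \<tau> are independent, so on Q a
  derivative inside \<tau> is a combination of derivatives outside; thus any one further derivative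
  can be traded for an enlargement of \<tau>.\<close>

lemma Q_nilpotent:
  "\<exists>N. \<forall>f\<in>Q. \<forall>u. N \<le> mdeg u \<longrightarrow> act (monom u * (\<Prod>j\<in>\<tau>. var j)) f = 0"
proof (induction "card (- \<tau>)" arbitrary: \<tau> rule: less_induct)
  case less
  show ?case
  proof (cases "\<exists>p q. (p, q) \<in> G \<and> zset v p \<subseteq> \<tau>")
    case True
    then obtain p q where pq: "(p, q) \<in> G" "zset v p \<subseteq> \<tau>" by blast
    have "act (monom u * (\<Prod>j\<in>\<tau>. var j)) f = 0" if f: "f \<in> Q" for f u
    proof -
      have "act (\<Prod>j\<in>zset v p. var j) f = 0" using f pq(1) by (auto simp: Q_def)
      then show ?thesis
        unfolding prod.subset_diff[OF pq(2) finite] mult.assoc[symmetric]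
        by (simp only: act_mult[of _ "\<Prod>j\<in>zset v p. var j"] act_0_right)
    qed
    then show ?thesis by blast
  next
    case False
    have "\<exists>N. \<forall>f\<in>Q. \<forall>u. N \<le> mdeg u \<longrightarrow> act (monom u * (\<Prod>j\<in>insert k \<tau>. var j)) f = 0" if "k \<notin> \<tau>" for k
      by (rule less) (use that in \<open>auto intro!: psubset_card_mono\<close>)
    then obtain N where N: "\<And>k f u. k \<notin> \<tau> \<Longrightarrow> f \<in> Q \<Longrightarrow> N k \<le> mdeg u \<Longrightarrow>
        act (monom u * (\<Prod>j\<in>insert k \<tau>. var j)) f = 0"
      by metis
    \<comment> \<open>The sum dominates the bound of every enlarged set, and \<open>Suc\<close> pays
      for the derivative that is traded.\<close>
    have "act (monom u * (\<Prod>j\<in>\<tau>. var j)) f = 0"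
      if f: "f \<in> Q" and u: "Suc (\<Sum>k\<in>- \<tau>. N k) \<le> mdeg u" for f u
    proof -
      have "u \<noteq> 0" using u by auto
      then obtain j where "j \<in> keys u" by (metis keys_eq_empty all_not_in_conv)
      then have "\<forall>i. lookup (single j (1::nat)) i \<le> lookup u i"
        by (auto simp: in_keys_iff lookup_single when_def)
      then obtain t where t: "u = single j 1 + t"
        unfolding exponent_dvd_iff[symmetric] by blast
      let ?p = "monom t * (\<Prod>j\<in>\<tau>. var j)"
      have up: "monom u * (\<Prod>j\<in>\<tau>. var j) = ?p * var j"
      proof -
        have "monom u = monom t * var j"
          by (simp only: t monom_add var_def mult.commute)
        then show ?thesis by (simp only: mult_ac)
      qed
      have outside: "act (?p * var k) f = 0" if k: "k \<notin> \<tau>" for k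
      proof -
        have "N k \<le> (\<Sum>k\<in>- \<tau>. N k)"
          by (rule member_le_sum) (use k in auto)
        then have "N k \<le> mdeg t" using u by (simp add: t)
        from N[OF k f this] show ?thesis
          by (simp only: prod.insert[OF finite k] mult_ac)
      qed
      show ?thesis
      proof (cases "j \<in> \<tau>")
        case False
        then show ?thesis unfolding up by (rule outside)
      next
        case True
        have ind: "x = 0" if "A *v x = 0" "\<And>j. j \<notin> \<tau> \<Longrightarrow> x $ j = 0" for x
          using columns_independent[of v \<tau> x] False that by blast
        obtain y :: "'d \<Rightarrow> complex"
          where y: "\<And>k. k \<in> \<tau> \<Longrightarrow> (\<Sum>i\<in>UNIV. y i * of_int (A $ i $ k)) = (if k = j then 1 else 0)"
          using dual_functional[OF ind True] by blast
        define c where "c k = (\<Sum>i\<in>UNIV. y i * of_int (A $ i $ k))" for k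
        have "(\<Sum>i\<in>UNIV. cscale (y i) (Aform A i)) = (\<Sum>k\<in>UNIV. cscale (c k) (var k))"
          unfolding Aform_def c_def cpoly.scale_sum_right cpoly.scale_sum_left cpoly.scale_scale
          by (rule sum.swap)
        also have "\<dots> = (\<Sum>k\<in>\<tau>. cscale (c k) (var k)) + (\<Sum>k\<in>- \<tau>. cscale (c k) (var k))"
          using sum.union_disjoint[of \<tau> "- \<tau>" "\<lambda>k. cscale (c k) (var k)"] by simp
        also have "(\<Sum>k\<in>\<tau>. cscale (c k) (var k)) = (\<Sum>k\<in>\<tau>. if k = j then var k else 0)"
          by (rule sum.cong) (auto simp: c_def y)
        also have "\<dots> = var j" using True by simp
        finally have "var j = (\<Sum>i\<in>UNIV. cscale (y i) (Aform A i)) - (\<Sum>k\<in>- \<tau>. cscale (c k) (var k))"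
          by simp
        then have "act (?p * var j) f
          = act ?p (\<Sum>i\<in>UNIV. cscale (y i) (act (Aform A i) f)) - (\<Sum>k\<in>- \<tau>. cscale (c k) (act (?p * var k) f))"
          by (simp only: act_mult[of ?p] act_diff_left act_diff_right act_sum_left act_sum_right
              act_cscale_left act_cscale_right)
        also have "\<dots> = 0"
          using f outside by (simp add: Q_def eulerian_def)
        finally show ?thesis unfolding up .
      qed
    qed
    then show ?thesis by blast
  qed
qed

lemma Q_bounded: "\<exists>N. \<forall>f\<in>Q. \<forall>u\<in>keys f. mdeg u < N"
proof -
  obtain N where N: "\<And>f u. f \<in> Q \<Longrightarrow> N \<le> mdeg u \<Longrightarrow> act (monom u) f = 0"
    using Q_nilpotent[of "{}"] by auto
  have "mdeg u < N" if "f \<in> Q" "u \<in> keys f" for f u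
  proof (rule ccontr)
    assume "\<not> mdeg u < N"
    with N[OF that(1), of u] lookup_act_monom_0[of u f] that(2) show False
      by (simp add: in_keys_iff)
  qed
  then show ?thesis by blast
qed

lemma subspace_Q: "cpoly.subspace Q"
  by (auto simp: cpoly.subspace_def Q_def eulerian_def act_add_right act_cscale_right)

lemma hcomp_Q: "f \<in> Q \<Longrightarrow> hcomp q f \<in> Q"
  unfolding Q_def eulerian_def
  by (auto intro: act_hcomp_eq_0[OF homog_Aform] act_hcomp_eq_0[OF homog_prod_var])

text \<open>Every \<open>zset\<close> of the basis is nonempty, so each product differentiates at
  least once. This makes the set of degrees in the final maximum nonempty.\<close>

lemma one_in_Q: "1 \<in> Q"
proof -
  have "act (\<Prod>j\<in>zset v p. var j) (const 1) = 0" if pq: "(p, q) \<in> G" for p q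
  proof -
    obtain j where "j \<in> zset v p" using zset_nonempty[OF pq] by blast
    then have "(\<Prod>j\<in>zset v p. var j) = (\<Prod>j\<in>zset v p - {j}. var j) * var j"
      by (subst prod.remove[of _ j]) (auto simp: mult.commute)
    then show ?thesis by (simp only: act_mult act_var pdiff_const act_0_right)
  qed
  then show ?thesis
    using eulerian_const[of 1 A] by (auto simp: Q_def)
qed

lemma zset_disjoint: "zset v p \<subseteq> - nsupp v"
  using nsupp_not_nat by (auto simp: zset_def)

text \<open>Restricting an element of Q to its terms in the variables V gives a polynomial
  orthogonal to J, and the Euler equations recover the element. So the degree q part of Q is the
  orthogonal space of that of J, to which \<open>dim_orthogonal\<close> applies.\<close>

lemma dim_Q_homog:
  fixes Lf ell
  assumes rr: "row_reduction A (nsupp v) Lf ell"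
  defines "V \<equiv> - nsupp v"
  defines "J \<equiv> ideal_in V (stanley_reisner_ideal V (link A w v) \<union> {ell q | q. q < CARD('d) - card (nsupp v)})"
  shows "cpoly.dim (Q \<inter> homog q) + cpoly.dim (J \<inter> homog q) = cpoly.dim (polys_in V \<inter> homog q)"
proof -
  \<comment> \<open>Elimination of the variables in the negative support. It is the identity on V
    and changes a polynomial only by the ideal of the Euler forms.\<close>
  define \<rho> where "\<rho> j = (if j \<in> V then var j else Lf j)" for j
  have Lf: "Lf j \<in> polys_in V" "Lf j \<in> homog 1" if "j \<notin> V" for j
    using rr that unfolding row_reduction_def linear_forms_def V_def by auto
  have ell: "ell k \<in> polys_in V" if "k < CARD('d) - card (nsupp v)" for k
    using rr that unfolding row_reduction_def linear_forms_def V_def by auto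
  have ideal_eq: "ideal (range (Aform A)) =
      ideal ({var p - Lf p | p. p \<in> nsupp v} \<union> {ell q | q. q < CARD('d) - card (nsupp v)})"
    using rr by (simp add: row_reduction_def)
  have \<rho>_in: "\<rho> j \<in> polys_in V" and \<rho>_homog: "\<rho> j \<in> homog 1" for j
    using Lf by (auto simp: \<rho>_def polys_in_var homog_var[unfolded One_nat_def])
  have \<rho>_id: "subst \<rho> p = p" if "p \<in> polys_in V" for p
    by (rule subst_eq_self[OF _ that]) (simp add: \<rho>_def)
  have J_sub: "J \<subseteq> polys_in V"
    unfolding J_def
  proof (rule ideal_in_subset)
    have "stanley_reisner_ideal V (link A w v) \<subseteq> polys_in V"
      unfolding stanley_reisner_ideal_def
      by (rule ideal_in_subset) (auto intro!: polys_in_prod polys_in_var)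
    then show "stanley_reisner_ideal V (link A w v) \<union> {ell q | q. q < CARD('d) - card (nsupp v)} \<subseteq> polys_in V"
      using ell by auto
  qed
  have act_Aform_ideal: "act p f = 0" if "p \<in> ideal (range (Aform A))" "f \<in> Q" for p f
    by (rule act_ideal[OF _ that(1)]) (use that(2) in \<open>auto simp: Q_def eulerian_def\<close>)
  have act_SR: "act p f = 0" if "p \<in> stanley_reisner_ideal V (link A w v)" and f: "f \<in> Q" for p f
    using that(1) unfolding stanley_reisner_ideal_def
  proof (induction rule: ideal_in_induct)
    case (step c g p)
    then obtain \<tau> where \<tau>: "g = (\<Prod>i\<in>\<tau>. var i)" "\<tau> \<subseteq> V" "\<tau> \<notin> link A w v" by auto
    then obtain s t where st: "(s, t) \<in> G" "zset v s \<subseteq> \<tau>"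
      using link_iff[of \<tau> v] by (auto simp: V_def)
    have "act (\<Prod>j\<in>zset v s. var j) f = 0" using f st(1) by (auto simp: Q_def)
    then have "act g f = 0"
      unfolding \<tau>(1) prod.subset_diff[OF st(2) finite] by (simp only: act_mult act_0_right)
    then show ?case by (simp only: act_add_left act_mult act_0_right step.IH add_0)
  qed simp
  have act_J: "act p f = 0" if "p \<in> J" and f: "f \<in> Q" for p f
    using that(1) unfolding J_def
  proof (induction rule: ideal_in_induct)
    case (step c g p)
    have "act g f = 0"
      using step.hyps(2)
    proof
      assume "g \<in> {ell q | q. q < CARD('d) - card (nsupp v)}"
      then have "g \<in> ideal (range (Aform A))"
        unfolding ideal_eq by (intro ideal_base) blast
      then show ?thesis using act_Aform_ideal f by blast
    qed (use act_SR f in blast)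
    then show ?case by (simp only: act_add_left act_mult act_0_right step.IH add_0)
  qed simp
  have \<rho>_Aform: "subst \<rho> p \<in> J" if "p \<in> ideal (range (Aform A))" for p
    using that unfolding ideal_eq
  proof (induction rule: ideal_induct)
    case zero
    show ?case by (simp add: J_def ideal_in_0)
  next
    case (step c g p)
    have "subst \<rho> g \<in> J"
      using step.hyps
    proof
      assume "g \<in> {var p - Lf p | p. p \<in> nsupp v}"
      then obtain j where "g = var j - Lf j" "j \<notin> V" by (auto simp: V_def)
      then have "subst \<rho> g = 0"
        using \<rho>_id[OF Lf(1)] by (simp add: subst_diff) (simp add: \<rho>_def)
      then show ?thesis by (simp add: J_def ideal_in_0)
    next
      assume g: "g \<in> {ell q | q. q < CARD('d) - card (nsupp v)}"
      then have "subst \<rho> g = g" using ell by (auto intro: \<rho>_id)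
      moreover have "g \<in> J" unfolding J_def using g by (intro ideal_in_base) blast
      ultimately show ?thesis by simp
    qed
    then show ?case
      unfolding subst_add subst_mult using step.IH polys_in_subst[of \<rho> V, OF \<rho>_in]
      by (auto simp: J_def intro!: ideal_in_add ideal_in_mult)
  qed
  have \<rho>_zset: "subst \<rho> (\<Prod>j\<in>zset v s. var j) \<in> J" if st: "(s, t) \<in> G" for s t
  proof -
    have "(\<Prod>j\<in>zset v s. var j) \<in> polys_in V"
      using zset_disjoint by (auto simp: V_def intro!: polys_in_prod polys_in_var)
    then have "subst \<rho> (\<Prod>j\<in>zset v s. var j) = (\<Prod>j\<in>zset v s. var j)" by (rule \<rho>_id)
    moreover have "zset v s \<notin> link A w v"
      using link_iff[OF zset_disjoint] st by blast
    then have "(\<Prod>j\<in>zset v s. var j) \<in> stanley_reisner_ideal V (link A w v)"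
      unfolding stanley_reisner_ideal_def using zset_disjoint[of s]
      by (intro ideal_in_base) (auto simp: V_def)
    then have "(\<Prod>j\<in>zset v s. var j) \<in> J"
      unfolding J_def by (intro ideal_in_base) blast
    ultimately show ?thesis by simp
  qed
  have \<rho>_cong: "subst \<rho> p - p \<in> ideal (range (Aform A))" for p
  proof (rule subst_congruent)
    fix j
    show "\<rho> j - var j \<in> ideal (range (Aform A))"
    proof (cases "j \<in> V")
      case True
      then show ?thesis by (simp add: \<rho>_def ideal_0)
    next
      case False
      then have "var j - Lf j \<in> ideal (range (Aform A))"
        unfolding ideal_eq by (intro ideal_base) (auto simp: V_def)
      from ideal_diff[OF ideal_0 this] show ?thesis
        using False by (simp add: \<rho>_def)
    qed
  qed
  let ?M = "{u :: 'n \<Rightarrow>\<^sub>0 nat. mdeg u = q}"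
  let ?MV = "{u :: 'n \<Rightarrow>\<^sub>0 nat. keys u \<subseteq> V \<and> mdeg u = q}"
  have finM: "finite ?M" by (rule finite_mdeg_eq)
  have finMV: "finite ?MV" by (rule finite_subset[OF _ finM]) auto
  have U: "polys_in V \<inter> homog q = cpoly.span (monom ` ?MV)"
    unfolding span_monom polys_in_def homog_def by blast
  \<comment> \<open>The adjoint of \<open>subst \<rho>\<close> in degree q, as
    \<open>T_pairing\<close> shows; the division by \<open>mfact u\<close> normalises the
    pairing.\<close>
  define T where "T r = (\<Sum>u\<in>?M. cscale (pairing (subst \<rho> (monom u)) r / mfact u) (monom u))" for r
  have T_lookup: "lookup (T r) u = (if mdeg u = q then pairing (subst \<rho> (monom u)) r / mfact u else 0)" for r u
    using finM by (simp add: T_def lookup_sum lookup_cscale lookup_monom when_def if_distrib cong: if_cong)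
  have T_homog: "T r \<in> homog q" for r
    by (auto simp: homog_def in_keys_iff T_lookup split: if_splits)
  have T_pairing: "pairing p (T r) = pairing (subst \<rho> p) r" if "p \<in> homog q" for p r
    using that unfolding homog_span
  proof (induction rule: cpoly.span_induct_alt)
    case (step c g p)
    then obtain u where "g = monom u" "mdeg u = q" by auto
    then have "pairing g (T r) = pairing (subst \<rho> g) r"
      by (simp add: pairing_monom T_lookup)
    with step.IH show ?case
      by (simp only: pairing_add_left pairing_cscale_left subst_add subst_cscale)
  qed simp
  let ?W = "{r \<in> polys_in V \<inter> homog q. \<forall>g\<in>J \<inter> homog q. pairing g r = 0}"
  have subJ: "cpoly.subspace (J \<inter> homog q)"
  proof (rule cpoly.subspace_inter[OF _ subspace_homog])
    show "cpoly.subspace J"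
      unfolding cpoly.subspace_def J_def cscale_def
      by (auto intro: ideal_in_0 ideal_in_add ideal_in_mult polys_in_const)
  qed
  have "cpoly.dim ?W + cpoly.dim (J \<inter> homog q) = cpoly.dim (polys_in V \<inter> homog q)"
    unfolding U by (rule dim_orthogonal[OF finMV subJ]) (use J_sub in \<open>auto simp: U[symmetric]\<close>)
  moreover have "cpoly.dim (T ` ?W) = cpoly.dim ?W"
  proof (rule dim_injective_image)
    show "T (f + g) = T f + T g" for f g
      by (simp add: T_def pairing_add_right add_divide_distrib cpoly.scale_left_distrib sum.distrib)
    show "T (cscale c f) = cscale c (T f)" for c f
      by (simp add: T_def pairing_cscale_right cpoly.scale_sum_right)
    have "cpoly.subspace (polys_in V \<inter> homog q)"
      unfolding U by (rule cpoly.subspace_span)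
    then show "cpoly.subspace ?W"
      by (auto simp: cpoly.subspace_def pairing_add_right pairing_cscale_right)
    show "inj_on T ?W"
    proof (rule inj_onI, rule poly_mapping_eqI)
      fix r r' u assume r: "r \<in> ?W" "r' \<in> ?W" "T r = T r'"
      show "lookup r u = lookup r' u"
      proof (cases "u \<in> ?MV")
        case True
        then have "subst \<rho> (monom u) = monom u"
          by (intro \<rho>_id) (auto simp: polys_in_def)
        moreover have "lookup (T r) u = lookup (T r') u" using r(3) by simp
        ultimately show ?thesis
          using True by (simp add: T_lookup pairing_monom)
      next
        case False
        moreover have "keys r \<subseteq> ?MV" "keys r' \<subseteq> ?MV"
          using r(1,2) by (auto simp: polys_in_def homog_def)
        ultimately have "u \<notin> keys r" "u \<notin> keys r'" by blast+
        then show ?thesis by (simp add: in_keys_iff)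
      qed
    qed
  qed
  moreover have "T ` ?W = Q \<inter> homog q"
  proof (intro equalityI subsetI)
    fix f assume "f \<in> T ` ?W"
    then obtain r where r: "r \<in> ?W" "f = T r" by blast
    \<comment> \<open>By adjointness, pairing \<open>monom u * p\<close> with T r is pairing the
      substituted product, an element of J, with r. Products of the wrong degree pair to 0 anyway,
      so all coefficients of \<open>act p f\<close> vanish.\<close>
    have kill: "act p f = 0" if p: "p \<in> homog k" "subst \<rho> p \<in> J" for p k
    proof (rule eq_0_if_pairing)
      fix u
      have deg: "monom u * p \<in> homog (mdeg u + k)"
        by (rule homog_mult[OF homog_monom p(1)])
      have "pairing (monom u * p) (T r) = 0"
      proof (cases "mdeg u + k = q")
        case True
        with deg have deg': "monom u * p \<in> homog q" by simp
        have "subst \<rho> (monom u * p) \<in> J"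
          unfolding subst_mult using p(2) polys_in_subst[of \<rho> V, OF \<rho>_in] by (auto simp: J_def intro: ideal_in_mult)
        moreover have "subst \<rho> (monom u * p) \<in> homog q"
          by (rule homog_subst[OF \<rho>_homog deg'])
        ultimately show ?thesis
          using r(1) by (simp add: T_pairing[OF deg'])
      next
        case False
        then show ?thesis by (intro pairing_homog_neq[OF deg T_homog])
      qed
      then show "pairing (monom u) (act p f) = 0"
        by (simp add: pairing_mult r(2))
    qed
    have "act (Aform A i) f = 0" for i
      by (rule kill[OF homog_Aform \<rho>_Aform]) (auto intro: ideal_base)
    moreover have "act (\<Prod>j\<in>zset v s. var j) f = 0" if "(s, t) \<in> G" for s t
      by (rule kill[OF homog_prod_var \<rho>_zset[OF that]])
    ultimately show "f \<in> Q \<inter> homog q"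
      using T_homog r(2) by (auto simp: Q_def eulerian_def)
  next
    fix f assume f: "f \<in> Q \<inter> homog q"
    define r where "r = Poly_Mapping.mapp (\<lambda>u c. c when keys u \<subseteq> V) f"
    have r_lookup: "lookup r u = (lookup f u when keys u \<subseteq> V)" for u
      by (auto simp: r_def lookup_mapp when_def in_keys_iff)
    have r_U: "r \<in> polys_in V \<inter> homog q"
    proof -
      have "keys r \<subseteq> {u \<in> keys f. keys u \<subseteq> V}"
        by (auto simp: in_keys_iff[of _ r] in_keys_iff[of _ f] r_lookup when_def split: if_splits)
      with f show ?thesis by (auto simp: polys_in_def homog_def)
    qed
    have r_pairing: "pairing g r = pairing g f" if "g \<in> polys_in V" for g
      unfolding pairing_eq using that by (intro sum.cong) (auto simp: r_lookup polys_in_def)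
    have "pairing g r = 0" if "g \<in> J \<inter> homog q" for g
    proof -
      have "act g f = 0" using act_J that f by blast
      then have "pairing g f = 0" by (simp add: pairing_def)
      moreover have "g \<in> polys_in V" using that J_sub by blast
      ultimately show ?thesis by (simp add: r_pairing)
    qed
    with r_U have "r \<in> ?W" by blast
    \<comment> \<open>Since \<open>\<rho>\<close> moves a monomial only by the Euler ideal, which
      annihilates f, the pairings of f with all monomials are determined by its terms in V.\<close>
    moreover have "T r = f"
    proof (rule poly_mapping_eqI)
      fix u
      show "lookup (T r) u = lookup f u"
      proof (cases "mdeg u = q")
        case True
        have "act (subst \<rho> (monom u) - monom u) f = 0"
          using act_Aform_ideal[OF \<rho>_cong] f by blast
        then have "pairing (subst \<rho> (monom u) - monom u) f = 0"
          by (simp add: pairing_def)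
        then have "pairing (subst \<rho> (monom u)) f = mfact u * lookup f u"
          by (simp add: pairing_diff_left pairing_monom)
        then show ?thesis
          using True by (simp add: T_lookup r_pairing[OF polys_in_subst[of \<rho>, OF \<rho>_in]])
      next
        case False
        with f have "u \<notin> keys f" by (auto simp: homog_def)
        with False show ?thesis by (simp add: T_lookup in_keys_iff)
      qed
    qed
    ultimately show "f \<in> T ` ?W" by blast
  qed
  ultimately show ?thesis by simp
qed

end

theorem corollary4p8:
  fixes A :: "int ^ 'n ^ 'd"
    and \<beta> :: "complex ^ 'd"
    and w :: "real ^ 'n"
    and v :: "complex ^ 'n"
    and G :: "(('n::finite \<Rightarrow>\<^sub>0 nat) \<times> ('n \<Rightarrow>\<^sub>0 nat)) set"
    and h :: nat
    and b :: "nat \<Rightarrow> int ^ 'n"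
    and Lf :: "'n \<Rightarrow> 'n cpoly"
    and ell :: "nat \<Rightarrow> 'n cpoly"
  assumes "rank (map_matrix of_int A :: rat ^ 'n ^ 'd::finite) = CARD('d)"
    and "\<exists>(c :: rat ^ 'd) r. c \<noteq> 0 \<and> r \<noteq> 0 \<and> (\<forall>j. (\<Sum>i\<in>UNIV. c $ i * of_int (A $ i $ j)) = r)"
    and "generic_weight A w"
    and "fake_exponent A \<beta> w v"
    and "row_reduction A (nsupp v) Lf ell"
    and "binomial_groebner_basis A w G"
    and "h = CARD('n) - CARD('d)"
    and "Z_basis h b (kerZ A)"
    and "P_ideal A v G h b = (\<lambda>p. m_elem A v G h b * p) ` PB_ideal v G h b"
  shows "Abs_fps (\<lambda>q. int (cpoly.dim (Cv_deg A \<beta> w v q))) = H_series A w v ell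
    \<and> (finite {q. Cv_deg A \<beta> w v q \<noteq> {0}} \<and> {q. Cv_deg A \<beta> w v q \<noteq> {0}} \<noteq> {}
        \<and> Max {q. Cv_deg A \<beta> w v q \<noteq> {0}} = fdeg A w v ell)
    \<and> ((\<exists>S. finite S \<and> Cv A \<beta> w v \<subseteq> cpoly.span S)
        \<and> int (cpoly.dim (Cv A \<beta> w v)) = poly (H_poly A w v ell) 1)"
proof -
  interpret frobenius A w G \<beta> v h b
    by unfold_locales (rule assms)+
  define D where "D q = int (cpoly.dim (Q \<inter> homog q))" for q
  have Cv_deg: "Cv_deg A \<beta> w v q = Q \<inter> homog q" for q
    by (simp add: Cv_deg_def Cv_eq_Q)
  have series: "Abs_fps D = H_series A w v ell"
  proof (rule fps_ext)
    fix q
    show "fps_nth (Abs_fps D) q = fps_nth (H_series A w v ell) q"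
      using dim_Q_homog[OF assms(5), of q]
      by (simp add: H_series_def quotient_hilbert_series_def D_def)
  qed
  obtain N where N: "\<And>f u. f \<in> Q \<Longrightarrow> u \<in> keys f \<Longrightarrow> mdeg u < N"
    using Q_bounded by blast
  have D_0_iff: "D q = 0 \<longleftrightarrow> Q \<inter> homog q = {0}" for q
    unfolding D_def of_nat_eq_0_iff
    by (rule dim_eq_0_homog[of _ q]) (auto simp: homog_0 cpoly.subspace_0[OF subspace_Q])
  have D_0: "D q = 0" if "N \<le> q" for q
  proof -
    have "f = 0" if f: "f \<in> Q \<inter> homog q" for f
    proof (rule ccontr)
      assume "f \<noteq> 0"
      then obtain u where u: "u \<in> keys f" by (metis keys_eq_empty all_not_in_conv)
      with f have "mdeg u = q" by (auto simp: homog_def)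
      with N[of f u] f u \<open>N \<le> q\<close> show False by auto
    qed
    then show ?thesis
      unfolding D_0_iff using homog_0 cpoly.subspace_0[OF subspace_Q] by blast
  qed
  \<comment> \<open>The series stops before degree N, so this polynomial is the one picked out by
    the description in \<open>H_poly\<close>.\<close>
  define p where "p = (\<Sum>q<N. Polynomial.monom (D q) q)"
  have coeff_p: "coeff p q = D q" for q
    using D_0[of q] by (auto simp: p_def coeff_sum not_less)
  have "fps_of_poly p = H_series A w v ell"
    unfolding series[symmetric] by (rule fps_ext) (simp add: coeff_p)
  then have p: "H_poly A w v ell = p"
    unfolding H_poly_def by (metis (mono_tags, lifting) fps_of_poly_eq_iff the_equality)
  have X: "{q. Cv_deg A \<beta> w v q \<noteq> {0}} = {q. D q \<noteq> 0}"
    by (simp add: Cv_deg D_0_iff)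
  have fin: "finite {q. D q \<noteq> 0}"
    by (rule finite_subset[of _ "{..<N}"]) (use D_0 in \<open>auto simp: not_le[symmetric]\<close>)
  \<comment> \<open>The constants make p nonzero, so its degree is attained by a nonzero
    coefficient.\<close>
  have "1 \<in> Q \<inter> homog 0" using one_in_Q homog_1 by blast
  then have "D 0 \<noteq> 0"
    unfolding D_0_iff using one_neq_zero by (metis singletonD)
  then have "p \<noteq> 0" using coeff_p[of 0] by auto
  have Max: "Max {q. D q \<noteq> 0} = fdeg A w v ell"
  proof (rule Max_eqI[OF fin])
    show "q \<le> fdeg A w v ell" if "q \<in> {q. D q \<noteq> 0}" for q
      using that unfolding fdeg_def p by (auto intro: le_degree simp: coeff_p)
    show "fdeg A w v ell \<in> {q. D q \<noteq> 0}"
      using \<open>p \<noteq> 0\<close> unfolding fdeg_def p by (simp flip: coeff_p)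
  qed
  have graded: "\<exists>S. finite S \<and> Q \<subseteq> cpoly.span S" "cpoly.dim Q = (\<Sum>q<N. cpoly.dim (Q \<inter> homog q))"
    by (rule dim_graded[OF subspace_Q]; use hcomp_Q N in blast)+
  show ?thesis
  proof (intro conjI)
    show "Abs_fps (\<lambda>q. int (cpoly.dim (Cv_deg A \<beta> w v q))) = H_series A w v ell"
      using series by (simp only: Cv_deg D_def[abs_def])
    show "finite {q. Cv_deg A \<beta> w v q \<noteq> {0}}" "Max {q. Cv_deg A \<beta> w v q \<noteq> {0}} = fdeg A w v ell"
      unfolding X by (fact fin Max)+
    show "{q. Cv_deg A \<beta> w v q \<noteq> {0}} \<noteq> {}"
      unfolding X using \<open>D 0 \<noteq> 0\<close> by blast
    show "\<exists>S. finite S \<and> Cv A \<beta> w v \<subseteq> cpoly.span S"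
      unfolding Cv_eq_Q by (fact graded(1))
    show "int (cpoly.dim (Cv A \<beta> w v)) = poly (H_poly A w v ell) 1"
      by (simp add: p Cv_eq_Q graded(2) p_def poly_sum poly_monom D_def)
  qed
qed

end
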